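(* Let $\Lambda\ge\lambda>0$, $\omega=\Lambda/\lambda$, $\theta_0\in(0,\pi)$, and let $\mathcal C_0=\{(x,y)\in\mathbb R^2: y>\cos(\theta_0)\sqrt{x^2+y^2}\}$. Consider the problem $$(P)\qquad \mathcal M^-_{\lambda,\Lambda}(D^2u)=0\ \text{ in }\mathcal C_0,\qquad u=0\ \text{ on }\partial\mathcal C_0\setminus\{0\}.$$ Let $g_\omega, G_{\omega,\alpha}, h_\omega, H_{\omega,\alpha}$ be the functions defined in the context and let $\rho=\sqrt{x^2+y^2}$, $\theta=\arccos(y/\rho)$. (1) Up to multiplication by positive constants, the positive homogeneous solutions of $(P)$ are $$u_{\alpha^\pm}=\rho^{\alpha^\pm}\phi_{\alpha^\pm}(\theta),$$ where the exponents $\alpha^-<0<\alpha^+$ satisfy $g_\omega(\alpha^\pm)=\theta_0$ and the angular parts are given, for $\theta\in[0,\theta_0]$, as follows. With $X=G_{\omega,\alpha^+}^{-1}(\theta)$, $$\phi_{\alpha^+}(\theta)=\frac{(1-X^2)\left(1+\frac{\omega(\alpha^+-1+1/\omega)}{\alpha^+-1+\omega}X^2\right)^{\frac{\alpha^+-2}{2}}}{(1+\omega X^2)^{\alpha^+/2}}\quad\text{if }\theta_0\le\frac{\pi}{2},$$ $$\phi_{\alpha^+}(\theta)=\frac{(1-X^2)\left(1+\frac{\alpha^+-1+\omega}{\omega(\alpha^+-1+1/\omega)}X^2\right)^{\frac{\alpha^+-2}{2}}}{(1+\frac1\omega X^2)^{\alpha^+/2}}\quad\text{if }\theta_0>\frac{\pi}{2};$$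 and, with $X=G_{\omega,\alpha^-}^{-1}(\theta)$, $$\phi_{\alpha^-}(\theta)=\frac{(1-X^2)\left(1+\frac{\omega(\alpha^--1+1/\omega)}{\alpha^--1+\omega}X^2\right)^{\frac{\alpha^--2}{2}}}{(1+\omega X^2)^{\alpha^-/2}}.$$ (2) Up to multiplication by positive constants, the negative homogeneous solutions of $(P)$ are $$v_{\beta^\pm}=-\rho^{\beta^\pm}\psi_{\beta^\pm}(\theta),$$ where the exponents $\beta^-<0<\beta^+$ satisfy $h_\omega(\beta^\pm)=\theta_0$ and the angular parts are given, for $\theta\in[0,\theta_0]$, as follows. With $Y=H_{\omega,\beta^+}^{-1}(\theta)$, $$\psi_{\beta^+}(\theta)=\frac{(1-Y^2)\left(1+\frac{\beta^+-1+\omega}{\omega(\beta^+-1+1/\omega)}Y^2\right)^{\frac{\beta^+-2}{2}}}{(1+\frac1\omega Y^2)^{\beta^+/2}}\quad\text{if }\theta_0\le\frac{\pi}{2},$$ $$\psi_{\beta^+}(\theta)=\frac{(1-Y^2)\left(1+\frac{\omega(\beta^+-1+1/\omega)}{\beta^+-1+\omega}Y^2\right)^{\frac{\beta^+-2}{2}}}{(1+\omega Y^2)^{\beta^+/2}}\quad\text{if }\theta_0>\frac{\pi}{2};$$ and, with $Y=H_{\omega,\beta^-}^{-1}(\theta)$, $$\psi_{\beta^-}(\theta)=\frac{(1-Y^2)\left(1+\frac{\beta^--1+\omega}{\omega(\beta^--1+1/\omega)}Y^2\right)^{\frac{\beta^--2}{2}}}{(1+\frac1\omega Y^2)^{\b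eta^-/2}}.$$
   Context: For a symmetric real matrix $M$ with eigenvalues $\mu_i$ (counted with multiplicity), the Pucci operator is $\mathcal M^-_{\lambda,\Lambda}(M)=\lambda\sum_{\mu_i>0}\mu_i+\Lambda\sum_{\mu_i<0}\mu_i$. A homogeneous solution of $(P)$ is a function, continuous on $\overline{\mathcal C_0}\setminus\{0\}$, homogeneous of some degree $\alpha\in\mathbb R$ (i.e. $u=\rho^\alpha$ times a function of the direction), which solves the equation in $\mathcal C_0$ in the viscosity sense and vanishes on $\partial\mathcal C_0\setminus\{0\}$; positive/negative means positive/negative in $\mathcal C_0$. Write $A=\alpha-1+\frac1\omega$, $B=\alpha-1+\omega$. The function $g_\omega:(-\infty,1-\omega)\cup(1-\frac1\omega,+\infty)\to(0,+\infty)$ and, for each $\alpha$ in this domain, the strictly increasing function $G_{\omega,\alpha}:[0,1]\to[0,g_\omega(\alpha)]$ are given by $g_\omega(\alpha)=G_{\omega,\alpha}(1)$ and - if $\alpha\ge1$: $G_{\omega,\alpha}(x)=\arctan(\sqrt\omega\,x)+\frac{2-\alpha}{\sqrt{AB}}\arctan\left(\sqrt{\frac{\omega A}{B}}\,x\right)$; - if $1-\frac1\omega<\alpha<1$: $G_{\omega,\alpha}(x)=\arctan\left(\frac{x}{\sqrt\omega}\right)+\frac{2-\alpha}{\sqrt{AB}}\arctan\left(\sqrt{\frac{B}{\omega A}}\,x\right)$; - if $\alpha<1-\omega$: $G_{\omega,\alpha}(x)=-\arctan(\sqrt\omega\,x)+\frac{2-\alpha}{\sqrt{AB}}\arctan\left(\sqrt{\frac{\omega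 A}{B}}\,x\right)$. The function $h_\omega:(-\infty,0)\cup(0,+\infty)\to(0,+\infty)$ and, for each $\alpha\neq0$, the strictly increasing function $H_{\omega,\alpha}:[0,1]\to[0,h_\omega(\alpha)]$ are given by $h_\omega(\alpha)=H_{\omega,\alpha}(1)$ and - if $\alpha\ge1$: $H_{\omega,\alpha}(x)=\arctan\left(\frac{x}{\sqrt\omega}\right)+\frac{2-\alpha}{\sqrt{AB}}\arctan\left(\sqrt{\frac{B}{\omega A}}\,x\right)$; - if $1-\frac1\omega<\alpha<1$: $H_{\omega,\alpha}(x)=\arctan(\sqrt\omega\,x)+\frac{2-\alpha}{\sqrt{AB}}\arctan\left(\sqrt{\frac{\omega A}{B}}\,x\right)$; - if $0<\alpha\le1-\frac1\omega$: $H_{\omega,\alpha}(x)=\arctan(\sqrt\omega\,x)+\frac{2-\alpha}{\sqrt{-AB}}\,\mathrm{arctanh}\left(\sqrt{-\frac{\omega A}{B}}\,x\right)$; - if $1-\omega\le\alpha<0$: $H_{\omega,\alpha}(x)=-\arctan\left(\frac{x}{\sqrt\omega}\right)+\frac{2-\alpha}{\sqrt{-AB}}\,\mathrm{arctanh}\left(\sqrt{-\frac{B}{\omega A}}\,x\right)$; - if $\alpha<1-\omega$: $H_{\omega,\alpha}(x)=-\arctan\left(\frac{x}{\sqrt\omega}\right)+\frac{2-\alpha}{\sqrt{AB}}\arctan\left(\sqrt{\frac{B}{\omega A}}\,x\right)$. At $\alpha=1-\frac1\omega$ (where $A=0$) and $\alpha=1-\omega$ (where $B=0$), with $\omega>1$,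 the second terms are understood as their limits, namely $\frac{(2-\alpha)\sqrt\omega\,x}{B}$ and $\frac{(2-\alpha)x}{\sqrt\omega\,|A|}$ respectively. The function $g_\omega$ is strictly increasing on $(-\infty,1-\omega)$ and strictly decreasing on $(1-\frac1\omega,+\infty)$; $h_\omega$ is strictly increasing on $(-\infty,0)$ and strictly decreasing on $(0,+\infty)$. *)

theory Defs
  imports "HOL-Analysis.Analysis"
begin

definition eigenspace :: "real^'n^'n \<Rightarrow> real \<Rightarrow> (real^'n) set" where
  "eigenspace M \<mu> = {v. M *v v = \<mu> *\<^sub>R v}"

definition eigenvalues :: "real^'n^'n \<Rightarrow> real set" where
  "eigenvalues M = {\<mu>. \<exists>v. v \<noteq> 0 \<and> v \<in> eigenspace M \<mu>}"

(* The multiplicity of an eigenvalue is the dimension of its eigenspace; the operator is only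
   meant for symmetric M, where this is also the algebraic multiplicity. *)
definition pucci_minus :: "real \<Rightarrow> real \<Rightarrow> real^'n^'n \<Rightarrow> real" where
  "pucci_minus lam Lam M =
     lam * (\<Sum>\<mu> \<in> {\<mu> \<in> eigenvalues M. 0 < \<mu>}. real (dim (eigenspace M \<mu>)) * \<mu>)
   + Lam * (\<Sum>\<mu> \<in> {\<mu> \<in> eigenvalues M. \<mu> < 0}. real (dim (eigenspace M \<mu>)) * \<mu>)"

(* On the open set U, \<phi> is of class C^2 and H is its Hessian matrix (g is its gradient). *)
definition C2_with_hessian ::
    "(real^'n) set \<Rightarrow> (real^'n \<Rightarrow> real) \<Rightarrow> (real^'n \<Rightarrow> real^'n^'n) \<Rightarrow> bool" where
  "C2_with_hessian U \<phi> H \<longleftrightarrow> continuous_on U H \<and>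
     (\<exists>g :: real^'n \<Rightarrow> real^'n. \<forall>x\<in>U.
        (\<phi> has_derivative (\<lambda>h. g x \<bullet> h)) (at x) \<and>
        (g has_derivative (\<lambda>h. H x *v h)) (at x))"

(* Sign convention for F(D^2 u) = 0 with F nondecreasing in the matrix argument, such as
   pucci_minus: F \<ge> 0 for subsolutions (test functions touching u from above) and F \<le> 0 for
   supersolutions (test functions touching u from below). *)
definition viscosity_subsolution ::
    "(real^'n^'n \<Rightarrow> real) \<Rightarrow> (real^'n) set \<Rightarrow> (real^'n \<Rightarrow> real) \<Rightarrow> bool" where
  "viscosity_subsolution F \<Omega> u \<longleftrightarrow>
     (\<forall>U \<phi> H x0. open U \<and> x0 \<in> U \<and> U \<subseteq> \<Omega> \<and> C2_with_hessian U \<phi> H \<and>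
        (\<forall>x\<in>U. u x - \<phi> x \<le> u x0 - \<phi> x0) \<longrightarrow> F (H x0) \<ge> 0)"

definition viscosity_supersolution ::
    "(real^'n^'n \<Rightarrow> real) \<Rightarrow> (real^'n) set \<Rightarrow> (real^'n \<Rightarrow> real) \<Rightarrow> bool" where
  "viscosity_supersolution F \<Omega> u \<longleftrightarrow>
     (\<forall>U \<phi> H x0. open U \<and> x0 \<in> U \<and> U \<subseteq> \<Omega> \<and> C2_with_hessian U \<phi> H \<and>
        (\<forall>x\<in>U. u x - \<phi> x \<ge> u x0 - \<phi> x0) \<longrightarrow> F (H x0) \<le> 0)"

definition viscosity_solution ::
    "(real^'n^'n \<Rightarrow> real) \<Rightarrow> (real^'n) set \<Rightarrow> (real^'n \<Rightarrow> real) \<Rightarrow> bool" where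
  "viscosity_solution F \<Omega> u \<longleftrightarrow>
     continuous_on \<Omega> u \<and> viscosity_subsolution F \<Omega> u \<and> viscosity_supersolution F \<Omega> u"

definition sector :: "real \<Rightarrow> (real^2) set" where
  "sector \<theta>0 = {p. p $ 2 > cos \<theta>0 * norm p}"

definition polar_angle :: "real^2 \<Rightarrow> real" where
  "polar_angle p = arccos (p $ 2 / norm p)"

definition homogeneous_on :: "(real^'n) set \<Rightarrow> real \<Rightarrow> (real^'n \<Rightarrow> real) \<Rightarrow> bool" where
  "homogeneous_on S \<alpha> u \<longleftrightarrow>
     (\<exists>f :: real^'n \<Rightarrow> real. \<forall>p\<in>S. u p = norm p powr \<alpha> * f (p /\<^sub>R norm p))"

(* Only the values of u on the closed sector minus its vertex matter. *)
definition homogeneous_solution :: "real \<Rightarrow> real \<Rightarrow> real \<Rightarrow> (real^2 \<Rightarrow> real) \<Rightarrow> bool" where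
  "homogeneous_solution lam Lam \<theta>0 u \<longleftrightarrow>
     continuous_on (closure (sector \<theta>0) - {0}) u \<and>
     (\<exists>\<alpha>. homogeneous_on (closure (sector \<theta>0) - {0}) \<alpha> u) \<and>
     viscosity_solution (pucci_minus lam Lam) (sector \<theta>0) u \<and>
     (\<forall>p \<in> frontier (sector \<theta>0) - {0}. u p = 0)"

definition positive_homogeneous_solution :: "real \<Rightarrow> real \<Rightarrow> real \<Rightarrow> (real^2 \<Rightarrow> real) \<Rightarrow> bool" where
  "positive_homogeneous_solution lam Lam \<theta>0 u \<longleftrightarrow>
     homogeneous_solution lam Lam \<theta>0 u \<and> (\<forall>p \<in> sector \<theta>0. u p > 0)"

definition negative_homogeneous_solution :: "real \<Rightarrow> real \<Rightarrow> real \<Rightarrow> (real^2 \<Rightarrow> real) \<Rightarrow> bool" where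
  "negative_homogeneous_solution lam Lam \<theta>0 u \<longleftrightarrow>
     homogeneous_solution lam Lam \<theta>0 u \<and> (\<forall>p \<in> sector \<theta>0. u p < 0)"

definition coefA :: "real \<Rightarrow> real \<Rightarrow> real" where
  "coefA \<omega> \<alpha> = \<alpha> - 1 + 1 / \<omega>"

definition coefB :: "real \<Rightarrow> real \<Rightarrow> real" where
  "coefB \<omega> \<alpha> = \<alpha> - 1 + \<omega>"

definition g_dom :: "real \<Rightarrow> real set" where
  "g_dom \<omega> = {..< 1 - \<omega>} \<union> {1 - 1 / \<omega> <..}"

(* Meaningful for \<alpha> in g_dom \<omega> only; there the last branch is the case \<alpha> < 1 - \<omega>. *)
definition G_fun :: "real \<Rightarrow> real \<Rightarrow> real \<Rightarrow> real" where
  "G_fun \<omega> \<alpha> x = (let A = coefA \<omega> \<alpha>; B = coefB \<omega> \<alpha> in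
     if \<alpha> \<ge> 1 then
       arctan (sqrt \<omega> * x) + (2 - \<alpha>) / sqrt (A * B) * arctan (sqrt (\<omega> * A / B) * x)
     else if 1 - 1 / \<omega> < \<alpha> then
       arctan (x / sqrt \<omega>) + (2 - \<alpha>) / sqrt (A * B) * arctan (sqrt (B / (\<omega> * A)) * x)
     else
       - arctan (sqrt \<omega> * x) + (2 - \<alpha>) / sqrt (A * B) * arctan (sqrt (\<omega> * A / B) * x))"

definition g_fun :: "real \<Rightarrow> real \<Rightarrow> real" where
  "g_fun \<omega> \<alpha> = G_fun \<omega> \<alpha> 1"

definition h_dom :: "real set" where
  "h_dom = {..<0} \<union> {0<..}"

(* Meaningful for \<alpha> in h_dom only. At \<alpha> = 1 - 1/\<omega> (A = 0) and \<alpha> = 1 - \<omega> (B = 0) the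
   second summand is the limit of the neighbouring expressions. *)
definition H_fun :: "real \<Rightarrow> real \<Rightarrow> real \<Rightarrow> real" where
  "H_fun \<omega> \<alpha> x = (let A = coefA \<omega> \<alpha>; B = coefB \<omega> \<alpha> in
     if \<alpha> \<ge> 1 then
       arctan (x / sqrt \<omega>) + (2 - \<alpha>) / sqrt (A * B) * arctan (sqrt (B / (\<omega> * A)) * x)
     else if 1 - 1 / \<omega> < \<alpha> then
       arctan (sqrt \<omega> * x) + (2 - \<alpha>) / sqrt (A * B) * arctan (sqrt (\<omega> * A / B) * x)
     else if \<alpha> = 1 - 1 / \<omega> then
       arctan (sqrt \<omega> * x) + (2 - \<alpha>) * sqrt \<omega> * x / B
     else if 0 < \<alpha> then
       arctan (sqrt \<omega> * x) + (2 - \<alpha>) / sqrt (- (A * B)) * artanh (sqrt (- (\<omega> * A / B)) * x)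
     else if 1 - \<omega> < \<alpha> then
       - arctan (x / sqrt \<omega>) + (2 - \<alpha>) / sqrt (- (A * B)) * artanh (sqrt (- (B / (\<omega> * A))) * x)
     else if \<alpha> = 1 - \<omega> then
       - arctan (x / sqrt \<omega>) + (2 - \<alpha>) * x / (sqrt \<omega> * \<bar>A\<bar>)
     else
       - arctan (x / sqrt \<omega>) + (2 - \<alpha>) / sqrt (A * B) * arctan (sqrt (B / (\<omega> * A)) * x))"

definition h_fun :: "real \<Rightarrow> real \<Rightarrow> real" where
  "h_fun \<omega> \<alpha> = H_fun \<omega> \<alpha> 1"

definition G_inv :: "real \<Rightarrow> real \<Rightarrow> real \<Rightarrow> real" where
  "G_inv \<omega> \<alpha> = inv_into {0..1} (G_fun \<omega> \<alpha>)"

definition H_inv :: "real \<Rightarrow> real \<Rightarrow> real \<Rightarrow> real" where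
  "H_inv \<omega> \<alpha> = inv_into {0..1} (H_fun \<omega> \<alpha>)"

(* The two algebraic profiles from which all angular parts are built; they are exchanged by
   \<omega> \<mapsto> 1/\<omega>. *)
definition profile1 :: "real \<Rightarrow> real \<Rightarrow> real \<Rightarrow> real" where
  "profile1 \<omega> \<alpha> X =
     (1 - X\<^sup>2) * (1 + \<omega> * (\<alpha> - 1 + 1 / \<omega>) / (\<alpha> - 1 + \<omega>) * X\<^sup>2) powr ((\<alpha> - 2) / 2)
       / (1 + \<omega> * X\<^sup>2) powr (\<alpha> / 2)"

definition profile2 :: "real \<Rightarrow> real \<Rightarrow> real \<Rightarrow> real" where
  "profile2 \<omega> \<alpha> X =
     (1 - X\<^sup>2) * (1 + (\<alpha> - 1 + \<omega>) / (\<omega> * (\<alpha> - 1 + 1 / \<omega>)) * X\<^sup>2) powr ((\<alpha> - 2) / 2)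
       / (1 + 1 / \<omega> * X\<^sup>2) powr (\<alpha> / 2)"

definition phi_plus :: "real \<Rightarrow> real \<Rightarrow> real \<Rightarrow> real \<Rightarrow> real" where
  "phi_plus \<omega> \<theta>0 \<alpha> \<theta> =
     (if \<theta>0 \<le> pi / 2 then profile1 \<omega> \<alpha> (G_inv \<omega> \<alpha> \<theta>) else profile2 \<omega> \<alpha> (G_inv \<omega> \<alpha> \<theta>))"

definition phi_minus :: "real \<Rightarrow> real \<Rightarrow> real \<Rightarrow> real" where
  "phi_minus \<omega> \<alpha> \<theta> = profile1 \<omega> \<alpha> (G_inv \<omega> \<alpha> \<theta>)"

definition psi_plus :: "real \<Rightarrow> real \<Rightarrow> real \<Rightarrow> real \<Rightarrow> real" where
  "psi_plus \<omega> \<theta>0 \<beta> \<theta> =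
     (if \<theta>0 \<le> pi / 2 then profile2 \<omega> \<beta> (H_inv \<omega> \<beta> \<theta>) else profile1 \<omega> \<beta> (H_inv \<omega> \<beta> \<theta>))"

definition psi_minus :: "real \<Rightarrow> real \<Rightarrow> real \<Rightarrow> real" where
  "psi_minus \<omega> \<beta> \<theta> = profile2 \<omega> \<beta> (H_inv \<omega> \<beta> \<theta>)"

definition u_plus :: "real \<Rightarrow> real \<Rightarrow> real \<Rightarrow> real^2 \<Rightarrow> real" where
  "u_plus \<omega> \<theta>0 \<alpha> p = norm p powr \<alpha> * phi_plus \<omega> \<theta>0 \<alpha> (polar_angle p)"

definition u_minus :: "real \<Rightarrow> real \<Rightarrow> real^2 \<Rightarrow> real" where
  "u_minus \<omega> \<alpha> p = norm p powr \<alpha> * phi_minus \<omega> \<alpha> (polar_angle p)"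

definition v_plus :: "real \<Rightarrow> real \<Rightarrow> real \<Rightarrow> real^2 \<Rightarrow> real" where
  "v_plus \<omega> \<theta>0 \<beta> p = - (norm p powr \<beta> * psi_plus \<omega> \<theta>0 \<beta> (polar_angle p))"

definition v_minus :: "real \<Rightarrow> real \<Rightarrow> real^2 \<Rightarrow> real" where
  "v_minus \<omega> \<beta> p = - (norm p powr \<beta> * psi_minus \<omega> \<beta> (polar_angle p))"

definition positive_multiple_on ::
    "(real^'n) set \<Rightarrow> (real^'n \<Rightarrow> real) \<Rightarrow> (real^'n \<Rightarrow> real) \<Rightarrow> bool" where
  "positive_multiple_on S u w \<longleftrightarrow> (\<exists>c>0. \<forall>p\<in>S. u p = c * w p)"

end

theory Submission
  imports Defs
begin

text \<open>
  Write a positive function of degree \<alpha> as \<open>U = norm p powr \<alpha> * exp (v t)\<close>, where \<open>t\<close> is the angle from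
  the vertical axis. In the orthonormal frame of the radial and the angular direction its Hessian is
  the positive factor \<open>U / (norm p)\<^sup>2\<close> times the symmetric matrix with entries \<open>\<alpha> * (\<alpha> - 1)\<close>,
  \<open>(\<alpha> - 1) * v'\<close> and \<open>\<alpha> + v'' + v'\<^sup>2\<close>. Hence the equation becomes a second order equation for \<open>v\<close> that
  contains neither \<open>t\<close> nor \<open>v\<close> and is strictly increasing in \<open>v''\<close>. The proof has four parts.

  \<^item> Exact solutions. A symmetric matrix of order two is annihilated by the operator exactly when its
    eigenvalues are \<open>\<omega> * m\<close> and \<open>- m\<close> with \<open>m \<ge> 0\<close>. Parametrising the slope by
    \<open>v' = - \<bar>\<alpha>\<bar> * (k + 1) * X / (sqrt k * (1 - X\<^sup>2))\<close>, where \<open>k = \<omega>\<close> or \<open>k = 1 / \<omega>\<close> according to the sign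
    of the radial entry \<open>\<alpha> * (\<alpha> - 1)\<close>, makes \<open>v''\<close> a rational function of \<open>X\<close>, and the angle is then
    the primitive of the rational function \<open>angle_speed\<close>. The maps \<open>G\<close> and \<open>H\<close> of the theorem are such
    primitives, and \<open>exp v\<close> is the explicit profile (locale \<open>angular_profile\<close>). These functions are
    classical, so by symmetry of Hessians and monotonicity of the operator they are viscosity
    solutions (\<open>classical_imp_viscosity\<close>).

  \<^item> Uniqueness for a given degree. If \<open>V\<close> is an exact solution then so is every \<open>V (t - s) + c\<close>, and since
    \<open>V'' < 0\<close> the rescaled function \<open>V (\<kappa> * (t - s)) / \<kappa>\<close> is a strict supersolution for \<open>\<kappa> > 1\<close> and a
    strict subsolution for \<open>\<kappa> < 1\<close>, so that no viscosity solution can touch it from the wrong side.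
    Touching on the whole interval shows that the exact solution and the given one live on the same
    interval; comparing on smaller intervals, where \<open>s\<close> and \<open>c\<close> are chosen to match the values at
    both ends, shows that they are proportional (\<open>multiple_of_exact_solution\<close>).

  \<^item> Excluded degrees. For a degree that admits no exact solution an increasing function
    with exponentially decaying slope touches the logarithm of the angular part from above and violates the definition of a
    subsolution (\<open>weights_pos_of_angular_solution\<close>).

  \<^item> Degrees for a given aperture. The aperture, that is the angle between the axis and the boundary
    on which the exact solution of a given degree vanishes, is the integral of a density whose denominator is
    affine in the degree, so it is strictly monotone and continuous on each branch and takes every
    positive value exactly once (\<open>aperture_integral_unique_exponent\<close>). Two branches meet at degree 1,
    where the aperture is a right angle; this is why the formulas depend on \<open>\<theta>0 \<le> pi / 2\<close>.

  All of this is carried out for \<open>lam\<close> and \<open>Lam\<close> in either order, because \<open>u \<mapsto> - u\<close> exchanges them: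
  up to sign, negative solutions are the positive solutions of the problem with \<open>1 / \<omega>\<close> in place of
  \<open>\<omega>\<close>, so both halves of the theorem are instances of \<open>two_positive_solutions\<close>.
\<close>

section \<open>The Pucci operator on symmetric matrices of order two\<close>

definition pucci_weight :: "real \<Rightarrow> real \<Rightarrow> real \<Rightarrow> real" where
  "pucci_weight lam Lam \<mu> = lam * max \<mu> 0 + Lam * min \<mu> 0"

text \<open>
  The value of the operator on the matrix with rows \<open>(a, b)\<close> and \<open>(b, c)\<close>, written with the
  explicit eigenvalues; a double eigenvalue occurs in both summands.
\<close>
definition pucci_sym :: "real \<Rightarrow> real \<Rightarrow> real \<Rightarrow> real \<Rightarrow> real \<Rightarrow> real" where
  "pucci_sym lam Lam a b c =
     pucci_weight lam Lam ((a + c) / 2 + sqrt (((a - c) / 2)\<^sup>2 + b\<^sup>2)) +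
     pucci_weight lam Lam ((a + c) / 2 - sqrt (((a - c) / 2)\<^sup>2 + b\<^sup>2))"

lemma pucci_weight_less:
  assumes "0 < lam" "0 < Lam" "x < y"
  shows "pucci_weight lam Lam x < pucci_weight lam Lam y"
proof -
  have "lam * max x 0 \<le> lam * max y 0" "Lam * min x 0 \<le> Lam * min y 0"
    using assms by (auto intro!: mult_left_mono)
  moreover have "lam * max x 0 < lam * max y 0 \<or> Lam * min x 0 < Lam * min y 0"
    using assms by (cases "y > 0") (auto simp: max_def min_def zero_less_mult_iff)
  ultimately show ?thesis unfolding pucci_weight_def by linarith
qed

lemma pucci_weight_mono:
  assumes "0 < lam" "0 < Lam" "x \<le> y"
  shows "pucci_weight lam Lam x \<le> pucci_weight lam Lam y"
  using pucci_weight_less[of lam Lam x y] assms by (cases "x = y") auto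

lemma pucci_weight_scale: "0 \<le> s \<Longrightarrow> pucci_weight lam Lam (s * x) = s * pucci_weight lam Lam x"
  by (cases "x \<ge> 0") (auto simp: pucci_weight_def max_def min_def mult_nonneg_nonneg
      zero_le_mult_iff mult_le_0_iff algebra_simps)

text \<open>
  Both sums in the Pucci operator have this shape, with \<open>f\<close> the positive or the negative part. For
  a double root the matrix is scalar and its single eigenspace has dimension two; otherwise both
  eigenspaces are lines.
\<close>
lemma eigenvalue_sum:
  fixes M :: "real^2^2"
  assumes sym: "M $ 1 $ 2 = M $ 2 $ 1"
  defines "S \<equiv> sqrt (((M$1$1 - M$2$2) / 2)\<^sup>2 + (M$1$2)\<^sup>2)"
  defines "p \<equiv> (M$1$1 + M$2$2) / 2 + S" and "q \<equiv> (M$1$1 + M$2$2) / 2 - S"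
  assumes f: "f 0 = 0"
  shows "finite (eigenvalues M)"
    and "(\<Sum>\<mu> \<in> eigenvalues M. real (dim (eigenspace M \<mu>)) * f \<mu>) = f p + f q"
proof -
  have S2: "S * S = ((M$1$1 - M$2$2) / 2)\<^sup>2 + (M$1$2)\<^sup>2" and S0: "S \<ge> 0"
    by (auto simp: S_def simp flip: power2_eq_square)
  have E: "v \<in> eigenspace M \<mu> \<longleftrightarrow> (M$1$1 - \<mu>) * v$1 + M$1$2 * v$2 = 0 \<and> M$1$2 * v$1 + (M$2$2 - \<mu>) * v$2 = 0"
    for v \<mu>
    by (auto simp: eigenspace_def vec_eq_iff forall_2 matrix_vector_mult_def sum_2 sym algebra_simps)
  have cp: "(M$1$1 - \<mu>) * (M$2$2 - \<mu>) - (M$1$2)\<^sup>2 = (\<mu> - p) * (\<mu> - q)" for \<mu>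
  proof -
    have "(\<mu> - p) * (\<mu> - q) = (\<mu> - (M$1$1 + M$2$2) / 2)\<^sup>2 - S * S"
      by (simp add: p_def q_def power2_eq_square field_simps)
    then show ?thesis unfolding S2 by (simp add: power2_eq_square field_simps)
  qed
  have ev: "\<mu> \<in> eigenvalues M \<longleftrightarrow> \<mu> = p \<or> \<mu> = q" for \<mu>
  proof
    assume "\<mu> \<in> eigenvalues M"
    then obtain v where v: "v \<noteq> 0" "v \<in> eigenspace M \<mu>" by (auto simp: eigenvalues_def)
    let ?D = "(M$1$1 - \<mu>) * (M$2$2 - \<mu>) - (M$1$2)\<^sup>2"
    have e1: "(M$1$1 - \<mu>) * v$1 + M$1$2 * v$2 = 0" and e2: "M$1$2 * v$1 + (M$2$2 - \<mu>) * v$2 = 0"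
      using v E by auto
    have "?D * v$1 = (M$2$2 - \<mu>) * ((M$1$1 - \<mu>) * v$1 + M$1$2 * v$2) - M$1$2 * (M$1$2 * v$1 + (M$2$2 - \<mu>) * v$2)"
      by (simp add: power2_eq_square algebra_simps)
    moreover have "?D * v$2 = (M$1$1 - \<mu>) * (M$1$2 * v$1 + (M$2$2 - \<mu>) * v$2) - M$1$2 * ((M$1$1 - \<mu>) * v$1 + M$1$2 * v$2)"
      by (simp add: power2_eq_square algebra_simps)
    ultimately have "?D * v$1 = 0" "?D * v$2 = 0" unfolding e1 e2 by auto
    then have "?D = 0" using v(1) by (auto simp: vec_eq_iff forall_2)
    then show "\<mu> = p \<or> \<mu> = q" unfolding cp by auto
  next
    assume "\<mu> = p \<or> \<mu> = q"
    then have D: "(M$1$1 - \<mu>) * (M$2$2 - \<mu>) - (M$1$2)\<^sup>2 = 0" unfolding cp by auto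
    have "\<exists>v. v \<noteq> 0 \<and> v \<in> eigenspace M \<mu>"
    proof (cases "M$1$2 = 0 \<and> M$1$1 = \<mu>")
      case True
      then show ?thesis unfolding E
        by (intro exI[of _ "vector [1, 0]"]) (auto simp: vec_eq_iff forall_2)
    next
      case False
      then show ?thesis unfolding E using D
        by (intro exI[of _ "vector [M$1$2, \<mu> - M$1$1]"])
           (auto simp: vec_eq_iff forall_2 power2_eq_square algebra_simps)
    qed
    then show "\<mu> \<in> eigenvalues M" by (auto simp: eigenvalues_def)
  qed
  have evs: "eigenvalues M = {p, q}" using ev by auto
  then show "finite (eigenvalues M)" by simp
  have sub: "subspace (eigenspace M \<mu>)" for \<mu>
    by (auto simp: subspace_def eigenspace_def matrix_vector_right_distrib scaleR_right_distrib
        matrix_vector_mult_scaleR)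
  have nz: "dim (eigenspace M \<mu>) \<noteq> 0" if "\<mu> \<in> eigenvalues M" for \<mu>
    using that by (auto simp: eigenvalues_def dim_eq_0)
  have full: "dim (eigenspace M \<mu>) = 2 \<longleftrightarrow> M$1$1 = \<mu> \<and> M$2$2 = \<mu> \<and> M$1$2 = 0" for \<mu>
  proof -
    have "dim (eigenspace M \<mu>) = 2 \<longleftrightarrow> eigenspace M \<mu> = UNIV"
      using dim_eq_full[of "eigenspace M \<mu>"] sub[of \<mu>] by (simp add: span_eq_iff[THEN iffD2])
    also have "\<dots> \<longleftrightarrow> M$1$1 = \<mu> \<and> M$2$2 = \<mu> \<and> M$1$2 = 0"
    proof
      assume U: "eigenspace M \<mu> = UNIV"
      have "vector [1,0] \<in> eigenspace M \<mu>" "vector [0,1] \<in> eigenspace M \<mu>" using U by auto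
      then show "M$1$1 = \<mu> \<and> M$2$2 = \<mu> \<and> M$1$2 = 0" unfolding E by auto
    qed (use E in auto)
    finally show ?thesis .
  qed
  have le2: "dim (eigenspace M \<mu>) \<le> 2" for \<mu>
    using dim_subset_UNIV[of "eigenspace M \<mu>"] by simp
  show "(\<Sum>\<mu> \<in> eigenvalues M. real (dim (eigenspace M \<mu>)) * f \<mu>) = f p + f q"
  proof (cases "S = 0")
    case True
    then have "p = q" "M$1$1 = p" "M$2$2 = p" "M$1$2 = 0"
      using S2 by (auto simp: p_def q_def add_nonneg_eq_0_iff)
    then show ?thesis using full[of p] evs by simp
  next
    case False
    then have "p \<noteq> q" by (simp add: p_def q_def)
    moreover have "dim (eigenspace M \<mu>) = 1" if "\<mu> \<in> eigenvalues M" for \<mu>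
    proof -
      have "dim (eigenspace M \<mu>) \<noteq> 2" unfolding full using False by (auto simp: S_def)
      then show ?thesis using nz[OF that] le2[of \<mu>] by linarith
    qed
    ultimately show ?thesis using evs by simp
  qed
qed

lemma pucci_minus_sym:
  fixes M :: "real^2^2"
  assumes sym: "M $ 1 $ 2 = M $ 2 $ 1"
  shows "pucci_minus lam Lam M = pucci_sym lam Lam (M$1$1) (M$1$2) (M$2$2)"
proof -
  note fin = eigenvalue_sum(1)[OF sym, of "\<lambda>_. 0", simplified]
  have "(\<Sum>\<mu> \<in> {\<mu> \<in> eigenvalues M. 0 < \<mu>}. real (dim (eigenspace M \<mu>)) * \<mu>)
      = (\<Sum>\<mu> \<in> eigenvalues M. real (dim (eigenspace M \<mu>)) * max \<mu> 0)"
    by (intro sum.mono_neutral_cong_left fin) auto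
  moreover have "(\<Sum>\<mu> \<in> {\<mu> \<in> eigenvalues M. \<mu> < 0}. real (dim (eigenspace M \<mu>)) * \<mu>)
      = (\<Sum>\<mu> \<in> eigenvalues M. real (dim (eigenspace M \<mu>)) * min \<mu> 0)"
    by (intro sum.mono_neutral_cong_left fin) auto
  ultimately show ?thesis
    using eigenvalue_sum(2)[OF sym, of "\<lambda>\<mu>. max \<mu> 0"] eigenvalue_sum(2)[OF sym, of "\<lambda>\<mu>. min \<mu> 0"]
    by (simp add: pucci_minus_def pucci_sym_def pucci_weight_def algebra_simps)
qed

lemma eigenspace_uminus: "eigenspace (- M) \<mu> = eigenspace M (- \<mu>)"
  for M :: "real^'n^'n"
  by (auto simp: eigenspace_def vec_eq_iff matrix_vector_mult_def sum_negf minus_equation_iff)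

lemma pucci_minus_uminus: "pucci_minus lam Lam (- M) = - pucci_minus Lam lam M"
  for M :: "real^'n^'n"
proof -
  have ev: "\<mu> \<in> eigenvalues (- M) \<longleftrightarrow> - \<mu> \<in> eigenvalues M" for \<mu>
    by (simp add: eigenvalues_def eigenspace_uminus)
  have "(\<Sum>\<mu> \<in> {\<mu> \<in> eigenvalues (- M). 0 < \<mu>}. real (dim (eigenspace (- M) \<mu>)) * \<mu>)
      = - (\<Sum>\<mu> \<in> {\<mu> \<in> eigenvalues M. \<mu> < 0}. real (dim (eigenspace M \<mu>)) * \<mu>)"
    unfolding sum_negf[symmetric]
    by (rule sum.reindex_bij_witness[of _ uminus uminus]) (auto simp: ev eigenspace_uminus)
  moreover have "(\<Sum>\<mu> \<in> {\<mu> \<in> eigenvalues (- M). \<mu> < 0}. real (dim (eigenspace (- M) \<mu>)) * \<mu>)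
      = - (\<Sum>\<mu> \<in> {\<mu> \<in> eigenvalues M. 0 < \<mu>}. real (dim (eigenspace M \<mu>)) * \<mu>)"
    unfolding sum_negf[symmetric]
    by (rule sum.reindex_bij_witness[of _ uminus uminus]) (auto simp: ev eigenspace_uminus)
  ultimately show ?thesis by (simp add: pucci_minus_def algebra_simps)
qed

text \<open>
  The eigenvalues are half the trace plus or minus the norm of the vector \<open>((a - c) / 2, b)\<close>. The
  condition on the entries says that the difference of the matrices is positive semidefinite, and
  then this norm changes by at most half the change of the trace. So both eigenvalues increase,
  and one of them strictly if the trace does.
\<close>
lemma pucci_sym_mono:
  assumes "0 < lam" "0 < Lam" and "a \<le> a'" "c \<le> c'" "(b' - b)\<^sup>2 \<le> (a' - a) * (c' - c)"
  shows "pucci_sym lam Lam a b c \<le> pucci_sym lam Lam a' b' c'"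
    and "a + c < a' + c' \<Longrightarrow> pucci_sym lam Lam a b c < pucci_sym lam Lam a' b' c'"
proof -
  define s where "s = sqrt (((a - c) / 2)\<^sup>2 + b\<^sup>2)"
  define s' where "s' = sqrt (((a' - c') / 2)\<^sup>2 + b'\<^sup>2)"
  define d where "d = sqrt (((a' - a - (c' - c)) / 2)\<^sup>2 + (b' - b)\<^sup>2)"
  have "((a' - a - (c' - c)) / 2)\<^sup>2 + (b' - b)\<^sup>2 \<le> ((a' - a + (c' - c)) / 2)\<^sup>2"
    using assms(5) by (simp add: power2_eq_square field_simps)
  then have d: "d \<le> (a' - a + (c' - c)) / 2"
    unfolding d_def using assms by (intro real_le_lsqrt) auto
  have "s' \<le> s + d"
    using real_sqrt_sum_squares_triangle_ineq[of "(a - c) / 2" "(a' - a - (c' - c)) / 2" b "b' - b"]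
    by (simp add: s_def s'_def d_def power_divide[symmetric] del: power_divide) (simp add: field_simps)
  moreover have "s \<le> s' + d"
    using real_sqrt_sum_squares_triangle_ineq[of "(a' - c') / 2" "- ((a' - a - (c' - c)) / 2)" b' "- (b' - b)"]
    by (simp add: s_def s'_def d_def power2_commute[of b b'] del: power_divide) (simp add: field_simps)
  ultimately have le: "(a + c) / 2 + s \<le> (a' + c') / 2 + s'" "(a + c) / 2 - s \<le> (a' + c') / 2 - s'"
    using d by (auto simp: field_simps)
  show "pucci_sym lam Lam a b c \<le> pucci_sym lam Lam a' b' c'"
    unfolding pucci_sym_def s_def[symmetric] s'_def[symmetric]
    by (intro add_mono pucci_weight_mono le assms)
  assume "a + c < a' + c'"
  then have "(a + c) / 2 + s < (a' + c') / 2 + s' \<or> (a + c) / 2 - s < (a' + c') / 2 - s'"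
    by (auto simp: field_simps)
  then show "pucci_sym lam Lam a b c < pucci_sym lam Lam a' b' c'"
    unfolding pucci_sym_def s_def[symmetric] s'_def[symmetric]
    using pucci_weight_less[OF assms(1,2)] pucci_weight_mono[OF assms(1,2) le(1)]
      pucci_weight_mono[OF assms(1,2) le(2)]
    by (meson add_le_less_mono add_less_le_mono)
qed

text \<open>
  Allows changing to the frame of the radial and the angular direction without introducing
  rotation matrices.
\<close>
lemma pucci_sym_invariant:
  assumes "a + c = a' + c'" "a * c - b\<^sup>2 = a' * c' - b'\<^sup>2"
  shows "pucci_sym lam Lam a b c = pucci_sym lam Lam a' b' c'"
proof -
  have *: "((a - c) / 2)\<^sup>2 + b\<^sup>2 = ((a + c) / 2)\<^sup>2 - (a * c - b\<^sup>2)" for a b c :: real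
    by (simp add: power2_eq_square field_simps)
  show ?thesis unfolding pucci_sym_def * assms ..
qed

lemma pucci_sym_scale:
  assumes "0 \<le> s"
  shows "pucci_sym lam Lam (s * a) (s * b) (s * c) = s * pucci_sym lam Lam a b c"
proof -
  have "sqrt (((s * a - s * c) / 2)\<^sup>2 + (s * b)\<^sup>2) = sqrt (s\<^sup>2 * (((a - c) / 2)\<^sup>2 + b\<^sup>2))"
    by (simp add: power2_eq_square field_simps)
  also have "\<dots> = s * sqrt (((a - c) / 2)\<^sup>2 + b\<^sup>2)"
    using assms by (simp add: real_sqrt_mult)
  finally have *: "sqrt (((s * a - s * c) / 2)\<^sup>2 + (s * b)\<^sup>2) = s * sqrt (((a - c) / 2)\<^sup>2 + b\<^sup>2)" .
  have **: "(s * a + s * c) / 2 + s * x = s * ((a + c) / 2 + x)"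
       "(s * a + s * c) / 2 - s * x = s * ((a + c) / 2 - x)" for x
    by (simp_all add: algebra_simps add_divide_distrib)
  show ?thesis unfolding pucci_sym_def * ** by (simp only: pucci_weight_scale[OF assms]) (rule distrib_left[symmetric])
qed

lemma pucci_sym_eigenvalues:
  assumes "a + c = \<mu> + \<nu>" "a * c - b\<^sup>2 = \<mu> * \<nu>"
  shows "pucci_sym lam Lam a b c = pucci_weight lam Lam \<mu> + pucci_weight lam Lam \<nu>"
proof -
  have "pucci_sym lam Lam a b c = pucci_sym lam Lam \<mu> 0 \<nu>"
    using assms by (intro pucci_sym_invariant) auto
  also have "\<dots> = pucci_weight lam Lam \<mu> + pucci_weight lam Lam \<nu>"
    by (cases "\<mu> \<ge> \<nu>") (auto simp: pucci_sym_def algebra_simps add_divide_distrib[symmetric] diff_divide_distrib[symmetric])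
  finally show ?thesis .
qed

text \<open>Trace and determinant say that the eigenvalues are \<open>\<omega> * m\<close> and \<open>- m\<close>, whose weights cancel.\<close>
lemma pucci_sym_eq_0:
  assumes "0 < lam" "0 < Lam" "0 \<le> m" "a + c = (Lam / lam - 1) * m" "a * c - b\<^sup>2 = - (Lam / lam) * m\<^sup>2"
  shows "pucci_sym lam Lam a b c = 0"
proof -
  have "pucci_sym lam Lam a b c = pucci_weight lam Lam (Lam / lam * m) + pucci_weight lam Lam (- m)"
    using assms by (intro pucci_sym_eigenvalues) (auto simp: algebra_simps power2_eq_square)
  also have "\<dots> = 0"
    using assms(1-3) by (auto simp: pucci_weight_def max_def min_def field_simps zero_le_mult_iff mult_le_0_iff)
  finally show ?thesis .
qed

section \<open>Hessians, maximum points and classical solutions\<close>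

text \<open>
  The mean value theorem is applied to the increment in the direction \<open>j\<close>, as a function of the
  step in the direction \<open>i\<close>, and then once more to the gradient. Exchanging \<open>i\<close> and \<open>j\<close> leaves the
  left-hand side unchanged, which yields the symmetry of the Hessian.
\<close>
lemma second_difference_mvt:
  fixes \<phi> :: "real^'n \<Rightarrow> real"
  assumes g: "\<And>x. x \<in> ball x0 r \<Longrightarrow> (\<phi> has_derivative (\<lambda>h. g x \<bullet> h)) (at x)"
    and H: "\<And>x. x \<in> ball x0 r \<Longrightarrow> (g has_derivative (\<lambda>h. H x *v h)) (at x)"
    and h: "0 < h" "2 * h < r"
  shows "\<exists>z \<in> ball x0 r. dist z x0 \<le> 2 * h \<and>
     \<phi> (x0 + h *\<^sub>R axis i 1 + h *\<^sub>R axis j 1) - \<phi> (x0 + h *\<^sub>R axis i 1)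
       - \<phi> (x0 + h *\<^sub>R axis j 1) + \<phi> x0 = h\<^sup>2 * H z $ i $ j"
proof -
  define e where "e = (axis i 1 :: real^'n)"
  define f where "f = (axis j 1 :: real^'n)"
  have n: "norm e = 1" "norm f = 1" by (simp_all add: e_def f_def)
  have close: "dist (x0 + s *\<^sub>R e + t *\<^sub>R f) x0 \<le> 2 * h" if "0 \<le> s" "s \<le> h" "0 \<le> t" "t \<le> h" for s t
  proof -
    have "norm (s *\<^sub>R e + t *\<^sub>R f) \<le> s + t"
      using norm_triangle_ineq[of "s *\<^sub>R e" "t *\<^sub>R f"] n that by simp
    then show ?thesis using that by (simp add: dist_norm add.assoc)
  qed
  have in_ball: "x0 + s *\<^sub>R e + t *\<^sub>R f \<in> ball x0 r" if "0 \<le> s" "s \<le> h" "0 \<le> t" "t \<le> h" for s t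
    using close[OF that] h by (simp add: dist_commute)
  have D: "((\<lambda>s. \<phi> (x0 + s *\<^sub>R e + t *\<^sub>R f)) has_derivative (\<lambda>d. g (x0 + s *\<^sub>R e + t *\<^sub>R f) \<bullet> (d *\<^sub>R e))) (at s)"
    if "0 \<le> s" "s \<le> h" "0 \<le> t" "t \<le> h" for s t
    by (rule has_derivative_compose[of "\<lambda>s. x0 + s *\<^sub>R e + t *\<^sub>R f" "\<lambda>d. d *\<^sub>R e" s UNIV \<phi>
          "\<lambda>d. g (x0 + s *\<^sub>R e + t *\<^sub>R f) \<bullet> d", OF _ g[OF in_ball[OF that]]])
       (auto intro!: derivative_eq_intros)
  define F where "F s = \<phi> (x0 + s *\<^sub>R e + h *\<^sub>R f) - \<phi> (x0 + s *\<^sub>R e + 0 *\<^sub>R f)" for s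
  have "(F has_real_derivative (g (x0 + s *\<^sub>R e + h *\<^sub>R f) \<bullet> e - g (x0 + s *\<^sub>R e + 0 *\<^sub>R f) \<bullet> e)) (at s)"
    if "0 \<le> s" "s \<le> h" for s
    unfolding F_def[abs_def] has_field_derivative_def
    by (rule has_derivative_eq_rhs[OF has_derivative_diff[OF D D]]) (use that h in \<open>auto simp: algebra_simps\<close>)
  from MVT2[OF h(1) this]
  obtain s where s: "0 < s" "s < h"
    "F h - F 0 = (h - 0) * (g (x0 + s *\<^sub>R e + h *\<^sub>R f) \<bullet> e - g (x0 + s *\<^sub>R e + 0 *\<^sub>R f) \<bullet> e)"
    by blast
  have "((\<lambda>t. g (x0 + s *\<^sub>R e + t *\<^sub>R f) \<bullet> e) has_real_derivative (H (x0 + s *\<^sub>R e + t *\<^sub>R f) *v f) \<bullet> e) (at t)"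
    if "0 \<le> t" "t \<le> h" for t
  proof -
    have "((\<lambda>t. g (x0 + s *\<^sub>R e + t *\<^sub>R f)) has_derivative (\<lambda>d. H (x0 + s *\<^sub>R e + t *\<^sub>R f) *v (d *\<^sub>R f))) (at t)"
      by (rule has_derivative_compose[of "\<lambda>t. x0 + s *\<^sub>R e + t *\<^sub>R f" "\<lambda>d. d *\<^sub>R f" t UNIV g
            "\<lambda>d. H (x0 + s *\<^sub>R e + t *\<^sub>R f) *v d", OF _ H[OF in_ball]])
         (use that s in \<open>auto intro!: derivative_eq_intros\<close>)
    then show ?thesis unfolding has_field_derivative_def
      by (rule has_derivative_eq_rhs[OF has_derivative_inner_left]) (auto simp: matrix_vector_mult_scaleR)
  qed
  from MVT2[OF h(1) this]
  obtain t where t: "0 < t" "t < h"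
    "g (x0 + s *\<^sub>R e + h *\<^sub>R f) \<bullet> e - g (x0 + s *\<^sub>R e + 0 *\<^sub>R f) \<bullet> e = (h - 0) * ((H (x0 + s *\<^sub>R e + t *\<^sub>R f) *v f) \<bullet> e)"
    by blast
  have "(H z *v f) \<bullet> e = H z $ i $ j" for z
    by (simp add: e_def f_def inner_axis matrix_vector_mult_basis column_def)
  then have "F h - F 0 = h\<^sup>2 * H (x0 + s *\<^sub>R e + t *\<^sub>R f) $ i $ j"
    using s(3) t(3) by (simp add: power2_eq_square)
  then show ?thesis
    using in_ball[of s t] close[of s t] s t
    by (intro bexI[of _ "x0 + s *\<^sub>R e + t *\<^sub>R f"]) (auto simp: F_def e_def f_def)
qed

text \<open>
  The eigenvalue formulas are valid for symmetric matrices only, while the definition of a test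
  function provides just a derivative of its gradient.
\<close>
lemma C2_with_hessian_symmetric:
  fixes \<phi> :: "real^'n \<Rightarrow> real"
  assumes C2: "C2_with_hessian U \<phi> H" and U: "open U" "x0 \<in> U"
  shows "H x0 $ i $ j = H x0 $ j $ i"
proof (rule ccontr)
  assume ne: "H x0 $ i $ j \<noteq> H x0 $ j $ i"
  define \<epsilon> where "\<epsilon> = \<bar>H x0 $ i $ j - H x0 $ j $ i\<bar> / 2"
  have \<epsilon>: "\<epsilon> > 0" using ne by (simp add: \<epsilon>_def)
  obtain g where g: "\<And>x. x \<in> U \<Longrightarrow> (\<phi> has_derivative (\<lambda>h. g x \<bullet> h)) (at x)"
    and H: "\<And>x. x \<in> U \<Longrightarrow> (g has_derivative (\<lambda>h. H x *v h)) (at x)"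
    and cont: "continuous_on U H"
    using C2 unfolding C2_with_hessian_def by blast
  have "isCont H x0" using cont U by (simp add: continuous_on_eq_continuous_at)
  then have "isCont (\<lambda>x. H x $ k $ l) x0" for k l by (intro isCont_vec_nth)
  then have lim: "(\<lambda>x. H x $ k $ l) \<midarrow>x0\<rightarrow> H x0 $ k $ l" for k l by (simp add: isCont_def)
  obtain r where r: "r > 0" "ball x0 r \<subseteq> U" using U openE by blast
  from LIM_D[OF lim[of i j] \<epsilon>] LIM_D[OF lim[of j i] \<epsilon>]
  obtain d1 d2 where d: "d1 > 0" "d2 > 0"
    "\<And>x. x \<noteq> x0 \<Longrightarrow> norm (x - x0) < d1 \<Longrightarrow> norm (H x $ i $ j - H x0 $ i $ j) < \<epsilon>"
    "\<And>x. x \<noteq> x0 \<Longrightarrow> norm (x - x0) < d2 \<Longrightarrow> norm (H x $ j $ i - H x0 $ j $ i) < \<epsilon>"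
    by blast
  \<comment> \<open>Two steps of this length stay inside the ball on which both mixed entries are controlled.\<close>
  define h where "h = min r (min d1 d2) / 3"
  have h: "0 < h" "2 * h < r" "2 * h < d1" "2 * h < d2" using r d by (auto simp: h_def min_def)
  note sd = second_difference_mvt[of x0 r \<phi> g H, OF g H h(1,2)]
  obtain z1 where z1: "dist z1 x0 \<le> 2 * h" and e1:
     "\<phi> (x0 + h *\<^sub>R axis i 1 + h *\<^sub>R axis j 1) - \<phi> (x0 + h *\<^sub>R axis i 1)
       - \<phi> (x0 + h *\<^sub>R axis j 1) + \<phi> x0 = h\<^sup>2 * H z1 $ i $ j"
    using sd[of i j] r(2) by blast
  obtain z2 where z2: "dist z2 x0 \<le> 2 * h" and e2:
     "\<phi> (x0 + h *\<^sub>R axis j 1 + h *\<^sub>R axis i 1) - \<phi> (x0 + h *\<^sub>R axis j 1)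
       - \<phi> (x0 + h *\<^sub>R axis i 1) + \<phi> x0 = h\<^sup>2 * H z2 $ j $ i"
    using sd[of j i] r(2) by blast
  have "x0 + h *\<^sub>R axis i 1 + h *\<^sub>R axis j 1 = x0 + h *\<^sub>R axis j 1 + h *\<^sub>R axis i 1"
    by (simp add: add_ac)
  then have "h\<^sup>2 * H z1 $ i $ j = h\<^sup>2 * H z2 $ j $ i"
    unfolding e1[symmetric] e2[symmetric] by (simp only:)
  then have "H z1 $ i $ j = H z2 $ j $ i" using h by simp
  moreover have "\<bar>H z1 $ i $ j - H x0 $ i $ j\<bar> < \<epsilon>"
    using d(3)[of z1] z1 h \<epsilon> by (cases "z1 = x0") (auto simp: dist_norm)
  moreover have "\<bar>H z2 $ j $ i - H x0 $ j $ i\<bar> < \<epsilon>"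
    using d(4)[of z2] z2 h \<epsilon> by (cases "z2 = x0") (auto simp: dist_norm)
  ultimately show False unfolding \<epsilon>_def by (simp add: abs_if split: if_splits)
qed

text \<open>
  If the second derivative were positive, the first derivative would be positive to the right of
  the maximum point.
\<close>
lemma real_second_derivative_test:
  fixes f f' :: "real \<Rightarrow> real"
  assumes r: "r > 0" and f: "\<And>s. \<bar>s\<bar> < r \<Longrightarrow> (f has_real_derivative f' s) (at s)"
    and f': "(f' has_real_derivative m) (at 0)"
    and le: "\<And>s. \<bar>s\<bar> < r \<Longrightarrow> f s \<le> f 0"
  shows "m \<le> 0"
proof (rule ccontr)
  assume "\<not> m \<le> 0"
  have 0: "f' 0 = 0"
    using DERIV_local_max[of f "f' 0" 0 r] f[of 0] le r by auto
  obtain d where d: "d > 0" "\<And>h. 0 < h \<Longrightarrow> h < d \<Longrightarrow> f' 0 < f' (0 + h)"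
    using DERIV_pos_inc_right[OF f'] \<open>\<not> m \<le> 0\<close> by auto
  define h where "h = min d r / 2"
  have h: "0 < h" "h < d" "h < r" using d r by (auto simp: h_def min_def)
  obtain z where "0 < z" "z < h" "f h - f 0 = (h - 0) * f' z"
    using MVT2[of 0 h f f'] f h by force
  then show False using d(2)[of z] 0 le[of h] h
    by (simp add: mult_le_0_iff) (metis add_0 diff_gt_0_iff_gt less_trans mult_pos_pos not_le)
qed

text \<open>The second derivative test is applied on every line through the maximum point.\<close>
lemma hessian_at_max:
  fixes u \<phi> :: "real^'n \<Rightarrow> real"
  assumes "open U" "x0 \<in> U" and u: "C2_with_hessian U u K" and \<phi>: "C2_with_hessian U \<phi> H"
    and le: "\<And>x. x \<in> U \<Longrightarrow> u x - \<phi> x \<le> u x0 - \<phi> x0"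
  shows "(K x0 *v h) \<bullet> h \<le> (H x0 *v h) \<bullet> h"
proof -
  obtain gu where gu: "\<And>x. x \<in> U \<Longrightarrow> (u has_derivative (\<lambda>h. gu x \<bullet> h)) (at x)"
    and K: "\<And>x. x \<in> U \<Longrightarrow> (gu has_derivative (\<lambda>h. K x *v h)) (at x)"
    using u unfolding C2_with_hessian_def by blast
  obtain gp where gp: "\<And>x. x \<in> U \<Longrightarrow> (\<phi> has_derivative (\<lambda>h. gp x \<bullet> h)) (at x)"
    and H: "\<And>x. x \<in> U \<Longrightarrow> (gp has_derivative (\<lambda>h. H x *v h)) (at x)"
    using \<phi> unfolding C2_with_hessian_def by blast
  have "open ((\<lambda>s. x0 + s *\<^sub>R h) -` U)"
    by (intro open_vimage continuous_intros assms)
  moreover have "0 \<in> (\<lambda>s. x0 + s *\<^sub>R h) -` U" using assms by simp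
  ultimately obtain r where "r > 0" "ball 0 r \<subseteq> (\<lambda>s. x0 + s *\<^sub>R h) -` U"
    by (rule openE)
  then have r: "r > 0" "\<And>s. \<bar>s\<bar> < r \<Longrightarrow> x0 + s *\<^sub>R h \<in> U"
    by (auto simp: subset_iff dist_real_def)
  have lin: "((\<lambda>s. x0 + s *\<^sub>R h) has_derivative (\<lambda>d. d *\<^sub>R h)) (at s)" for s
    by (auto intro!: derivative_eq_intros)
  have "((\<lambda>s. u (x0 + s *\<^sub>R h) - \<phi> (x0 + s *\<^sub>R h)) has_real_derivative
      gu (x0 + s *\<^sub>R h) \<bullet> h - gp (x0 + s *\<^sub>R h) \<bullet> h) (at s)" if "\<bar>s\<bar> < r" for s
    unfolding has_field_derivative_def
    by (rule has_derivative_eq_rhs[OF has_derivative_diff[OF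
          has_derivative_compose[OF lin gu] has_derivative_compose[OF lin gp]]])
       (use r that in \<open>auto simp: algebra_simps\<close>)
  moreover have "((\<lambda>s. gu (x0 + s *\<^sub>R h) \<bullet> h - gp (x0 + s *\<^sub>R h) \<bullet> h) has_real_derivative
      (K x0 *v h) \<bullet> h - (H x0 *v h) \<bullet> h) (at 0)"
  proof -
    have "((\<lambda>s. gu (x0 + s *\<^sub>R h)) has_derivative (\<lambda>d. K x0 *v (d *\<^sub>R h))) (at 0)"
      using has_derivative_compose[OF lin[of 0], of gu "\<lambda>h. K x0 *v h"] K[OF assms(2)] by simp
    moreover have "((\<lambda>s. gp (x0 + s *\<^sub>R h)) has_derivative (\<lambda>d. H x0 *v (d *\<^sub>R h))) (at 0)"
      using has_derivative_compose[OF lin[of 0], of gp "\<lambda>h. H x0 *v h"] H[OF assms(2)] by simp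
    ultimately show ?thesis
      unfolding has_field_derivative_def
      by (rule has_derivative_eq_rhs[OF has_derivative_diff[OF has_derivative_inner_left has_derivative_inner_left]])
         (auto simp: matrix_vector_mult_scaleR algebra_simps)
  qed
  ultimately have "(K x0 *v h) \<bullet> h - (H x0 *v h) \<bullet> h \<le> 0"
    by (rule real_second_derivative_test[OF r(1)]) (use le r(2) in auto)
  then show ?thesis by simp
qed

text \<open>
  The discriminant inequality comes from the vector \<open>(q, - p)\<close>; if \<open>p = 0\<close> the form is affine in
  its first argument.
\<close>
lemma quadratic_form_nonneg:
  fixes p q r :: real
  assumes "\<And>x y. 0 \<le> p * x\<^sup>2 + 2 * q * x * y + r * y\<^sup>2"
  shows "0 \<le> p" "0 \<le> r" "q\<^sup>2 \<le> p * r"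
proof -
  show p: "0 \<le> p" using assms[of 1 0] by simp
  show r: "0 \<le> r" using assms[of 0 1] by simp
  show "q\<^sup>2 \<le> p * r"
  proof (cases "p = 0")
    case True
    have "0 \<le> 2 * q * (- (r + 1)) * q + r * q\<^sup>2" using assms[of "- (r + 1)" q] True by simp
    then have "(r + 2) * q\<^sup>2 \<le> 0" by (simp add: power2_eq_square algebra_simps)
    then show ?thesis using r True by (simp add: mult_le_0_iff)
  next
    case False
    have "0 \<le> p * q\<^sup>2 + 2 * q * q * (- p) + r * (- p)\<^sup>2" using assms[of q "- p"] by simp
    then have "0 \<le> p * (p * r - q\<^sup>2)" by (simp add: power2_eq_square algebra_simps)
    then show ?thesis using p False by (simp add: zero_le_mult_iff)
  qed
qed

lemma pucci_minus_mono:
  fixes M N :: "real^2^2"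
  assumes "0 < lam" "0 < Lam" "M $ 1 $ 2 = M $ 2 $ 1" "N $ 1 $ 2 = N $ 2 $ 1"
    and le: "\<And>h. (M *v h) \<bullet> h \<le> (N *v h) \<bullet> h"
  shows "pucci_minus lam Lam M \<le> pucci_minus lam Lam N"
proof -
  have "0 \<le> (N$1$1 - M$1$1) * x\<^sup>2 + 2 * (N$1$2 - M$1$2) * x * y + (N$2$2 - M$2$2) * y\<^sup>2" for x y
    using le[of "vector [x, y]"] assms(3,4)
    by (simp add: inner_vec_def matrix_vector_mult_def sum_2 power2_eq_square algebra_simps)
  from quadratic_form_nonneg[OF this] show ?thesis
    unfolding pucci_minus_sym[OF assms(3)] pucci_minus_sym[OF assms(4)]
    using assms(1,2) by (intro pucci_sym_mono(1)) auto
qed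

lemma C2_with_hessian_subset:
  "C2_with_hessian U \<phi> H \<Longrightarrow> V \<subseteq> U \<Longrightarrow> C2_with_hessian V \<phi> H"
  unfolding C2_with_hessian_def by (meson continuous_on_subset subsetD)

text \<open>At a touching point the Hessians are ordered, and the operator respects this order.\<close>
lemma classical_imp_viscosity:
  fixes u :: "real^2 \<Rightarrow> real"
  assumes pos: "0 < lam" "0 < Lam" and \<Omega>: "open \<Omega>"
    and u: "C2_with_hessian \<Omega> u K" and zero: "\<And>x. x \<in> \<Omega> \<Longrightarrow> pucci_minus lam Lam (K x) = 0"
  shows "viscosity_solution (pucci_minus lam Lam) \<Omega> u"
proof -
  have "continuous_on \<Omega> u"
    using u unfolding C2_with_hessian_def
    by (meson continuous_at_imp_continuous_on has_derivative_continuous)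
  moreover have "viscosity_subsolution (pucci_minus lam Lam) \<Omega> u"
    unfolding viscosity_subsolution_def
  proof (intro allI impI, elim conjE)
    fix U \<phi> H x0
    assume *: "open U" "x0 \<in> U" "U \<subseteq> \<Omega>" "C2_with_hessian U \<phi> H" "\<forall>x\<in>U. u x - \<phi> x \<le> u x0 - \<phi> x0"
    note uU = C2_with_hessian_subset[OF u *(3)]
    have "pucci_minus lam Lam (K x0) \<le> pucci_minus lam Lam (H x0)"
      by (intro pucci_minus_mono pos C2_with_hessian_symmetric[OF uU *(1,2)]
          C2_with_hessian_symmetric[OF *(4,1,2)] hessian_at_max[OF *(1,2) uU *(4)]) (use * in auto)
    then show "0 \<le> pucci_minus lam Lam (H x0)" using zero * by auto
  qed
  moreover have "viscosity_supersolution (pucci_minus lam Lam) \<Omega> u"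
    unfolding viscosity_supersolution_def
  proof (intro allI impI, elim conjE)
    fix U \<phi> H x0
    assume *: "open U" "x0 \<in> U" "U \<subseteq> \<Omega>" "C2_with_hessian U \<phi> H" "\<forall>x\<in>U. u x - \<phi> x \<ge> u x0 - \<phi> x0"
    note uU = C2_with_hessian_subset[OF u *(3)]
    have "\<phi> x - u x \<le> \<phi> x0 - u x0" if "x \<in> U" for x using *(5) that by force
    then have "pucci_minus lam Lam (H x0) \<le> pucci_minus lam Lam (K x0)"
      by (intro pucci_minus_mono pos C2_with_hessian_symmetric[OF uU *(1,2)]
          C2_with_hessian_symmetric[OF *(4,1,2)] hessian_at_max[OF *(1,2) *(4) uU])
    then show "pucci_minus lam Lam (H x0) \<le> 0" using zero * by auto
  qed
  ultimately show ?thesis by (simp add: viscosity_solution_def)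
qed

section \<open>Functions in polar form\<close>

text \<open>
  The plane without the closed negative vertical axis. It contains every closed sector considered
  here, up to the vertex.
\<close>
definition slit_plane :: "(real^2) set" where
  "slit_plane = {p. p $ 2 + norm p > 0}"

text \<open>
  The angle from the positive vertical axis, positive to the right. The half-angle formula is
  smooth on the whole slit plane, whereas \<open>polar_angle\<close>, its absolute value, is not differentiable
  on the axis of the sector.
\<close>
definition signed_angle :: "real^2 \<Rightarrow> real" where
  "signed_angle p = 2 * arctan (p $ 1 / (p $ 2 + norm p))"

definition direction :: "real \<Rightarrow> real^2" where
  "direction t = vector [sin t, cos t]"

lemma direction_nth [simp]: "direction t $ 1 = sin t" "direction t $ 2 = cos t"
  by (simp_all add: direction_def)

lemma norm_sq_2: "(norm p)\<^sup>2 = (p $ 1)\<^sup>2 + (p $ 2)\<^sup>2" for p :: "real^2"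
  by (simp add: norm_vec_def L2_set_def sum_2)

lemma norm_direction [simp]: "norm (direction t) = 1"
  by (simp add: norm_vec_def L2_set_def sum_2)

lemma slit_plane_nonzero: "p \<in> slit_plane \<Longrightarrow> p \<noteq> 0"
  by (auto simp: slit_plane_def)

lemma open_slit_plane: "open slit_plane"
  unfolding slit_plane_def by (intro open_Collect_less continuous_intros)

lemma signed_angle_bounds: "\<bar>signed_angle p\<bar> < pi"
  using arctan_bounded[of "p $ 1 / (p $ 2 + norm p)"] by (simp add: signed_angle_def abs_if)

lemma signed_angle_polar:
  assumes "p \<in> slit_plane"
  shows "norm p *\<^sub>R direction (signed_angle p) = p"
proof -
  define x y n where "x = p $ 1" and "y = p $ 2" and "n = norm p"
  define w where "w = x / (y + n)"
  have n2: "n * n = x * x + y * y" using norm_sq_2[of p] by (simp add: x_def y_def n_def power2_eq_square)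
  have pos: "y + n > 0" "n > 0" using assms slit_plane_nonzero[OF assms] by (auto simp: slit_plane_def y_def n_def)
  have c: "1 + w\<^sup>2 = 2 * n / (y + n)"
  proof -
    have "(y + n)\<^sup>2 + x\<^sup>2 = 2 * n * (y + n)" using n2 by (simp add: power2_eq_square algebra_simps)
    then show ?thesis using pos unfolding w_def
      by (simp add: power_divide field_simps) (simp add: power2_eq_square algebra_simps)
  qed
  have cos2: "(cos (arctan w))\<^sup>2 = (y + n) / (2 * n)"
    using pos by (simp add: cos_arctan power_divide c)
  have "sin (arctan w) = w * cos (arctan w)" by (simp add: cos_arctan sin_arctan)
  then have "sin (2 * arctan w) = 2 * w * (cos (arctan w))\<^sup>2"
    by (simp add: sin_double power2_eq_square)
  also have "\<dots> = x / n" unfolding cos2 using pos by (simp add: w_def)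
  finally have s: "sin (signed_angle p) = x / n" by (simp add: signed_angle_def w_def x_def y_def n_def)
  have "cos (2 * arctan w) = 2 * (cos (arctan w))\<^sup>2 - 1" by (simp add: cos_double_cos)
  also have "\<dots> = y / n" unfolding cos2 using pos by (simp add: field_simps)
  finally have "cos (signed_angle p) = y / n" by (simp add: signed_angle_def w_def x_def y_def n_def)
  with s show ?thesis using pos by (auto simp: vec_eq_iff forall_2 x_def y_def n_def)
qed

lemma direction_in_slit_plane: "\<bar>t\<bar> < pi \<Longrightarrow> direction t \<in> slit_plane"
proof -
  assume "\<bar>t\<bar> < pi"
  then have "cos \<bar>t\<bar> > cos pi" by (intro cos_monotone_0_pi) auto
  then show ?thesis by (simp add: slit_plane_def)
qed

lemma signed_angle_direction:
  assumes "\<bar>t\<bar> < pi"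
  shows "signed_angle (direction t) = t"
proof -
  have "sin t = 2 * sin (t/2) * cos (t/2)" "1 + cos t = 2 * (cos (t/2))\<^sup>2"
    using sin_double[of "t/2"] cos_double_cos[of "t/2"] by simp_all
  moreover have "cos (t/2) > 0" using assms by (intro cos_gt_zero_pi) auto
  ultimately have "sin t / (cos t + 1) = tan (t/2)"
    by (simp add: tan_def power2_eq_square add.commute)
  then show ?thesis using assms by (simp add: signed_angle_def arctan_tan)
qed

lemma norm_has_derivative_2:
  "p \<noteq> 0 \<Longrightarrow> (norm has_derivative (\<lambda>h. (p $ 1 * h $ 1 + p $ 2 * h $ 2) / norm p)) (at p)"
  for p :: "real^2"
  by (rule has_derivative_eq_rhs[OF has_derivative_norm])
     (auto simp: sgn_div_norm inner_vec_def sum_2 divide_inverse algebra_simps)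

lemma nth_has_derivative: "((\<lambda>p::real^'n. p $ i) has_derivative (\<lambda>h. h $ i)) (at p)"
  by (simp add: bounded_linear.has_derivative[OF bounded_linear_vec_nth])

lemma signed_angle_has_derivative:
  assumes "p \<in> slit_plane"
  shows "(signed_angle has_derivative (\<lambda>h. (p $ 2 * h $ 1 - p $ 1 * h $ 2) / (norm p)\<^sup>2)) (at p)"
proof -
  define x y n where "x = p $ 1" and "y = p $ 2" and "n = norm p"
  have n2: "x * x = n * n - y * y"
    using norm_sq_2[of p] by (simp add: x_def y_def n_def power2_eq_square)
  have pos: "y + n > 0" "n > 0" using assms slit_plane_nonzero[OF assms] by (auto simp: slit_plane_def y_def n_def)
  have w: "1 + (x / (y + n))\<^sup>2 = 2 * n / (y + n)"
  proof -
    have "(y + n)\<^sup>2 + x\<^sup>2 = 2 * n * (y + n)" using n2 by (simp add: power2_eq_square algebra_simps)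
    then show ?thesis using pos
      by (simp add: power_divide field_simps) (simp add: power2_eq_square algebra_simps)
  qed
  have *: "((\<lambda>p. p $ 1 / (p $ 2 + norm p)) has_derivative
      (\<lambda>h. (h $ 1 * (y + n) - x * (h $ 2 + (x * h $ 1 + y * h $ 2) / n)) / ((y + n) * (y + n)))) (at p)"
    by (rule has_derivative_eq_rhs[OF has_derivative_divide'[OF nth_has_derivative
          has_derivative_add[OF nth_has_derivative norm_has_derivative_2]]])
       (use pos in \<open>auto simp: x_def y_def n_def\<close>)
  have "((\<lambda>q. 2 * arctan (q $ 1 / (q $ 2 + norm q))) has_derivative
      (\<lambda>h. 2 * ((h $ 1 * (y + n) - x * (h $ 2 + (x * h $ 1 + y * h $ 2) / n)) / ((y + n) * (y + n))
         * inverse (1 + (p $ 1 / (p $ 2 + norm p))\<^sup>2)))) (at p)"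
    by (intro has_derivative_mult_right has_derivative_eq_rhs[OF has_derivative_compose[OF *
          DERIV_arctan[unfolded has_field_derivative_def]]]) (auto simp: fun_eq_iff mult.commute)
  moreover have "2 * ((h1 * (y + n) - x * (h2 + (x * h1 + y * h2) / n)) / ((y + n) * (y + n))
         * inverse (1 + (x / (y + n))\<^sup>2)) = (y * h1 - x * h2) / n\<^sup>2" for h1 h2
  proof -
    have "h1 * (y + n) - x * (h2 + (x * h1 + y * h2) / n)
        = (h1 * n * (y + n) - x * h2 * n - (x * x) * h1 - x * y * h2) / n"
      using pos by (simp add: field_simps)
    also have "\<dots> = (y + n) * (y * h1 - x * h2) / n"
      unfolding n2 by (simp add: algebra_simps)
    finally have eq: "h1 * (y + n) - x * (h2 + (x * h1 + y * h2) / n) = (y + n) * (y * h1 - x * h2) / n" .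
    have "2 * ((m * Z / n) / (m * m) * inverse (2 * n / m)) = Z / n\<^sup>2" if "m > 0" for m Z
      using pos that by (simp add: power2_eq_square)
    from this[OF pos(1)] show ?thesis unfolding w eq .
  qed
  ultimately show ?thesis unfolding signed_angle_def[abs_def]
    by (simp add: x_def y_def n_def)
qed

lemma continuous_on_vec2:
  fixes g :: "'a::topological_space \<Rightarrow> ('b::topological_space)^2"
  assumes "continuous_on S (\<lambda>p. g p $ 1)" "continuous_on S (\<lambda>p. g p $ 2)"
  shows "continuous_on S g"
proof -
  have "continuous_on S (\<lambda>p. g p $ i)" for i
    using assms exhaust_2[of i] by auto
  then have "continuous_on S (\<lambda>p. \<chi> i. g p $ i)" by (rule continuous_on_vec_lambda)
  then show ?thesis by simp
qed

text \<open>
  The Hessian of \<open>norm p powr \<alpha> * exp (\<psi> (signed_angle p))\<close>, where \<open>\<psi>1\<close> and \<open>\<psi>2\<close> are the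
  derivatives of \<open>\<psi>\<close>: a multiple of the symmetric tensor with entries \<open>a\<close>, \<open>b\<close>, \<open>c\<close> in the basis
  formed by \<open>p\<close> and its rotation \<open>(y, - x)\<close>.
\<close>
definition polar_hessian :: "real \<Rightarrow> (real \<Rightarrow> real) \<Rightarrow> (real \<Rightarrow> real) \<Rightarrow> (real \<Rightarrow> real) \<Rightarrow> real^2 \<Rightarrow> real^2^2" where
  "polar_hessian \<alpha> \<psi> \<psi>1 \<psi>2 p =
     (let t = signed_angle p; x = p $ 1; y = p $ 2;
          s = norm p powr \<alpha> * exp (\<psi> t) / ((norm p)\<^sup>2)\<^sup>2;
          a = \<alpha> * (\<alpha> - 1); b = (\<alpha> - 1) * \<psi>1 t; c = \<alpha> + \<psi>2 t + (\<psi>1 t)\<^sup>2;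
          m = s * (a * (x * y) + b * (y\<^sup>2 - x\<^sup>2) - c * (x * y))
      in vector [vector [s * (a * x\<^sup>2 + 2 * b * (x * y) + c * y\<^sup>2), m],
                 vector [m, s * (a * y\<^sup>2 - 2 * b * (x * y) + c * x\<^sup>2)]])"

text \<open>
  Trace and determinant of the Hessian are those of the matrix with entries \<open>a\<close>, \<open>b\<close>, \<open>c\<close>, up to
  the factor coming from the length of \<open>p\<close>.
\<close>
lemma pucci_minus_polar_hessian:
  assumes "p \<in> slit_plane"
  shows "pucci_minus lam Lam (polar_hessian \<alpha> \<psi> \<psi>1 \<psi>2 p) =
     norm p powr \<alpha> * exp (\<psi> (signed_angle p)) / (norm p)\<^sup>2 *
     pucci_sym lam Lam (\<alpha> * (\<alpha> - 1)) ((\<alpha> - 1) * \<psi>1 (signed_angle p))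
       (\<alpha> + \<psi>2 (signed_angle p) + (\<psi>1 (signed_angle p))\<^sup>2)"
proof -
  define t x y q s where "t = signed_angle p" and "x = p $ 1" and "y = p $ 2" and "q = (norm p)\<^sup>2"
    and "s = norm p powr \<alpha> * exp (\<psi> t) / q\<^sup>2"
  define a b c where "a = \<alpha> * (\<alpha> - 1)" and "b = (\<alpha> - 1) * \<psi>1 t" and "c = \<alpha> + \<psi>2 t + (\<psi>1 t)\<^sup>2"
  have q: "q = x\<^sup>2 + y\<^sup>2" "q > 0" using slit_plane_nonzero[OF assms]
    by (auto simp: x_def y_def q_def norm_sq_2[symmetric])
  have s: "s \<ge> 0" by (simp add: s_def)
  have "pucci_minus lam Lam (polar_hessian \<alpha> \<psi> \<psi>1 \<psi>2 p) =
      pucci_sym lam Lam (s * (a * x\<^sup>2 + 2 * b * (x * y) + c * y\<^sup>2))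
        (s * (a * (x * y) + b * (y\<^sup>2 - x\<^sup>2) - c * (x * y)))
        (s * (a * y\<^sup>2 - 2 * b * (x * y) + c * x\<^sup>2))"
    by (subst pucci_minus_sym)
       (auto simp: polar_hessian_def Let_def t_def x_def y_def q_def s_def a_def b_def c_def)
  also have "\<dots> = s * pucci_sym lam Lam (a * x\<^sup>2 + 2 * b * (x * y) + c * y\<^sup>2)
        (a * (x * y) + b * (y\<^sup>2 - x\<^sup>2) - c * (x * y)) (a * y\<^sup>2 - 2 * b * (x * y) + c * x\<^sup>2)"
    by (rule pucci_sym_scale[OF s])
  also have "pucci_sym lam Lam (a * x\<^sup>2 + 2 * b * (x * y) + c * y\<^sup>2)
        (a * (x * y) + b * (y\<^sup>2 - x\<^sup>2) - c * (x * y)) (a * y\<^sup>2 - 2 * b * (x * y) + c * x\<^sup>2)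
      = pucci_sym lam Lam (q * a) (q * b) (q * c)"
    by (rule pucci_sym_invariant) (simp_all add: q(1) power2_eq_square algebra_simps)
  also have "\<dots> = q * pucci_sym lam Lam a b c"
    using q by (intro pucci_sym_scale) simp
  also have "s * (q * pucci_sym lam Lam a b c) = norm p powr \<alpha> * exp (\<psi> t) / q * pucci_sym lam Lam a b c"
    using q(2) by (simp add: s_def power2_eq_square)
  finally show ?thesis unfolding t_def q_def a_def b_def c_def .
qed

lemma has_derivative_vec2:
  fixes g :: "'a::real_normed_vector \<Rightarrow> real^2"
  assumes "((\<lambda>p. g p $ 1) has_derivative (\<lambda>h. D h $ 1)) (at p)"
    and "((\<lambda>p. g p $ 2) has_derivative (\<lambda>h. D h $ 2)) (at p)"
  shows "(g has_derivative D) (at p)"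
proof -
  have "((\<lambda>p. g p $ i) has_derivative (\<lambda>h. D h $ i)) (at p)" for i
    using assms exhaust_2[of i] by auto
  then show ?thesis
    by (subst has_derivative_componentwise_within) (auto simp: Basis_vec_def inner_axis)
qed

text \<open>
  Used in both directions: it produces test functions in the plane from test functions of the
  angle, and it shows that the explicit solutions are classical.
\<close>
lemma polar_C2:
  assumes \<psi>: "\<And>t. t \<in> {a<..<b} \<Longrightarrow> (\<psi> has_real_derivative \<psi>1 t) (at t)"
    and \<psi>1: "\<And>t. t \<in> {a<..<b} \<Longrightarrow> (\<psi>1 has_real_derivative \<psi>2 t) (at t)"
    and \<psi>2: "continuous_on {a<..<b} \<psi>2"
  defines "V \<equiv> {p \<in> slit_plane. signed_angle p \<in> {a<..<b}}"
  shows "open V"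
    and "C2_with_hessian V (\<lambda>p. norm p powr \<alpha> * exp (\<psi> (signed_angle p))) (polar_hessian \<alpha> \<psi> \<psi>1 \<psi>2)"
proof -
  have cont_angle: "continuous_on slit_plane signed_angle"
    by (meson continuous_at_imp_continuous_on has_derivative_continuous signed_angle_has_derivative)
  have V: "V = slit_plane \<inter> signed_angle -` {a<..<b}" by (auto simp: V_def)
  show "open V"
    unfolding V by (intro continuous_open_preimage cont_angle open_slit_plane) auto
  define u where "u p = norm p powr \<alpha> * exp (\<psi> (signed_angle p))" for p :: "real^2"
  define g :: "real^2 \<Rightarrow> real^2" where "g p = vector [u p * (\<alpha> * p $ 1 + \<psi>1 (signed_angle p) * p $ 2) / (norm p)\<^sup>2,
     u p * (\<alpha> * p $ 2 - \<psi>1 (signed_angle p) * p $ 1) / (norm p)\<^sup>2]" for p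
  have g_nth: "g p $ 1 = u p * (\<alpha> * p $ 1 + \<psi>1 (signed_angle p) * p $ 2) / (norm p)\<^sup>2"
     "g p $ 2 = u p * (\<alpha> * p $ 2 - \<psi>1 (signed_angle p) * p $ 1) / (norm p)\<^sup>2" for p :: "real^2"
    by (simp_all add: g_def)
  have u_der: "(u has_derivative (\<lambda>h. g p \<bullet> h)) (at p)"
    and g_der: "(g has_derivative (\<lambda>h. polar_hessian \<alpha> \<psi> \<psi>1 \<psi>2 p *v h)) (at p)" if p: "p \<in> V" for p
  proof -
    define t x y q where "t = signed_angle p" and "x = p $ 1" and "y = p $ 2" and "q = (norm p)\<^sup>2"
    have ps: "p \<in> slit_plane" "p \<noteq> 0" and t: "t \<in> {a<..<b}"
      using p slit_plane_nonzero by (auto simp: V_def t_def)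
    have q: "q = x\<^sup>2 + y\<^sup>2" "q > 0" "x\<^sup>2 + y\<^sup>2 > 0" using ps
      by (auto simp: x_def y_def q_def norm_sq_2 simp flip: norm_sq_2)
    have np: "norm p > 0" using ps by simp
    note A = signed_angle_has_derivative[OF ps(1)]
    have d_psi: "((\<lambda>p. \<psi> (signed_angle p)) has_derivative (\<lambda>h. \<psi>1 t * ((y * h $ 1 - x * h $ 2) / q))) (at p)"
      using has_derivative_compose[OF A, of \<psi> "(*) (\<psi>1 t)"] \<psi>[OF t]
      by (simp add: has_field_derivative_def t_def x_def y_def q_def)
    have d_psi1: "((\<lambda>p. \<psi>1 (signed_angle p)) has_derivative (\<lambda>h. \<psi>2 t * ((y * h $ 1 - x * h $ 2) / q))) (at p)"
      using has_derivative_compose[OF A, of \<psi>1 "(*) (\<psi>2 t)"] \<psi>1[OF t]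
      by (simp add: has_field_derivative_def t_def x_def y_def q_def)
    have d_ln: "((\<lambda>p. ln (norm p)) has_derivative (\<lambda>h. (x * h $ 1 + y * h $ 2) / q)) (at p)"
      by (rule has_derivative_eq_rhs[OF has_derivative_ln[OF np norm_has_derivative_2[OF ps(2)]]])
         (use np in \<open>auto simp: x_def y_def q_def power2_eq_square fun_eq_iff divide_inverse\<close>)
    have d_sq: "((\<lambda>p::real^2. (norm p)\<^sup>2) has_derivative (\<lambda>h. 2 * (x * h $ 1 + y * h $ 2))) (at p)"
      unfolding norm_sq_2
      by (rule has_derivative_eq_rhs, (rule derivative_eq_intros nth_has_derivative refl)+)
         (auto simp: x_def y_def fun_eq_iff)
    have "((\<lambda>p. exp (\<alpha> * ln (norm p) + \<psi> (signed_angle p))) has_derivative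
        (\<lambda>h. exp (\<alpha> * ln (norm p) + \<psi> (signed_angle p)) *
          (\<alpha> * ((x * h $ 1 + y * h $ 2) / q) + \<psi>1 t * ((y * h $ 1 - x * h $ 2) / q)))) (at p)"
      by (rule has_derivative_eq_rhs, (rule derivative_eq_intros d_ln d_psi refl)+) (auto simp: algebra_simps)
    then have "(u has_derivative (\<lambda>h. exp (\<alpha> * ln (norm p) + \<psi> (signed_angle p)) *
          (\<alpha> * ((x * h $ 1 + y * h $ 2) / q) + \<psi>1 t * ((y * h $ 1 - x * h $ 2) / q)))) (at p)"
      by (rule has_derivative_transform_within_open[OF _ open_slit_plane ps(1)])
         (auto simp: u_def powr_def exp_add dest: slit_plane_nonzero)
    moreover have "exp (\<alpha> * ln (norm p) + \<psi> (signed_angle p)) = u p"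
      using ps by (simp add: u_def powr_def exp_add)
    ultimately have d_u: "(u has_derivative (\<lambda>h. u p *
          (\<alpha> * ((x * h $ 1 + y * h $ 2) / q) + \<psi>1 t * ((y * h $ 1 - x * h $ 2) / q)))) (at p)" by simp
    then show "(u has_derivative (\<lambda>h. g p \<bullet> h)) (at p)"
      by (rule has_derivative_eq_rhs)
         (use q in \<open>auto simp: inner_vec_def sum_2 g_nth x_def y_def q_def t_def fun_eq_iff add_divide_distrib
             diff_divide_distrib algebra_simps\<close>)
    have 1: "((\<lambda>p. g p $ 1) has_derivative (\<lambda>h.
        ((u p * (\<alpha> * ((x * h $ 1 + y * h $ 2) / q) + \<psi>1 t * ((y * h $ 1 - x * h $ 2) / q)) * (\<alpha> * x + \<psi>1 t * y)
        + u p * (\<alpha> * h $ 1 + \<psi>2 t * ((y * h $ 1 - x * h $ 2) / q) * y + \<psi>1 t * h $ 2)) * q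
        - u p * (\<alpha> * x + \<psi>1 t * y) * (2 * (x * h $ 1 + y * h $ 2))) / (q * q))) (at p)"
      (is "(_ has_derivative ?D1) _")
      unfolding g_nth
      by (rule has_derivative_eq_rhs, (rule has_derivative_divide' has_derivative_mult has_derivative_add
            has_derivative_mult_right d_u d_psi1 d_sq nth_has_derivative)+)
         (use ps in \<open>auto simp: x_def y_def q_def t_def fun_eq_iff algebra_simps\<close>)
    have 2: "((\<lambda>p. g p $ 2) has_derivative (\<lambda>h.
        ((u p * (\<alpha> * ((x * h $ 1 + y * h $ 2) / q) + \<psi>1 t * ((y * h $ 1 - x * h $ 2) / q)) * (\<alpha> * y - \<psi>1 t * x)
        + u p * (\<alpha> * h $ 2 - (\<psi>2 t * ((y * h $ 1 - x * h $ 2) / q) * x + \<psi>1 t * h $ 1))) * q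
        - u p * (\<alpha> * y - \<psi>1 t * x) * (2 * (x * h $ 1 + y * h $ 2))) / (q * q))) (at p)"
      (is "(_ has_derivative ?D2) _")
      unfolding g_nth
      by (rule has_derivative_eq_rhs, (rule has_derivative_divide' has_derivative_mult has_derivative_diff
            has_derivative_mult_right d_u d_psi1 d_sq nth_has_derivative)+)
         (use ps in \<open>auto simp: x_def y_def q_def t_def fun_eq_iff algebra_simps\<close>)
    have Hv: "(polar_hessian \<alpha> \<psi> \<psi>1 \<psi>2 p *v h) $ 1 = u p / q\<^sup>2 * ((\<alpha> * (\<alpha> - 1) * x\<^sup>2 + 2 * ((\<alpha> - 1) * \<psi>1 t) * (x * y)
         + (\<alpha> + \<psi>2 t + (\<psi>1 t)\<^sup>2) * y\<^sup>2) * h $ 1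
       + (\<alpha> * (\<alpha> - 1) * (x * y) + (\<alpha> - 1) * \<psi>1 t * (y\<^sup>2 - x\<^sup>2) - (\<alpha> + \<psi>2 t + (\<psi>1 t)\<^sup>2) * (x * y)) * h $ 2)"
       "(polar_hessian \<alpha> \<psi> \<psi>1 \<psi>2 p *v h) $ 2 = u p / q\<^sup>2 * ((\<alpha> * (\<alpha> - 1) * (x * y) + (\<alpha> - 1) * \<psi>1 t * (y\<^sup>2 - x\<^sup>2)
         - (\<alpha> + \<psi>2 t + (\<psi>1 t)\<^sup>2) * (x * y)) * h $ 1
       + (\<alpha> * (\<alpha> - 1) * y\<^sup>2 - 2 * ((\<alpha> - 1) * \<psi>1 t) * (x * y) + (\<alpha> + \<psi>2 t + (\<psi>1 t)\<^sup>2) * x\<^sup>2) * h $ 2)" for h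
      unfolding polar_hessian_def Let_def x_def[symmetric] y_def[symmetric] t_def[symmetric] q_def[symmetric]
      by (simp_all add: matrix_vector_mult_def sum_2 u_def t_def algebra_simps)
    have "?D1
       = (\<lambda>h. (polar_hessian \<alpha> \<psi> \<psi>1 \<psi>2 p *v h) $ 1)"
      unfolding Hv fun_eq_iff using q(2)
      by (simp add: field_simps) (simp add: q(1) power2_eq_square algebra_simps)
    moreover have "?D2
       = (\<lambda>h. (polar_hessian \<alpha> \<psi> \<psi>1 \<psi>2 p *v h) $ 2)"
      unfolding Hv fun_eq_iff using q(2)
      by (simp add: field_simps) (simp add: q(1) power2_eq_square algebra_simps)
    ultimately show "(g has_derivative (\<lambda>h. polar_hessian \<alpha> \<psi> \<psi>1 \<psi>2 p *v h)) (at p)"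
      using 1 2 by (intro has_derivative_vec2) simp_all
  qed
  have ca: "continuous_on V signed_angle" using cont_angle by (rule continuous_on_subset) (auto simp: V_def)
  have cu: "continuous_on V u"
    by (meson continuous_at_imp_continuous_on has_derivative_continuous u_der)
  have c1: "continuous_on V (\<lambda>p. \<psi>1 (signed_angle p))"
    by (rule continuous_on_compose2[OF _ ca, of "{a<..<b}"])
       (auto simp: V_def intro!: continuous_at_imp_continuous_on DERIV_isCont[OF \<psi>1])
  have c2: "continuous_on V (\<lambda>p. \<psi>2 (signed_angle p))"
    by (rule continuous_on_compose2[OF \<psi>2 ca]) (auto simp: V_def)
  have nz: "norm p \<noteq> 0" if "p \<in> V" for p using that slit_plane_nonzero by (auto simp: V_def)
  have "continuous_on V (polar_hessian \<alpha> \<psi> \<psi>1 \<psi>2)"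
    unfolding polar_hessian_def Let_def u_def[symmetric]
    by (intro continuous_on_vec2; simp; intro continuous_intros cu c1 c2; use nz in force)
  then show "C2_with_hessian V (\<lambda>p. norm p powr \<alpha> * exp (\<psi> (signed_angle p))) (polar_hessian \<alpha> \<psi> \<psi>1 \<psi>2)"
    unfolding C2_with_hessian_def u_def[symmetric] using u_der g_der by blast
qed

section \<open>The sector and the equation for the angular part\<close>

lemma sector_subset_slit_plane:
  assumes "0 < \<theta>0" "\<theta>0 < pi" "p \<noteq> 0" "p $ 2 \<ge> cos \<theta>0 * norm p"
  shows "p \<in> slit_plane"
proof -
  have "cos \<theta>0 > cos pi" using assms by (intro cos_monotone_0_pi) auto
  then have "(1 + cos \<theta>0) * norm p > 0" using assms(3) by simp
  then show ?thesis using assms(4) by (simp add: slit_plane_def algebra_simps)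
qed

lemma nth_2_eq_cos: "p \<in> slit_plane \<Longrightarrow> p $ 2 = norm p * cos \<bar>signed_angle p\<bar>"
proof -
  assume "p \<in> slit_plane"
  then have "(norm p *\<^sub>R direction (signed_angle p)) $ 2 = p $ 2" by (simp only: signed_angle_polar)
  then show ?thesis by simp
qed

lemma direction_signed_angle:
  assumes "p \<in> slit_plane"
  shows "p /\<^sub>R norm p = direction (signed_angle p)"
proof -
  have "p /\<^sub>R norm p = (norm p *\<^sub>R direction (signed_angle p)) /\<^sub>R norm p"
    by (simp only: signed_angle_polar[OF assms])
  then show ?thesis using slit_plane_nonzero[OF assms] by simp
qed

lemma polar_angle_eq_abs:
  assumes "p \<in> slit_plane"
  shows "polar_angle p = \<bar>signed_angle p\<bar>"
proof -
  have "p $ 2 / norm p = cos \<bar>signed_angle p\<bar>"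
    unfolding nth_2_eq_cos[OF assms] using slit_plane_nonzero[OF assms] by simp
  then show ?thesis
    unfolding polar_angle_def using signed_angle_bounds[of p] by (simp only: arccos_cos abs_ge_zero less_imp_le)
qed

text \<open>
  On the slit plane the defining inequality of the sector, divided by the norm, compares two
  cosines on \<open>[0, \<pi>]\<close>.
\<close>
lemma cos_less_iff_angle:
  assumes "0 < \<theta>0" "\<theta>0 < pi" "p \<in> slit_plane"
  shows "cos \<theta>0 * norm p < p $ 2 \<longleftrightarrow> \<bar>signed_angle p\<bar> < \<theta>0"
    and "cos \<theta>0 * norm p \<le> p $ 2 \<longleftrightarrow> \<bar>signed_angle p\<bar> \<le> \<theta>0"
    and "cos \<theta>0 * norm p = p $ 2 \<longleftrightarrow> \<bar>signed_angle p\<bar> = \<theta>0"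
proof -
  have eq: "p $ 2 = cos \<bar>signed_angle p\<bar> * norm p"
    using nth_2_eq_cos[OF assms(3)] by simp
  have n: "norm p > 0" using slit_plane_nonzero[OF assms(3)] by simp
  have t: "0 \<le> \<bar>signed_angle p\<bar>" "\<bar>signed_angle p\<bar> \<le> pi" using signed_angle_bounds[of p] by auto
  have "cos \<theta>0 < cos \<bar>signed_angle p\<bar> \<longleftrightarrow> \<bar>signed_angle p\<bar> < \<theta>0"
    by (rule cos_mono_less_eq) (use assms t in auto)
  moreover have "cos \<theta>0 \<le> cos \<bar>signed_angle p\<bar> \<longleftrightarrow> \<bar>signed_angle p\<bar> \<le> \<theta>0"
    by (rule cos_mono_le_eq) (use assms t in auto)
  ultimately show "cos \<theta>0 * norm p < p $ 2 \<longleftrightarrow> \<bar>signed_angle p\<bar> < \<theta>0"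
      "cos \<theta>0 * norm p \<le> p $ 2 \<longleftrightarrow> \<bar>signed_angle p\<bar> \<le> \<theta>0"
    by (simp_all only: eq mult_less_cancel_right_pos[OF n] mult_le_cancel_right_pos[OF n])
  then show "cos \<theta>0 * norm p = p $ 2 \<longleftrightarrow> \<bar>signed_angle p\<bar> = \<theta>0"
    by linarith
qed

lemma mem_symmetric_interval: "x \<in> {- a<..<a} \<longleftrightarrow> \<bar>x\<bar> < a" for x a :: real
  unfolding greaterThanLessThan_iff by linarith

lemma open_sector: "open (sector \<theta>0)"
  unfolding sector_def by (intro open_Collect_less continuous_intros)

context
  fixes \<theta>0 :: real
  assumes \<theta>0: "0 < \<theta>0" "\<theta>0 < pi"
begin

lemma sector_eq: "sector \<theta>0 = {p \<in> slit_plane. signed_angle p \<in> {- \<theta>0<..<\<theta>0}}"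
proof -
  have "p \<in> sector \<theta>0 \<longleftrightarrow> p \<in> slit_plane \<and> \<bar>signed_angle p\<bar> < \<theta>0" for p
  proof (cases "p = 0")
    case False
    then show ?thesis
      using sector_subset_slit_plane[OF \<theta>0 False] cos_less_iff_angle(1)[OF \<theta>0, of p]
      by (auto simp: sector_def)
  qed (auto simp: sector_def slit_plane_def)
  then show ?thesis by (simp only: set_eq_iff mem_Collect_eq mem_symmetric_interval simp_thms)
qed

lemma in_sector_iff: "p \<in> sector \<theta>0 \<longleftrightarrow> p \<in> slit_plane \<and> \<bar>signed_angle p\<bar> < \<theta>0"
  unfolding sector_eq mem_Collect_eq mem_symmetric_interval by (rule refl)

text \<open>
  A point with equality is the limit of its upward translates by \<open>1 / (n + 1)\<close>. These lie in the
  sector because the norm changes by at most the length of the translation and \<open>\<bar>cos \<theta>0\<bar> < 1\<close>.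
\<close>
lemma closure_sector: "closure (sector \<theta>0) = {p. p $ 2 \<ge> cos \<theta>0 * norm p}"
proof (rule closure_unique)
  show "sector \<theta>0 \<subseteq> {p. p $ 2 \<ge> cos \<theta>0 * norm p}" by (auto simp: sector_def)
  show "closed {p::real^2. p $ 2 \<ge> cos \<theta>0 * norm p}"
    by (intro closed_Collect_le continuous_intros)
  fix T assume T: "sector \<theta>0 \<subseteq> T" "closed T"
  have c1: "\<bar>cos \<theta>0\<bar> < 1"
    using cos_monotone_0_pi[of \<theta>0 pi] cos_monotone_0_pi[of 0 \<theta>0] \<theta>0 by auto
  show "{p. p $ 2 \<ge> cos \<theta>0 * norm p} \<subseteq> T"
  proof safe
    fix p :: "real^2" assume p: "p $ 2 \<ge> cos \<theta>0 * norm p"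
    define q where "q n = p + (1 / real (Suc n)) *\<^sub>R axis 2 1" for n
    have "q n \<in> T" for n
    proof -
      define e where "e = 1 / real (Suc n)"
      have e: "e > 0" by (simp add: e_def)
      have "\<bar>norm (q n) - norm p\<bar> \<le> norm (q n - p)" by (rule norm_triangle_ineq3)
      also have "\<dots> = e" by (simp add: q_def e_def)
      finally have "\<bar>cos \<theta>0\<bar> * \<bar>norm (q n) - norm p\<bar> \<le> \<bar>cos \<theta>0\<bar> * e"
        by (intro mult_left_mono) auto
      also have "\<dots> < e" using c1 e by simp
      finally have "cos \<theta>0 * (norm (q n) - norm p) < e"
        unfolding abs_mult[symmetric] by linarith
      then have "cos \<theta>0 * norm (q n) < q n $ 2"
        using p by (simp add: q_def e_def axis_def algebra_simps)
      then show ?thesis using T by (auto simp: sector_def)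
    qed
    moreover have "q \<longlonglongrightarrow> p + 0 *\<^sub>R axis 2 1"
      unfolding q_def by (intro tendsto_intros LIMSEQ_Suc[OF lim_1_over_n])
    ultimately show "p \<in> T" using T(2) closed_sequentially[of T q] by simp
  qed
qed

lemma punctured_closed_sector:
  "closure (sector \<theta>0) - {0} = {p \<in> slit_plane. \<bar>signed_angle p\<bar> \<le> \<theta>0}"
proof (intro set_eqI)
  fix p
  show "p \<in> closure (sector \<theta>0) - {0} \<longleftrightarrow> p \<in> {p \<in> slit_plane. \<bar>signed_angle p\<bar> \<le> \<theta>0}"
    unfolding closure_sector mem_Collect_eq Diff_iff
    using sector_subset_slit_plane[OF \<theta>0, of p] cos_less_iff_angle(2)[OF \<theta>0, of p] slit_plane_nonzero[of p]
    by blast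
qed

lemma in_punctured_closed_sector_iff:
  "p \<in> closure (sector \<theta>0) - {0} \<longleftrightarrow> p \<in> slit_plane \<and> \<bar>signed_angle p\<bar> \<le> \<theta>0"
  unfolding punctured_closed_sector by simp

lemma sector_subset_punctured: "sector \<theta>0 \<subseteq> closure (sector \<theta>0) - {0}"
  by (rule subsetI) (simp only: in_sector_iff in_punctured_closed_sector_iff less_imp_le simp_thms)

lemma frontier_sector: "frontier (sector \<theta>0) - {0} = {p \<in> slit_plane. \<bar>signed_angle p\<bar> = \<theta>0}"
proof -
  have boundary: "(P \<and> a \<le> b) \<and> \<not> (P \<and> a < b) \<longleftrightarrow> P \<and> a = b" for P and a b :: real
    by auto
  have "frontier (sector \<theta>0) - {0} = (closure (sector \<theta>0) - {0}) - sector \<theta>0"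
    by (auto simp: frontier_def interior_open[OF open_sector])
  then show ?thesis
    unfolding punctured_closed_sector unfolding sector_eq mem_symmetric_interval
    by (simp only: set_eq_iff mem_Collect_eq Diff_iff boundary simp_thms)
qed

lemma direction_in_sector:
  assumes t: "\<bar>t\<bar> < \<theta>0"
  shows "direction t \<in> sector \<theta>0"
proof -
  have lt: "\<bar>t\<bar> < pi" using t \<theta>0 by linarith
  show ?thesis
    unfolding sector_eq mem_Collect_eq mem_symmetric_interval signed_angle_direction[OF lt]
    using direction_in_slit_plane[OF lt] t by (rule conjI)
qed

lemma direction_in_closed_sector:
  assumes t: "\<bar>t\<bar> \<le> \<theta>0"
  shows "direction t \<in> closure (sector \<theta>0) - {0}"
proof -
  have lt: "\<bar>t\<bar> < pi" using t \<theta>0 by linarith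
  show ?thesis
    unfolding punctured_closed_sector mem_Collect_eq signed_angle_direction[OF lt]
    using direction_in_slit_plane[OF lt] t by (rule conjI)
qed

end

text \<open>
  The equation for the logarithm of the angular part, with \<open>p\<close> and \<open>q\<close> in place of its first and
  second derivative.
\<close>
definition angular_op :: "real \<Rightarrow> real \<Rightarrow> real \<Rightarrow> real \<Rightarrow> real \<Rightarrow> real" where
  "angular_op lam Lam \<alpha> p q = pucci_sym lam Lam (\<alpha> * (\<alpha> - 1)) ((\<alpha> - 1) * p) (\<alpha> + q + p\<^sup>2)"

definition C2_jet :: "real set \<Rightarrow> (real \<Rightarrow> real) \<Rightarrow> (real \<Rightarrow> real) \<Rightarrow> (real \<Rightarrow> real) \<Rightarrow> bool" where
  "C2_jet I \<psi> \<psi>1 \<psi>2 \<longleftrightarrow>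
     (\<forall>t\<in>I. (\<psi> has_real_derivative \<psi>1 t) (at t) \<and> (\<psi>1 has_real_derivative \<psi>2 t) (at t)) \<and>
     continuous_on I \<psi>2"

text \<open>
  Viscosity solutions on \<open>(- \<theta>0, \<theta>0)\<close> of the equation for the logarithm of the angular part. The
  sign \<open>\<sigma>\<close> selects test functions that touch from above (1) or from below (-1). Test functions are
  compared up to additive constants, as the equation does not contain the unknown function itself.
\<close>
definition angular_viscosity_solution :: "real \<Rightarrow> real \<Rightarrow> real \<Rightarrow> real \<Rightarrow> (real \<Rightarrow> real) \<Rightarrow> bool" where
  "angular_viscosity_solution lam Lam \<theta>0 \<alpha> w \<longleftrightarrow>
     (\<forall>\<sigma>\<in>{1, - 1}. \<forall>a b \<psi> \<psi>1 \<psi>2 s.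
        {a<..<b} \<subseteq> {- \<theta>0<..<\<theta>0} \<and> s \<in> {a<..<b} \<and> C2_jet {a<..<b} \<psi> \<psi>1 \<psi>2 \<and>
        (\<forall>t\<in>{a<..<b}. \<sigma> * (w t - \<psi> t) \<le> \<sigma> * (w s - \<psi> s)) \<longrightarrow> 0 \<le> \<sigma> * angular_op lam Lam \<alpha> (\<psi>1 s) (\<psi>2 s))"

lemma C2_jet_polar:
  assumes "C2_jet {a<..<b} \<psi> \<psi>1 \<psi>2"
  shows "open {p \<in> slit_plane. signed_angle p \<in> {a<..<b}}"
    and "C2_with_hessian {p \<in> slit_plane. signed_angle p \<in> {a<..<b}}
       (\<lambda>p. norm p powr \<alpha> * exp (\<psi> (signed_angle p))) (polar_hessian \<alpha> \<psi> \<psi>1 \<psi>2)"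
  using assms polar_C2[of a b \<psi> \<psi>1 \<psi>2] by (auto simp: C2_jet_def)

lemma C2_jet_add_const: "C2_jet I \<psi> \<psi>1 \<psi>2 \<Longrightarrow> C2_jet I (\<lambda>t. \<psi> t + c) \<psi>1 \<psi>2"
  by (auto simp: C2_jet_def intro!: derivative_eq_intros)

lemma pucci_minus_polar_hessian_direction:
  assumes "\<bar>s\<bar> < pi"
  shows "pucci_minus lam Lam (polar_hessian \<alpha> \<psi> \<psi>1 \<psi>2 (direction s)) =
     exp (\<psi> s) * angular_op lam Lam \<alpha> (\<psi>1 s) (\<psi>2 s)"
  using pucci_minus_polar_hessian[OF direction_in_slit_plane[OF assms]] assms
  by (simp add: signed_angle_direction angular_op_def)

text \<open>
  A test function of the angle, shifted to agree with \<open>w\<close> at the touching point, gives a test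
  function of degree \<alpha> in the plane, which touches \<open>u\<close> from the same side.
\<close>
lemma angular_viscosity_solutionI:
  assumes \<theta>0: "0 < \<theta>0" "\<theta>0 < pi" and u: "viscosity_solution (pucci_minus lam Lam) (sector \<theta>0) u"
    and eq: "\<And>p. p \<in> sector \<theta>0 \<Longrightarrow> u p = norm p powr \<alpha> * exp (w (signed_angle p))"
  shows "angular_viscosity_solution lam Lam \<theta>0 \<alpha> w"
  unfolding angular_viscosity_solution_def
proof (intro ballI allI impI, elim conjE)
  fix \<sigma> a b s :: real and \<psi> \<psi>1 \<psi>2
  assume \<sigma>: "\<sigma> \<in> {1, - 1}" and I: "{a<..<b} \<subseteq> {- \<theta>0<..<\<theta>0}" "s \<in> {a<..<b}"
    and jet: "C2_jet {a<..<b} \<psi> \<psi>1 \<psi>2"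
    and max: "\<forall>t\<in>{a<..<b}. \<sigma> * (w t - \<psi> t) \<le> \<sigma> * (w s - \<psi> s)"
  define V where "V = {p \<in> slit_plane. signed_angle p \<in> {a<..<b}}"
  define c where "c = w s - \<psi> s"
  define U where "U p = norm p powr \<alpha> * exp (\<psi> (signed_angle p) + c)" for p :: "real^2"
  define H where "H = polar_hessian \<alpha> (\<lambda>t. \<psi> t + c) \<psi>1 \<psi>2"
  have C2: "open V" "C2_with_hessian V U H"
    using C2_jet_polar(1)[OF jet] C2_jet_polar(2)[OF C2_jet_add_const[OF jet]]
    unfolding V_def U_def[abs_def] H_def by blast+
  have "s \<in> {- \<theta>0<..<\<theta>0}" using I by blast
  then have s: "\<bar>s\<bar> < \<theta>0" "\<bar>s\<bar> < pi" using \<theta>0 unfolding mem_symmetric_interval by linarith+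
  have sub: "V \<subseteq> sector \<theta>0" using I by (auto simp: V_def sector_eq[OF \<theta>0])
  have sV: "direction s \<in> V" using s I by (auto simp: V_def direction_in_slit_plane signed_angle_direction)
  have at_s: "u (direction s) = U (direction s)"
    unfolding eq[OF subsetD[OF sub sV]] U_def by (simp add: c_def signed_angle_direction[OF s(2)])
  have side: "\<sigma> * (u p - U p) \<le> \<sigma> * (u (direction s) - U (direction s))" if p: "p \<in> V" for p
  proof -
    define t where "t = signed_angle p"
    have t: "\<sigma> * (w t - \<psi> t) \<le> \<sigma> * c" using bspec[OF max, of t] p by (simp add: V_def c_def t_def)
    have "\<sigma> * (exp (w t) - exp (\<psi> t + c)) \<le> 0" using \<sigma> t by auto
    then have "norm p powr \<alpha> * (\<sigma> * (exp (w t) - exp (\<psi> t + c))) \<le> 0" by (simp add: mult_le_0_iff)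
    then show ?thesis
      unfolding at_s eq[OF subsetD[OF sub p]] U_def t_def[symmetric] by (simp add: algebra_simps)
  qed
  have "0 \<le> \<sigma> * pucci_minus lam Lam (H (direction s))"
  proof (cases "\<sigma> = 1")
    case True
    have "\<forall>p\<in>V. u p - U p \<le> u (direction s) - U (direction s)" using side unfolding True by simp
    then show ?thesis
      using u C2 sV sub unfolding True viscosity_solution_def viscosity_subsolution_def mult_1 by blast
  next
    case False
    then have \<sigma>': "\<sigma> = - 1" using \<sigma> by simp
    have "\<forall>p\<in>V. u p - U p \<ge> u (direction s) - U (direction s)"
      using side unfolding \<sigma>' mult_minus1 neg_le_iff_le by blast
    then have "pucci_minus lam Lam (H (direction s)) \<le> 0"
      using u C2 sV sub unfolding viscosity_solution_def viscosity_supersolution_def by blast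
    then show ?thesis unfolding \<sigma>' by simp
  qed
  then have "0 \<le> exp (\<psi> s + c) * (\<sigma> * angular_op lam Lam \<alpha> (\<psi>1 s) (\<psi>2 s))"
    unfolding H_def pucci_minus_polar_hessian_direction[OF s(2)] by (simp add: mult_ac)
  then show "0 \<le> \<sigma> * angular_op lam Lam \<alpha> (\<psi>1 s) (\<psi>2 s)"
    by (simp only: zero_le_mult_iff exp_ge_zero exp_gt_zero) (metis exp_gt_zero not_le)
qed

text \<open>The solutions in the theorem are only determined on the closed sector without its vertex.\<close>
lemma viscosity_solution_cong:
  assumes "open \<Omega>" "\<And>p. p \<in> \<Omega> \<Longrightarrow> u p = v p" "viscosity_solution F \<Omega> v"
  shows "viscosity_solution F \<Omega> u"
proof -
  have eq: "(\<forall>x\<in>U. u x - \<phi> x \<le> u x0 - \<phi> x0) \<longleftrightarrow> (\<forall>x\<in>U. v x - \<phi> x \<le> v x0 - \<phi> x0)"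
       "(\<forall>x\<in>U. u x - \<phi> x \<ge> u x0 - \<phi> x0) \<longleftrightarrow> (\<forall>x\<in>U. v x - \<phi> x \<ge> v x0 - \<phi> x0)"
    if U: "x0 \<in> U" "U \<subseteq> \<Omega>" for \<phi> x0 U
  proof -
    have "u x = v x" if "x \<in> U" for x using that U assms(2) by auto
    then show "(\<forall>x\<in>U. u x - \<phi> x \<le> u x0 - \<phi> x0) \<longleftrightarrow> (\<forall>x\<in>U. v x - \<phi> x \<le> v x0 - \<phi> x0)"
       "(\<forall>x\<in>U. u x - \<phi> x \<ge> u x0 - \<phi> x0) \<longleftrightarrow> (\<forall>x\<in>U. v x - \<phi> x \<ge> v x0 - \<phi> x0)"
      using U(1) by simp_all
  qed
  have "continuous_on \<Omega> u \<longleftrightarrow> continuous_on \<Omega> v"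
    using assms(2) by (intro continuous_on_cong) auto
  moreover have "viscosity_subsolution F \<Omega> v \<Longrightarrow> viscosity_subsolution F \<Omega> u"
    unfolding viscosity_subsolution_def using eq(1) by meson
  moreover have "viscosity_supersolution F \<Omega> v \<Longrightarrow> viscosity_supersolution F \<Omega> u"
    unfolding viscosity_supersolution_def using eq(2) by meson
  ultimately show ?thesis using assms(3) unfolding viscosity_solution_def by blast
qed

text \<open>
  \<open>E\<close> and \<open>w\<close> are kept apart since \<open>w\<close> is the logarithm of \<open>E\<close> and tends to minus infinity at the
  boundary.
\<close>
lemma positive_homogeneous_solutionI:
  assumes pos: "0 < lam" "0 < Lam" and \<theta>0: "0 < \<theta>0" "\<theta>0 < pi"
    and E: "continuous_on {- \<theta>0..\<theta>0} E" "\<And>t. \<bar>t\<bar> < \<theta>0 \<Longrightarrow> E t = exp (w t)" "E \<theta>0 = 0" "E (- \<theta>0) = 0"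
    and jet: "C2_jet {- \<theta>0<..<\<theta>0} w w1 w2"
    and zero: "\<And>t. \<bar>t\<bar> < \<theta>0 \<Longrightarrow> angular_op lam Lam \<alpha> (w1 t) (w2 t) = 0"
    and c: "c > 0" and u: "\<And>p. p \<in> closure (sector \<theta>0) - {0} \<Longrightarrow> u p = c * (norm p powr \<alpha> * E (signed_angle p))"
  shows "positive_homogeneous_solution lam Lam \<theta>0 u"
proof -
  note sub = sector_subset_punctured[OF \<theta>0]
  have inside: "u p = norm p powr \<alpha> * exp (w (signed_angle p) + ln c)" if "p \<in> sector \<theta>0" for p
  proof -
    have "\<bar>signed_angle p\<bar> < \<theta>0" "p \<in> closure (sector \<theta>0) - {0}"
      using that sub in_sector_iff[OF \<theta>0] by auto
    then show ?thesis using u[of p] E(2)[of "signed_angle p"] c by (simp add: exp_add)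
  qed
  have V: "sector \<theta>0 = {p \<in> slit_plane. signed_angle p \<in> {- \<theta>0<..<\<theta>0}}" by (rule sector_eq[OF \<theta>0])
  have "viscosity_solution (pucci_minus lam Lam) (sector \<theta>0)
      (\<lambda>p. norm p powr \<alpha> * exp (w (signed_angle p) + ln c))"
  proof (rule classical_imp_viscosity[OF pos open_sector])
    show "C2_with_hessian (sector \<theta>0) (\<lambda>p. norm p powr \<alpha> * exp (w (signed_angle p) + ln c))
       (polar_hessian \<alpha> (\<lambda>t. w t + ln c) w1 w2)"
      unfolding V by (rule C2_jet_polar(2)[OF C2_jet_add_const[OF jet]])
    show "pucci_minus lam Lam (polar_hessian \<alpha> (\<lambda>t. w t + ln c) w1 w2 p) = 0" if "p \<in> sector \<theta>0" for p
      using that zero[of "signed_angle p"] unfolding V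
      by (subst pucci_minus_polar_hessian) (auto simp: angular_op_def)
  qed
  then have visc: "viscosity_solution (pucci_minus lam Lam) (sector \<theta>0) u"
    by (rule viscosity_solution_cong[OF open_sector inside, rotated])
  have ang: "signed_angle p \<in> {- \<theta>0..\<theta>0}" "p \<in> slit_plane" "p \<noteq> 0" if "p \<in> closure (sector \<theta>0) - {0}" for p
    using that slit_plane_nonzero unfolding punctured_closed_sector[OF \<theta>0] by auto
  have "continuous_on (closure (sector \<theta>0) - {0}) signed_angle"
    using ang(2) by (meson continuous_at_imp_continuous_on has_derivative_continuous signed_angle_has_derivative)
  then have "continuous_on (closure (sector \<theta>0) - {0}) (\<lambda>p. E (signed_angle p))"
    by (rule continuous_on_compose2[OF E(1)]) (use ang(1) in blast)
  then have "continuous_on (closure (sector \<theta>0) - {0}) (\<lambda>p. c * (norm p powr \<alpha> * E (signed_angle p)))"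
    by (intro continuous_intros) auto
  then have cont: "continuous_on (closure (sector \<theta>0) - {0}) u"
    by (rule continuous_on_eq) (rule u[symmetric])
  have "homogeneous_on (closure (sector \<theta>0) - {0}) \<alpha> u"
    unfolding homogeneous_on_def
  proof (intro exI ballI)
    fix p assume p: "p \<in> closure (sector \<theta>0) - {0}"
    have "p /\<^sub>R norm p = direction (signed_angle p)"
      by (rule direction_signed_angle[OF ang(2)[OF p]])
    then have "signed_angle (p /\<^sub>R norm p) = signed_angle p"
      using signed_angle_direction[OF signed_angle_bounds] by simp
    then show "u p = norm p powr \<alpha> * (\<lambda>d. c * E (signed_angle d)) (p /\<^sub>R norm p)"
      using u[OF p] by simp
  qed
  moreover have "u p = 0" if "p \<in> frontier (sector \<theta>0) - {0}" for p
  proof -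
    have "p \<in> closure (sector \<theta>0) - {0}" using that by (auto simp: frontier_def)
    moreover have "\<bar>signed_angle p\<bar> = \<theta>0" using that unfolding frontier_sector[OF \<theta>0] by auto
    ultimately show ?thesis using u[of p] E(3,4) by (auto simp: abs_if split: if_splits)
  qed
  moreover have "u p > 0" if "p \<in> sector \<theta>0" for p
    using inside[OF that] that slit_plane_nonzero unfolding V by auto
  ultimately show ?thesis
    using cont visc unfolding positive_homogeneous_solution_def homogeneous_solution_def by blast
qed

text \<open>The angular part is the restriction of \<open>u\<close> to the unit circle.\<close>
lemma positive_homogeneous_solutionE:
  assumes \<theta>0: "0 < \<theta>0" "\<theta>0 < pi" and u: "positive_homogeneous_solution lam Lam \<theta>0 u"
  obtains \<alpha> \<phi> where "continuous_on {- \<theta>0..\<theta>0} \<phi>" "\<And>t. \<bar>t\<bar> < \<theta>0 \<Longrightarrow> \<phi> t > 0" "\<phi> \<theta>0 = 0" "\<phi> (- \<theta>0) = 0"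
    "\<And>p. p \<in> closure (sector \<theta>0) - {0} \<Longrightarrow> u p = norm p powr \<alpha> * \<phi> (signed_angle p)"
    "angular_viscosity_solution lam Lam \<theta>0 \<alpha> (\<lambda>t. ln (\<phi> t))"
proof -
  from u have cont: "continuous_on (closure (sector \<theta>0) - {0}) u"
    and visc: "viscosity_solution (pucci_minus lam Lam) (sector \<theta>0) u"
    and bdry: "\<And>p. p \<in> frontier (sector \<theta>0) - {0} \<Longrightarrow> u p = 0"
    and pos: "\<And>p. p \<in> sector \<theta>0 \<Longrightarrow> u p > 0"
    unfolding positive_homogeneous_solution_def homogeneous_solution_def by simp_all
  from u obtain \<alpha> f where f: "\<And>p. p \<in> closure (sector \<theta>0) - {0} \<Longrightarrow> u p = norm p powr \<alpha> * f (p /\<^sub>R norm p)"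
    unfolding positive_homogeneous_solution_def homogeneous_solution_def homogeneous_on_def by blast
  define \<phi> where "\<phi> t = u (direction t)" for t
  have cd: "continuous_on S direction" for S
    by (rule continuous_on_vec2; simp; intro continuous_intros)
  have eq: "u p = norm p powr \<alpha> * \<phi> (signed_angle p)" if p: "p \<in> closure (sector \<theta>0) - {0}" for p
  proof -
    have ps: "p \<in> slit_plane" "p \<noteq> 0" "\<bar>signed_angle p\<bar> \<le> \<theta>0"
      using p slit_plane_nonzero unfolding punctured_closed_sector[OF \<theta>0] by auto
    have "p /\<^sub>R norm p = direction (signed_angle p)"
      by (rule direction_signed_angle[OF ps(1)])
    then show ?thesis
      using f[OF p] f[OF direction_in_closed_sector[OF \<theta>0 ps(3)]] by (simp add: \<phi>_def)
  qed
  note sub = sector_subset_punctured[OF \<theta>0]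
  have \<phi>_pos: "\<phi> t > 0" if "\<bar>t\<bar> < \<theta>0" for t
    unfolding \<phi>_def by (intro pos direction_in_sector \<theta>0 that)
  have inside: "u p = norm p powr \<alpha> * exp (ln (\<phi> (signed_angle p)))" if "p \<in> sector \<theta>0" for p
  proof -
    have "\<bar>signed_angle p\<bar> < \<theta>0" "p \<in> closure (sector \<theta>0) - {0}"
      using that sub in_sector_iff[OF \<theta>0] by auto
    then show ?thesis using eq[of p] \<phi>_pos[of "signed_angle p"] by simp
  qed
  show thesis
  proof (rule that)
    show "continuous_on {- \<theta>0..\<theta>0} \<phi>" unfolding \<phi>_def
      by (rule continuous_on_compose2[OF cont cd]) (use direction_in_closed_sector[OF \<theta>0] in force)
    show "\<phi> \<theta>0 = 0" "\<phi> (- \<theta>0) = 0" unfolding \<phi>_def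
      by (rule bdry; use \<theta>0 in \<open>simp add: frontier_sector direction_in_slit_plane signed_angle_direction\<close>)+
  qed (use \<phi>_pos eq angular_viscosity_solutionI[OF \<theta>0 visc inside] in auto)
qed

section \<open>Comparison with exact angular solutions\<close>

lemma angular_op_strict_mono:
  assumes "0 < lam" "0 < Lam" "q < q'"
  shows "angular_op lam Lam \<alpha> p q < angular_op lam Lam \<alpha> p q'"
  unfolding angular_op_def by (rule pucci_sym_mono(2)) (use assms in auto)

lemma interior_max:
  fixes f :: "real \<Rightarrow> real"
  assumes "continuous_on {a..b} f" "t \<in> {a..b}" "f a < f t" "f b < f t"
  shows "\<exists>s\<in>{a<..<b}. \<forall>x\<in>{a..b}. f x \<le> f s"
proof -
  obtain s where s: "s \<in> {a..b}" "\<And>x. x \<in> {a..b} \<Longrightarrow> f x \<le> f s"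
    using continuous_attains_sup[OF compact_Icc _ assms(1)] assms(2) by force
  have "s \<noteq> a" "s \<noteq> b" using s(2)[OF assms(2)] assms(3,4) by fastforce+
  then have "s \<in> {a<..<b}" using s(1) by simp
  then show ?thesis using s(2) by blast
qed

lemma pucci_weight_add:
  assumes "0 < lam" "0 < Lam" "0 \<le> h"
  shows "pucci_weight lam Lam (x + h) \<le> pucci_weight lam Lam x + max lam Lam * h"
    and "pucci_weight lam Lam (x - h) \<le> pucci_weight lam Lam x - min lam Lam * h"
proof -
  have *: "max (x + h) 0 - max x 0 + (min (x + h) 0 - min x 0) = h"
     "0 \<le> max (x + h) 0 - max x 0" "0 \<le> min (x + h) 0 - min x 0" for x
    using assms(3) by (auto simp: max_def min_def)
  have eq: "pucci_weight lam Lam (x + h) - pucci_weight lam Lam x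
      = lam * (max (x + h) 0 - max x 0) + Lam * (min (x + h) 0 - min x 0)" for x
    by (simp add: pucci_weight_def algebra_simps)
  have "pucci_weight lam Lam (x + h) - pucci_weight lam Lam x
      \<le> max lam Lam * (max (x + h) 0 - max x 0) + max lam Lam * (min (x + h) 0 - min x 0)"
    unfolding eq using * by (intro add_mono mult_right_mono) auto
  also have "\<dots> = max lam Lam * h" unfolding distrib_left[symmetric] * ..
  finally show "pucci_weight lam Lam (x + h) \<le> pucci_weight lam Lam x + max lam Lam * h" by simp
  have "min lam Lam * h
      = min lam Lam * (max (x - h + h) 0 - max (x - h) 0) + min lam Lam * (min (x - h + h) 0 - min (x - h) 0)"
    unfolding distrib_left[symmetric] *(1)[of "x - h"] ..
  also have "\<dots> \<le> pucci_weight lam Lam (x - h + h) - pucci_weight lam Lam (x - h)"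
    unfolding eq[of "x - h"] using *[of "x - h"] by (intro add_mono mult_right_mono) auto
  finally show "pucci_weight lam Lam (x - h) \<le> pucci_weight lam Lam x - min lam Lam * h" by simp
qed

text \<open>
  The sum of the weights is the value of the equation at slope and second derivative 0. If it is
  not positive, constants are supersolutions, though perhaps not strict ones. The function \<open>\<psi>\<close>
  with \<open>\<psi>' = exp (- K * (t + \<theta>0))\<close> and \<open>\<psi>'' = - K * \<psi>'\<close> is strict: changing the slope from 0 to
  \<open>p\<close> costs an amount linear in \<open>p\<close>, which \<open>- K * p\<close> outweighs for large \<open>K\<close>. As \<open>\<phi>\<close> vanishes at
  both ends, a translate of \<open>\<psi>\<close> touches \<open>ln \<circ> \<phi>\<close> from above at an interior point.
\<close>
lemma weights_pos_of_angular_solution: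
  assumes pos: "0 < lam" "0 < Lam" and \<theta>0: "0 < \<theta>0"
    and \<phi>: "continuous_on {- \<theta>0..\<theta>0} \<phi>" "\<And>t. \<bar>t\<bar> < \<theta>0 \<Longrightarrow> \<phi> t > 0" "\<phi> \<theta>0 = 0" "\<phi> (- \<theta>0) = 0"
    and visc: "angular_viscosity_solution lam Lam \<theta>0 \<alpha> (\<lambda>t. ln (\<phi> t))"
  shows "0 < pucci_weight lam Lam (\<alpha> * (\<alpha> - 1)) + pucci_weight lam Lam \<alpha>"
proof (rule ccontr)
  assume "\<not> 0 < pucci_weight lam Lam (\<alpha> * (\<alpha> - 1)) + pucci_weight lam Lam \<alpha>"
  then have na: "pucci_weight lam Lam (\<alpha> * (\<alpha> - 1)) + pucci_weight lam Lam \<alpha> \<le> 0" by simp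
  define M m where "M = max lam Lam" and "m = min lam Lam"
  have Mm: "M > 0" "m > 0" using pos by (auto simp: M_def m_def)
  \<comment> \<open>Large enough for the bound at the end: the last two summands pay for the mixed entry \<open>b\<close>, one unit pays for \<open>p\<^sup>2 \<le> p\<close>, and one is left over.\<close>
  define K where "K = 2 + \<bar>\<alpha> - 1\<bar> + M * \<bar>\<alpha> - 1\<bar> / m"
  have K: "K > 0" using Mm by (simp add: K_def add_pos_nonneg)
  define \<psi> \<psi>1 where "\<psi> t = - exp (- K * (t + \<theta>0)) / K" and "\<psi>1 t = exp (- K * (t + \<theta>0))" for t
  define \<psi>2 where "\<psi>2 t = - K * \<psi>1 t" for t
  have jet: "C2_jet {- \<theta>0<..<\<theta>0} \<psi> \<psi>1 \<psi>2"
    unfolding C2_jet_def \<psi>2_def \<psi>_def \<psi>1_def using K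
    by (auto intro!: derivative_eq_intros continuous_intros)
  define f where "f t = \<phi> t * exp (- \<psi> t)" for t
  have "continuous_on {- \<theta>0..\<theta>0} f"
    unfolding f_def \<psi>_def using K by (intro continuous_intros \<phi>) auto
  moreover have "0 \<in> {- \<theta>0..\<theta>0}" "f (- \<theta>0) < f 0" "f \<theta>0 < f 0"
    using \<theta>0 \<phi>(2)[of 0] by (auto simp: f_def \<phi>)
  ultimately have "\<exists>s\<in>{- \<theta>0<..<\<theta>0}. \<forall>x\<in>{- \<theta>0..\<theta>0}. f x \<le> f s" by (rule interior_max)
  then obtain s where s: "s \<in> {- \<theta>0<..<\<theta>0}" "\<And>x. x \<in> {- \<theta>0..\<theta>0} \<Longrightarrow> f x \<le> f s" by blast
  have max: "ln (\<phi> t) - \<psi> t \<le> ln (\<phi> s) - \<psi> s" if "t \<in> {- \<theta>0<..<\<theta>0}" for t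
  proof -
    have ps: "\<phi> t > 0" "\<phi> s > 0"
      by (rule \<phi>(2), use that s(1) in \<open>simp only: mem_symmetric_interval\<close>)+
    have "ln (f t) \<le> ln (f s)" using s(2)[of t] that ps by (subst ln_le_cancel_iff) (auto simp: f_def)
    then show ?thesis using ps by (simp add: f_def ln_mult)
  qed
  then have "\<forall>t\<in>{- \<theta>0<..<\<theta>0}. 1 * (ln (\<phi> t) - \<psi> t) \<le> 1 * (ln (\<phi> s) - \<psi> s)" by simp
  then have "0 \<le> 1 * angular_op lam Lam \<alpha> (\<psi>1 s) (\<psi>2 s)"
    using bspec[OF visc[unfolded angular_viscosity_solution_def], of 1] s(1) jet by blast
  then have ge: "0 \<le> angular_op lam Lam \<alpha> (\<psi>1 s) (\<psi>2 s)" by simp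
  define p where "p = \<psi>1 s"
  have p: "p > 0" "p \<le> 1" using s(1) K by (auto simp: p_def \<psi>1_def)
  define b where "b = \<bar>(\<alpha> - 1) * p\<bar>"
  have b: "b = \<bar>\<alpha> - 1\<bar> * p" "b \<ge> 0" using p by (auto simp: b_def abs_mult)
  have p2: "p\<^sup>2 \<le> p" using p by (simp add: power2_eq_square mult_left_le)
  have Kp: "K * p = 2 * p + b + M / m * b" unfolding K_def b(1) by (simp add: algebra_simps)
  define h where "h = K * p - p\<^sup>2 - b"
  have "0 \<le> M / m * b" using Mm b(2) by simp
  then have h: "h \<ge> p + M / m * b" "h \<ge> 0" unfolding h_def Kp using p2 p(1) by linarith+
  have "angular_op lam Lam \<alpha> (\<psi>1 s) (\<psi>2 s)
      = pucci_sym lam Lam (\<alpha> * (\<alpha> - 1)) ((\<alpha> - 1) * p) (\<alpha> - K * p + p\<^sup>2)"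
    by (simp add: angular_op_def \<psi>2_def p_def)
  \<comment> \<open>The mixed entry is absorbed by adding its absolute value to the diagonal.\<close>
  also have "\<dots> \<le> pucci_sym lam Lam (\<alpha> * (\<alpha> - 1) + b) 0 (\<alpha> - h)"
    by (rule pucci_sym_mono(1)[OF pos]) (use b(2) in \<open>auto simp: h_def b_def power2_eq_square\<close>)
  also have "\<dots> = pucci_weight lam Lam (\<alpha> * (\<alpha> - 1) + b) + pucci_weight lam Lam (\<alpha> - h)"
    by (rule pucci_sym_eigenvalues) auto
  also have "\<dots> \<le> pucci_weight lam Lam (\<alpha> * (\<alpha> - 1)) + M * b + (pucci_weight lam Lam \<alpha> - m * h)"
    unfolding M_def m_def by (intro add_mono pucci_weight_add pos b(2) h(2))
  also have "\<dots> \<le> M * b - m * h" using na by simp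
  also have "\<dots> \<le> M * b - m * (p + M / m * b)" using h(1) Mm by simp
  also have "\<dots> = - m * p" using Mm by (simp add: field_simps)
  also have "\<dots> < 0" using Mm p by simp
  finally show False using ge by simp
qed

text \<open>
  An exact solution \<open>V\<close> on \<open>(- T, T)\<close> with derivatives \<open>V1\<close> and \<open>V2\<close>. Its exponential \<open>E\<close> is a
  separate parameter because it extends continuously by 0 to the endpoints, which \<open>V\<close> does not.
\<close>
locale angular_solution =
  fixes lam Lam \<alpha> T :: real and V V1 V2 E :: "real \<Rightarrow> real"
  assumes pos: "0 < lam" "0 < Lam" and T_pos: "0 < T"
    and E_cont: "continuous_on {- T..T} E" and E_exp: "\<And>t. \<bar>t\<bar> < T \<Longrightarrow> E t = exp (V t)"
    and E_end: "E T = 0" "E (- T) = 0"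
    and jet: "C2_jet {- T<..<T} V V1 V2"
    and concave: "\<And>t. \<bar>t\<bar> < T \<Longrightarrow> V2 t < 0"
    and solution: "\<And>t. \<bar>t\<bar> < T \<Longrightarrow> angular_op lam Lam \<alpha> (V1 t) (V2 t) = 0"
begin

text \<open>
  Rescaling keeps the slope and multiplies the second derivative by \<open>\<kappa>\<close>. As the latter is
  negative, \<open>\<kappa> > 1\<close> gives a strict supersolution and \<open>\<kappa> < 1\<close> a strict subsolution.
\<close>
definition scaled :: "real \<Rightarrow> real \<Rightarrow> real \<Rightarrow> real" where
  "scaled \<kappa> s t = V (\<kappa> * (t - s)) / \<kappa>"

lemma V_isCont: "\<bar>t\<bar> < T \<Longrightarrow> isCont V t"
  using jet unfolding C2_jet_def mem_symmetric_interval[symmetric] by (blast intro: DERIV_isCont)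

lemma scaled_jet:
  assumes "\<kappa> > 0" "\<And>t. t \<in> I \<Longrightarrow> \<bar>\<kappa> * (t - s)\<bar> < T"
  shows "C2_jet I (scaled \<kappa> s) (\<lambda>t. V1 (\<kappa> * (t - s))) (\<lambda>t. \<kappa> * V2 (\<kappa> * (t - s)))"
proof -
  have I: "\<kappa> * (t - s) \<in> {- T<..<T}" if "t \<in> I" for t
    using assms(2)[OF that] unfolding mem_symmetric_interval .
  have lin: "((\<lambda>t. \<kappa> * (t - s)) has_real_derivative \<kappa>) (at t)" for t
    by (auto intro!: derivative_eq_intros)
  have d0: "(scaled \<kappa> s has_real_derivative V1 (\<kappa> * (t - s))) (at t)" if "t \<in> I" for t
  proof -
    have "((\<lambda>t. V (\<kappa> * (t - s))) has_real_derivative V1 (\<kappa> * (t - s)) * \<kappa>) (at t)"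
      by (rule DERIV_chain2[OF _ lin]) (use jet I[OF that] in \<open>auto simp: C2_jet_def\<close>)
    from DERIV_cdivide[OF this, of \<kappa>] show ?thesis using assms(1) unfolding scaled_def by simp
  qed
  have d1: "((\<lambda>t. V1 (\<kappa> * (t - s))) has_real_derivative \<kappa> * V2 (\<kappa> * (t - s))) (at t)" if "t \<in> I" for t
  proof -
    have "((\<lambda>t. V1 (\<kappa> * (t - s))) has_real_derivative V2 (\<kappa> * (t - s)) * \<kappa>) (at t)"
      by (rule DERIV_chain2[OF _ lin]) (use jet I[OF that] in \<open>auto simp: C2_jet_def\<close>)
    then show ?thesis by (simp add: mult.commute)
  qed
  have d2: "continuous_on I (\<lambda>t. \<kappa> * V2 (\<kappa> * (t - s)))"
  proof (intro continuous_on_mult continuous_on_const)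
    have V2: "continuous_on {- T<..<T} V2" using jet unfolding C2_jet_def by blast
    have "continuous_on I (\<lambda>t. \<kappa> * (t - s))" by (intro continuous_intros)
    then show "continuous_on I (\<lambda>t. V2 (\<kappa> * (t - s)))"
      by (rule continuous_on_compose2[OF V2]) (use I in blast)
  qed
  show ?thesis unfolding C2_jet_def by (intro conjI ballI d0 d1 d2)
qed

lemma scaled_strict:
  assumes "\<bar>\<kappa> * (t - s)\<bar> < T"
  shows "1 < \<kappa> \<Longrightarrow> angular_op lam Lam \<alpha> (V1 (\<kappa> * (t - s))) (\<kappa> * V2 (\<kappa> * (t - s))) < 0"
    and "\<kappa> < 1 \<Longrightarrow> 0 < angular_op lam Lam \<alpha> (V1 (\<kappa> * (t - s))) (\<kappa> * V2 (\<kappa> * (t - s)))"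
  unfolding solution[OF assms, symmetric]
  by (rule angular_op_strict_mono[OF pos], use concave[OF assms] in simp)+

end

text \<open>The angular part \<open>\<phi>\<close> of a viscosity solution of the same degree as a given exact solution.\<close>
locale angular_comparison = angular_solution +
  fixes \<theta>0 :: real and \<phi> :: "real \<Rightarrow> real"
  assumes \<theta>0: "0 < \<theta>0"
    and \<phi>: "continuous_on {- \<theta>0..\<theta>0} \<phi>" "\<And>t. \<bar>t\<bar> < \<theta>0 \<Longrightarrow> \<phi> t > 0" "\<phi> \<theta>0 = 0" "\<phi> (- \<theta>0) = 0"
    and visc: "angular_viscosity_solution lam Lam \<theta>0 \<alpha> (\<lambda>t. ln (\<phi> t))"
begin

text \<open>
  For \<open>\<sigma> = 1\<close> a strict supersolution would touch from above, for \<open>\<sigma> = - 1\<close> a strict subsolution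
  from below.
\<close>
lemma no_touching:
  assumes \<sigma>: "\<sigma> \<in> {1, - 1}" "0 < \<sigma> * (\<kappa> - 1)" "0 < \<kappa>" and sub: "{a<..<b} \<subseteq> {- \<theta>0<..<\<theta>0}"
    and I: "\<And>t. t \<in> {a<..<b} \<Longrightarrow> \<bar>\<kappa> * (t - s)\<bar> < T" and x: "x \<in> {a<..<b}"
  shows "\<exists>t\<in>{a<..<b}. \<sigma> * (ln (\<phi> x) - scaled \<kappa> s x) < \<sigma> * (ln (\<phi> t) - scaled \<kappa> s t)"
proof (rule ccontr)
  assume "\<not> ?thesis"
  then have "\<forall>t\<in>{a<..<b}. \<sigma> * (ln (\<phi> t) - scaled \<kappa> s t) \<le> \<sigma> * (ln (\<phi> x) - scaled \<kappa> s x)"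
    by (meson not_less)
  then have "0 \<le> \<sigma> * angular_op lam Lam \<alpha> (V1 (\<kappa> * (x - s))) (\<kappa> * V2 (\<kappa> * (x - s)))"
    using visc[unfolded angular_viscosity_solution_def, THEN bspec[OF _ \<sigma>(1)]] scaled_jet[OF \<sigma>(3) I] sub x by blast
  then show False using scaled_strict[OF I[OF x]] \<sigma>(1,2) by (auto simp: not_le)
qed

lemma \<phi>_pos: "t \<in> {- \<theta>0<..<\<theta>0} \<Longrightarrow> \<phi> t > 0"
  using \<phi>(2) unfolding mem_symmetric_interval .

text \<open>
  If the interval of the exact solution were larger, a slightly rescaled copy of it would be
  finite on the whole closed interval of \<open>\<phi>\<close>; since \<open>\<phi>\<close> vanishes at both ends, some vertical
  translate of this strict supersolution would touch \<open>ln \<circ> \<phi>\<close> from above.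
\<close>
lemma T_le: "T \<le> \<theta>0"
proof (rule ccontr)
  assume "\<not> T \<le> \<theta>0"
  define \<kappa> where "\<kappa> = (1 + T / \<theta>0) / 2"
  have \<kappa>: "1 < \<kappa>" "\<kappa> * \<theta>0 < T" using \<open>\<not> T \<le> \<theta>0\<close> \<theta>0 by (auto simp: \<kappa>_def field_simps)
  have I: "\<bar>\<kappa> * (t - 0)\<bar> < T" if "t \<in> {- \<theta>0..\<theta>0}" for t
  proof -
    have "\<bar>\<kappa> * (t - 0)\<bar> = \<kappa> * \<bar>t\<bar>" using \<kappa> by (simp add: abs_mult)
    also have "\<dots> \<le> \<kappa> * \<theta>0" using that \<kappa> by (intro mult_left_mono) auto
    finally show ?thesis using \<kappa> by simp
  qed
  define f where "f t = \<phi> t * exp (- scaled \<kappa> 0 t)" for t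
  have "C2_jet {- \<theta>0..\<theta>0} (scaled \<kappa> 0) (\<lambda>t. V1 (\<kappa> * (t - 0))) (\<lambda>t. \<kappa> * V2 (\<kappa> * (t - 0)))"
    using \<kappa> I by (intro scaled_jet) auto
  then have "continuous_on {- \<theta>0..\<theta>0} (scaled \<kappa> 0)"
    unfolding C2_jet_def by (intro continuous_at_imp_continuous_on) (blast intro: DERIV_isCont)
  then have "continuous_on {- \<theta>0..\<theta>0} f"
    unfolding f_def by (intro continuous_intros \<phi>)
  moreover have "0 \<in> {- \<theta>0..\<theta>0}" "f (- \<theta>0) < f 0" "f \<theta>0 < f 0"
    using \<theta>0 \<phi>(2)[of 0] by (auto simp: f_def \<phi>)
  ultimately have "\<exists>s\<in>{- \<theta>0<..<\<theta>0}. \<forall>x\<in>{- \<theta>0..\<theta>0}. f x \<le> f s" by (rule interior_max)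
  then obtain x where x: "x \<in> {- \<theta>0<..<\<theta>0}" "\<And>t. t \<in> {- \<theta>0..\<theta>0} \<Longrightarrow> f t \<le> f x" by blast
  obtain t where t: "t \<in> {- \<theta>0<..<\<theta>0}" "ln (\<phi> x) - scaled \<kappa> 0 x < ln (\<phi> t) - scaled \<kappa> 0 t"
    using no_touching[of 1 \<kappa>, OF _ _ _ order_refl _ x(1), of 0] \<kappa>(1) I by auto
  note ps = \<phi>_pos[OF t(1)] \<phi>_pos[OF x(1)]
  have "ln (f t) \<le> ln (f x)" using x(2)[of t] t(1) ps by (subst ln_le_cancel_iff) (auto simp: f_def)
  then show False using ps t(2) by (simp add: f_def ln_mult)
qed

text \<open>
  If the interval of the exact solution were smaller, \<open>\<phi>\<close> would be positive on the closed interval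
  of a slightly rescaled copy, whose exponential vanishes at both ends: a strict subsolution would
  touch \<open>ln \<circ> \<phi>\<close> from below.
\<close>
lemma T_ge: "\<theta>0 \<le> T"
proof (rule ccontr)
  assume "\<not> \<theta>0 \<le> T"
  define \<kappa> where "\<kappa> = (1 + T / \<theta>0) / 2"
  have \<kappa>: "\<kappa> < 1" "T < \<kappa> * \<theta>0" "0 < \<kappa>"
    using \<open>\<not> \<theta>0 \<le> T\<close> \<theta>0 T_pos by (auto simp: \<kappa>_def field_simps add_pos_pos)
  define a where "a = T / \<kappa>"
  have a: "0 < a" "a < \<theta>0" "\<kappa> * a = T" using \<kappa> T_pos by (auto simp: a_def field_simps)
  have I: "\<bar>\<kappa> * (t - 0)\<bar> < T" if "t \<in> {- a<..<a}" for t
  proof -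
    have "\<bar>\<kappa> * (t - 0)\<bar> = \<kappa> * \<bar>t\<bar>" using \<kappa> by (simp add: abs_mult)
    also have "\<dots> < \<kappa> * a" using that \<kappa> unfolding mem_symmetric_interval by simp
    finally show ?thesis using a by simp
  qed
  have ps: "\<phi> t > 0" if "t \<in> {- a..a}" for t using \<phi>_pos[of t] that a by simp
  define f where "f t = E (\<kappa> * t) * exp (- (\<kappa> * ln (\<phi> t)))" for t
  have "continuous_on {- a..a} (\<lambda>t. E (\<kappa> * t))"
  proof (rule continuous_on_compose2[OF E_cont])
    show "(\<lambda>t. \<kappa> * t) ` {- a..a} \<subseteq> {- T..T}"
    proof
      fix y assume "y \<in> (\<lambda>t. \<kappa> * t) ` {- a..a}"
      then obtain t where "y = \<kappa> * t" "t \<in> {- a..a}" by blast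
      then have t: "y = \<kappa> * t" "- a \<le> t" "t \<le> a" by auto
      have "\<kappa> * t \<le> \<kappa> * a" "\<kappa> * (- a) \<le> \<kappa> * t"
        using mult_left_mono[of t a \<kappa>] mult_left_mono[of "- a" t \<kappa>] t \<kappa> by linarith+
      then show "y \<in> {- T..T}" using a t(1) by simp
    qed
  qed (intro continuous_intros)
  then have "continuous_on {- a..a} f"
    unfolding f_def using a ps
    by (intro continuous_intros continuous_on_subset[OF \<phi>(1)]) (auto simp: less_imp_neq[symmetric])
  moreover have "0 \<in> {- a..a}" "f (- a) < f 0" "f a < f 0"
    using a E_end E_exp[of 0] T_pos by (auto simp: f_def)
  ultimately have "\<exists>s\<in>{- a<..<a}. \<forall>x\<in>{- a..a}. f x \<le> f s" by (rule interior_max)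
  then obtain x where x: "x \<in> {- a<..<a}" "\<And>t. t \<in> {- a..a} \<Longrightarrow> f t \<le> f x" by blast
  have sub_int: "{- a<..<a} \<subseteq> {- \<theta>0<..<\<theta>0}" using a by auto
  obtain t where t: "t \<in> {- a<..<a}" "ln (\<phi> t) - scaled \<kappa> 0 t < ln (\<phi> x) - scaled \<kappa> 0 x"
    using no_touching[of "- 1" \<kappa>, OF _ _ _ sub_int _ x(1), of 0] \<kappa>(1,3) I by auto
  have "ln (f y) = \<kappa> * (scaled \<kappa> 0 y - ln (\<phi> y))" "f y > 0" if "y \<in> {- a<..<a}" for y
    using E_exp[of "\<kappa> * y"] I[OF that] \<kappa> by (simp_all add: f_def scaled_def ln_mult algebra_simps)
  note this[OF x(1)] this[OF t(1)]
  moreover have "f t \<le> f x" using x(2)[of t] t(1) by simp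
  ultimately have "\<kappa> * (scaled \<kappa> 0 t - ln (\<phi> t)) \<le> \<kappa> * (scaled \<kappa> 0 x - ln (\<phi> x))"
    by (metis ln_le_cancel_iff)
  then show False using \<kappa> t(2) by simp
qed

lemma T_eq: "T = \<theta>0" using T_le T_ge by simp

text \<open>
  In terms of \<open>E\<close> the required equation reads \<open>E (r - s) = c * E (- r - s)\<close>. The difference of its
  sides is continuous on the closed interval of admissible shifts and changes sign, as one of the
  two terms vanishes at each end.
\<close>
lemma shift_exists:
  assumes r: "0 < r" "r < T"
  obtains s where "\<bar>s\<bar> < T - r" "V (r - s) - V (- r - s) = ln (\<phi> r) - ln (\<phi> (- r))"
proof -
  have ps: "\<phi> r > 0" "\<phi> (- r) > 0" using \<phi>_pos[of r] \<phi>_pos[of "- r"] r T_eq by simp_all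
  define c where "c = \<phi> r / \<phi> (- r)"
  have c: "c > 0" using ps by (simp add: c_def)
  define K where "K s = E (r - s) - c * E (- r - s)" for s
  have Epos: "E t > 0" if "\<bar>t\<bar> < T" for t using E_exp[OF that] by simp
  have "continuous_on {- (T - r)..T - r} K"
    unfolding K_def using r
    by (intro continuous_intros continuous_on_compose2[OF E_cont]) auto
  moreover have "K (- (T - r)) < 0" "0 < K (T - r)"
    using Epos[of "T - 2 * r"] Epos[of "2 * r - T"] r c E_end
    by (auto simp: K_def algebra_simps)
  ultimately obtain s where s: "- (T - r) \<le> s" "s \<le> T - r" "K s = 0"
    using IVT'[of K "- (T - r)" 0 "T - r"] r by auto
  then have "s \<noteq> - (T - r)" "s \<noteq> T - r" using \<open>K (- (T - r)) < 0\<close> \<open>0 < K (T - r)\<close> by auto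
  then have s': "\<bar>s\<bar> < T - r" using s by linarith
  then have "\<bar>r - s\<bar> < T" "\<bar>- r - s\<bar> < T" using r by linarith+
  then have "exp (V (r - s)) = c * exp (V (- r - s))" using s(3) E_exp by (simp add: K_def)
  then have "V (r - s) = ln c + V (- r - s)"
    using c by (metis exp_gt_zero ln_exp ln_mult_pos)
  then show thesis using that[OF s'] ps by (simp add: c_def ln_div)
qed

text \<open>
  Suppose that \<open>w = ln \<circ> \<phi>\<close> lies above (for \<open>\<sigma> = 1\<close>) or below (for \<open>\<sigma> = - 1\<close>) the shifted exact
  solution at \<open>t\<close>. For \<open>\<kappa>\<close> close to 1 the rescaled solution is close to the unscaled one at the
  three points \<open>t\<close>, \<open>r\<close> and \<open>- r\<close>, so \<open>\<sigma>\<close> times the difference of \<open>w\<close> and the rescaled solution is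
  still larger at \<open>t\<close> than at both ends and has an interior maximum. If \<open>\<kappa>\<close> is moved away from 1
  in the direction of \<open>\<sigma>\<close>, this contradicts \<open>no_touching\<close>.
\<close>
lemma local_representation:
  assumes r: "0 < r" "r < T" and s: "\<bar>s\<bar> < T - r"
    and eq: "V (r - s) - V (- r - s) = ln (\<phi> r) - ln (\<phi> (- r))"
    and t: "\<bar>t\<bar> < r"
  shows "ln (\<phi> t) - ln (\<phi> (- r)) = V (t - s) - V (- r - s)"
proof -
  define w where "w t = ln (\<phi> t)" for t
  have ps: "\<phi> x > 0" if "x \<in> {- r..r}" for x using \<phi>_pos[of x] that r T_eq by simp
  have w_cont: "continuous_on {- r..r} w"
    unfolding w_def using ps r T_eq
    by (intro continuous_intros continuous_on_subset[OF \<phi>(1)]) (auto simp: less_imp_neq[symmetric])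
  have sub_int: "{- r<..<r} \<subseteq> {- \<theta>0<..<\<theta>0}" using r T_eq by auto
  have in_T: "\<bar>x - s\<bar> < T" if "x \<in> {- r..r}" for x
    using that s unfolding atLeastAtMost_iff by linarith
  have scaled_tendsto: "((\<lambda>\<kappa>. scaled \<kappa> s x) \<longlongrightarrow> V (x - s)) (at 1)" if "x \<in> {- r..r}" for x
  proof -
    have "isCont (\<lambda>\<kappa>. V (\<kappa> * (x - s))) 1"
      by (rule isCont_o2[of 1 "\<lambda>\<kappa>. \<kappa> * (x - s)" V]) (use V_isCont in_T[OF that] in \<open>auto intro!: continuous_intros\<close>)
    then have "isCont (\<lambda>\<kappa>. scaled \<kappa> s x) 1" unfolding scaled_def by (intro continuous_intros) auto
    then have "((\<lambda>\<kappa>. scaled \<kappa> s x) \<longlongrightarrow> scaled 1 s x) (at 1)" by (simp add: isCont_def)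
    then show ?thesis by (simp add: scaled_def)
  qed
  have bound_tendsto: "((\<lambda>\<kappa>. \<bar>\<kappa>\<bar> * (r + \<bar>s\<bar>)) \<longlongrightarrow> \<bar>1\<bar> * (r + \<bar>s\<bar>)) (at (1::real))"
    by (intro tendsto_intros)
  have near: "eventually (\<lambda>\<kappa>. \<bar>\<kappa>\<bar> * (r + \<bar>s\<bar>) < T \<and> (\<forall>x\<in>{t, r, - r}. \<bar>scaled \<kappa> s x - V (x - s)\<bar> < \<delta>)) (at 1)"
    if \<delta>: "\<delta> > 0" for \<delta>
  proof (intro eventually_conj eventually_ball_finite ballI)
    show "eventually (\<lambda>\<kappa>. \<bar>\<kappa>\<bar> * (r + \<bar>s\<bar>) < T) (at 1)"
      by (rule order_tendstoD(2)[OF bound_tendsto]) (use s in auto)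
    fix x assume "x \<in> {t, r, - r}"
    then have "x \<in> {- r..r}" using t r by auto
    from tendstoD[OF scaled_tendsto[OF this] \<delta>]
    show "eventually (\<lambda>\<kappa>. \<bar>scaled \<kappa> s x - V (x - s)\<bar> < \<delta>) (at 1)" by (simp add: dist_real_def)
  qed simp
  have I: "\<bar>\<kappa> * (x - s)\<bar> < T" if "\<bar>\<kappa>\<bar> * (r + \<bar>s\<bar>) < T" "x \<in> {- r..r}" for \<kappa> x
  proof -
    have "\<bar>\<kappa> * (x - s)\<bar> \<le> \<bar>\<kappa>\<bar> * (r + \<bar>s\<bar>)"
      unfolding abs_mult using that(2) by (intro mult_left_mono) auto
    then show ?thesis using that by simp
  qed
  have sc_cont: "continuous_on {- r..r} (scaled \<kappa> s)" if "\<bar>\<kappa>\<bar> * (r + \<bar>s\<bar>) < T" "\<kappa> > 0" for \<kappa>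
  proof -
    have "C2_jet {- r..r} (scaled \<kappa> s) (\<lambda>t. V1 (\<kappa> * (t - s))) (\<lambda>t. \<kappa> * V2 (\<kappa> * (t - s)))"
      using that I by (intro scaled_jet) auto
    then show ?thesis
      unfolding C2_jet_def by (intro continuous_at_imp_continuous_on) (blast intro: DERIV_isCont)
  qed
  have t_in: "t \<in> {- r..r}" using t by auto
  define y where "y x = V (x - s) - V (- r - s) + w (- r)" for x
  have y_end: "y r = w r" "y (- r) = w (- r)" using eq by (simp_all add: y_def w_def)
  have le: "\<sigma> * (w t - y t) \<le> 0" if \<sigma>: "\<sigma> \<in> {1, - 1}" for \<sigma>
  proof (rule ccontr)
    assume "\<not> \<sigma> * (w t - y t) \<le> 0"
    define \<delta> where "\<delta> = \<sigma> * (w t - y t) / 3"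
    have \<delta>: "\<delta> > 0" using \<open>\<not> \<sigma> * (w t - y t) \<le> 0\<close> by (simp add: \<delta>_def)
    obtain d where d: "d > 0" "\<And>\<kappa>. \<kappa> \<noteq> 1 \<Longrightarrow> \<bar>\<kappa> - 1\<bar> < d \<Longrightarrow>
        \<bar>\<kappa>\<bar> * (r + \<bar>s\<bar>) < T \<and> (\<forall>x\<in>{t, r, - r}. \<bar>scaled \<kappa> s x - V (x - s)\<bar> < \<delta>)"
      using near[OF \<delta>] unfolding eventually_at dist_real_def by blast
    define \<kappa> where "\<kappa> = 1 + \<sigma> * (min d 1 / 2)"
    have \<kappa>: "0 < \<sigma> * (\<kappa> - 1)" "0 < \<kappa>" "\<kappa> \<noteq> 1" "\<bar>\<kappa> - 1\<bar> < d"
      using \<sigma> d(1) by (auto simp: \<kappa>_def min_def)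
    have \<kappa>T: "\<bar>\<kappa>\<bar> * (r + \<bar>s\<bar>) < T" and close: "\<bar>scaled \<kappa> s t - V (t - s)\<bar> < \<delta>"
        "\<bar>scaled \<kappa> s r - V (r - s)\<bar> < \<delta>" "\<bar>scaled \<kappa> s (- r) - V (- r - s)\<bar> < \<delta>"
      using d(2)[OF \<kappa>(3,4)] by blast+
    define f where "f x = \<sigma> * (w x - scaled \<kappa> s x)" for x
    have "continuous_on {- r..r} f" unfolding f_def
      by (intro continuous_on_mult_left continuous_on_diff w_cont sc_cont \<kappa>T \<kappa>(2))
    moreover have "f (- r) < f t" "f r < f t"
    proof -
      have "\<sigma> * (w t - y t) = 3 * \<delta>" by (simp add: \<delta>_def)
      then show "f (- r) < f t" "f r < f t"
        using close y_end \<sigma> unfolding f_def y_def by (elim insertE emptyE; simp only: mult_1 mult_minus1; linarith)+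
    qed
    ultimately obtain x where x: "x \<in> {- r<..<r}" "\<And>t. t \<in> {- r..r} \<Longrightarrow> f t \<le> f x"
      using interior_max[of "- r" r f t] t_in by blast
    obtain z where "z \<in> {- r<..<r}" "f x < f z"
      using no_touching[OF \<sigma> \<kappa>(1,2) sub_int I[OF \<kappa>T] x(1)] unfolding f_def w_def by auto
    then show False using x(2)[of z] by auto
  qed
  have "w t = y t" using le[of 1] le[of "- 1"] by simp
  then show ?thesis by (simp add: y_def w_def)
qed

text \<open>The shift that belongs to \<open>r\<close> is smaller than \<open>T - r\<close>; letting \<open>r\<close> tend to \<open>T\<close> removes it.\<close>
lemma representation:
  assumes t: "\<bar>t\<bar> < T"
  shows "ln (\<phi> t) - ln (\<phi> 0) = V t - V 0"
proof -
  \<comment> \<open>A sequence in the open interval from \<open>\<bar>t\<bar>\<close> to \<open>T\<close>; the second successor keeps its first member above \<open>\<bar>t\<bar>\<close>.\<close>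
  define r where "r n = T - (T - \<bar>t\<bar>) / real (Suc (Suc n))" for n
  have r: "\<bar>t\<bar> < r n" "r n < T" for n
  proof -
    have "(T - \<bar>t\<bar>) / real (Suc (Suc n)) < (T - \<bar>t\<bar>) / 1"
      using t by (intro divide_strict_left_mono) auto
    then show "\<bar>t\<bar> < r n" "r n < T" using t by (auto simp: r_def)
  qed
  have "\<exists>s. \<bar>s\<bar> < T - r n \<and> ln (\<phi> t) - ln (\<phi> 0) = V (t - s) - V (0 - s)" for n
  proof -
    have r0: "0 < r n" using r(1)[of n] by linarith
    obtain s where s: "\<bar>s\<bar> < T - r n" "V (r n - s) - V (- r n - s) = ln (\<phi> (r n)) - ln (\<phi> (- r n))"
      using shift_exists[OF r0 r(2)] by blast
    show ?thesis
      using local_representation[OF r0 r(2) s r(1)] local_representation[OF r0 r(2) s, of 0] r0 s(1)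
      by (intro exI[of _ s]) simp
  qed
  then obtain s where s: "\<And>n. \<bar>s n\<bar> < T - r n" "\<And>n. ln (\<phi> t) - ln (\<phi> 0) = V (t - s n) - V (0 - s n)"
    by metis
  have "(\<lambda>n. (T - \<bar>t\<bar>) / real (Suc (Suc n))) \<longlonglongrightarrow> 0"
    by (rule LIMSEQ_Suc[OF LIMSEQ_Suc]) (rule lim_const_over_n)
  then have s_lim: "s \<longlonglongrightarrow> 0"
    by (rule Lim_null_comparison[rotated]) (use s(1) in \<open>auto simp: r_def less_imp_le\<close>)
  have "(\<lambda>n. V (t - s n) - V (0 - s n)) \<longlonglongrightarrow> V (t - 0) - V (0 - 0)"
    by (intro tendsto_diff isCont_tendsto_compose[of _ V] V_isCont tendsto_intros s_lim) (use t T_pos in auto)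
  then show ?thesis
    unfolding s(2)[symmetric] by (simp add: LIMSEQ_const_iff)
qed

lemma multiple_of_exact_solution: "\<exists>c>0. \<forall>t\<in>{- \<theta>0..\<theta>0}. \<phi> t = c * E t"
proof (intro exI[of _ "\<phi> 0 / E 0"] conjI ballI)
  have 0: "\<phi> 0 > 0" "E 0 = exp (V 0)" using \<phi>(2)[of 0] \<theta>0 E_exp[of 0] T_pos by auto
  then show "\<phi> 0 / E 0 > 0" by simp
  fix t assume t: "t \<in> {- \<theta>0..\<theta>0}"
  show "\<phi> t = \<phi> 0 / E 0 * E t"
  proof (cases "\<bar>t\<bar> < \<theta>0")
    case True
    then have "\<phi> t > 0" "E t = exp (V t)" "\<bar>t\<bar> < T" using \<phi>(2)[of t] E_exp[of t] T_eq by simp_all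
    from representation[OF this(3)] have "ln (\<phi> t) = ln (\<phi> 0) + (V t - V 0)" by simp
    then have "\<phi> t = \<phi> 0 * exp (V t - V 0)" using \<open>\<phi> t > 0\<close> 0(1) by (metis exp_add exp_ln)
    then show ?thesis using 0 \<open>E t = exp (V t)\<close> by (simp add: exp_diff)
  next
    case False
    then have "t = \<theta>0 \<or> t = - \<theta>0" using t by auto
    then show ?thesis using \<phi>(3,4) E_end T_eq by auto
  qed
qed

end

section \<open>The explicit angular solutions\<close>

lemma ln_quadratic_deriv:
  fixes c :: real
  assumes "0 < 1 + c * X\<^sup>2"
  shows "((\<lambda>X. ln (1 + c * X\<^sup>2)) has_real_derivative 2 * c * X / (1 + c * X\<^sup>2)) (at X)"
  using assms by (auto intro!: derivative_eq_intros)

text \<open>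
  Its sign decides whether there is an exact solution. It is affine in \<open>X\<^sup>2\<close> with value
  \<open>(k + 1) * \<alpha>\<close> at \<open>X = 1\<close>, so on \<open>[-1, 1]\<close> it has the sign of \<alpha> as soon as it does at 0.
\<close>
definition quad :: "real \<Rightarrow> real \<Rightarrow> real \<Rightarrow> real" where
  "quad k \<alpha> X = (\<alpha> - 1 + k) + (k * (\<alpha> - 1) + 1) * X\<^sup>2"

text \<open>The derivative of the angle with respect to the parameter \<open>X\<close>.\<close>
definition angle_speed :: "real \<Rightarrow> real \<Rightarrow> real \<Rightarrow> real" where
  "angle_speed k \<alpha> X = sgn \<alpha> * sqrt k * (k + 1) * (1 + X\<^sup>2) / (quad k \<alpha> X * (1 + k * X\<^sup>2))"

text \<open>The two profiles of the theorem are the cases \<open>k = \<omega>\<close> and \<open>k = 1 / \<omega>\<close>.\<close>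
definition profile :: "real \<Rightarrow> real \<Rightarrow> real \<Rightarrow> real" where
  "profile k \<alpha> X = (1 - X\<^sup>2) * (1 + (k * (\<alpha> - 1) + 1) / (\<alpha> - 1 + k) * X\<^sup>2) powr ((\<alpha> - 2) / 2)
     / (1 + k * X\<^sup>2) powr (\<alpha> / 2)"

lemma square_le_1_interval: "X \<in> {-1..1} \<Longrightarrow> X\<^sup>2 \<le> (1::real)"
  unfolding abs_square_le_1 atLeastAtMost_iff by linarith

lemma square_less_1_interval: "X \<in> {-1<..<1} \<Longrightarrow> X\<^sup>2 < (1::real)"
  unfolding abs_square_less_1 greaterThanLessThan_iff by linarith

lemma quad_sign:
  assumes "0 < k" "0 < \<alpha> * (\<alpha> - 1 + k)" "X \<in> {-1..1}"
  shows "0 < \<alpha> * quad k \<alpha> X"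
proof -
  have eq: "\<alpha> * quad k \<alpha> X = (1 - X\<^sup>2) * (\<alpha> * (\<alpha> - 1 + k)) + X\<^sup>2 * ((k + 1) * \<alpha>\<^sup>2)"
    by (simp add: quad_def power2_eq_square algebra_simps)
  have X: "X\<^sup>2 \<le> 1" using square_le_1_interval[OF assms(3)] .
  have "\<alpha>\<^sup>2 > 0" using assms(2) by auto
  show ?thesis
  proof (cases "X = 0")
    case True then show ?thesis unfolding eq using assms by simp
  next
    case False
    then have "0 < X\<^sup>2 * ((k + 1) * \<alpha>\<^sup>2)" using \<open>\<alpha>\<^sup>2 > 0\<close> assms(1) by simp
    moreover have "0 \<le> (1 - X\<^sup>2) * (\<alpha> * (\<alpha> - 1 + k))"
      by (rule mult_nonneg_nonneg) (use X assms(2) in simp_all)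
    ultimately show ?thesis unfolding eq by (rule add_nonneg_pos[rotated])
  qed
qed

lemma angle_speed_pos:
  assumes "0 < k" "0 < \<alpha> * (\<alpha> - 1 + k)" "X \<in> {-1..1}"
  shows "0 < angle_speed k \<alpha> X"
proof -
  have "0 < sgn \<alpha> / quad k \<alpha> X"
    using quad_sign[OF assms] by (auto simp: zero_less_mult_iff zero_less_divide_iff sgn_if)
  moreover have "0 < sqrt k * (k + 1) * (1 + X\<^sup>2) / (1 + k * X\<^sup>2)"
    using assms(1) by (intro divide_pos_pos mult_pos_pos add_pos_nonneg) auto
  ultimately have "0 < sgn \<alpha> / quad k \<alpha> X * (sqrt k * (k + 1) * (1 + X\<^sup>2) / (1 + k * X\<^sup>2))"
    by (rule mult_pos_pos)
  then show ?thesis by (simp add: angle_speed_def mult_ac)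
qed

text \<open>
  Any odd primitive \<open>G\<close> of \<open>angle_speed\<close> on \<open>[-1, 1]\<close>. For \<open>0 < \<alpha> < 1\<close> the radial entry
  \<open>\<alpha> * (\<alpha> - 1)\<close> is negative and the roles of the two eigenvalues are exchanged, which replaces \<open>\<omega>\<close>
  by its inverse.
\<close>
locale angular_profile =
  fixes lam Lam \<alpha> k :: real and G :: "real \<Rightarrow> real"
  assumes pos: "0 < lam" "0 < Lam"
    and k_def: "k = (if 0 < \<alpha> \<and> \<alpha> < 1 then lam / Lam else Lam / lam)"
    and admissible: "0 < \<alpha> * (\<alpha> - 1 + k)"
    and G_odd: "\<And>X. X \<in> {-1..1} \<Longrightarrow> G (- X) = - G X"
    and G_deriv: "\<And>X. X \<in> {-1..1} \<Longrightarrow> (G has_real_derivative angle_speed k \<alpha> X) (at X)"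
begin

definition "aperture = G 1"

definition "Xi = inv_into {-1..1} G"

definition "log_profile X = ln (1 - X\<^sup>2)
   + (\<alpha> - 2) / 2 * ln (1 + (k * (\<alpha> - 1) + 1) / (\<alpha> - 1 + k) * X\<^sup>2) - \<alpha> / 2 * ln (1 + k * X\<^sup>2)"

definition "log_slope X = - \<bar>\<alpha>\<bar> * (k + 1) * X / (sqrt k * (1 - X\<^sup>2))"

definition "log_curvature X = - \<alpha> * quad k \<alpha> X * (1 + k * X\<^sup>2) / (k * (1 - X\<^sup>2)\<^sup>2)"

lemma k_pos: "0 < k" using pos by (simp add: k_def)

lemma nonzero: "\<alpha> \<noteq> 0" "\<alpha> - 1 + k \<noteq> 0" using admissible by auto

lemmas quad_pos = quad_sign[OF k_pos admissible]
lemmas speed_pos = angle_speed_pos[OF k_pos admissible]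

lemma one_plus_pos: "0 < 1 + k * X\<^sup>2" using k_pos by (simp add: add_pos_nonneg)

lemma ratio_eq: "1 + (k * (\<alpha> - 1) + 1) / (\<alpha> - 1 + k) * X\<^sup>2 = quad k \<alpha> X / (\<alpha> - 1 + k)"
  using nonzero(2) by (simp add: quad_def field_simps)

lemma ratio_pos: "X \<in> {-1..1} \<Longrightarrow> 0 < 1 + (k * (\<alpha> - 1) + 1) / (\<alpha> - 1 + k) * X\<^sup>2"
  unfolding ratio_eq using quad_pos[of X] admissible by (auto simp: zero_less_mult_iff zero_less_divide_iff)

lemma profile_exp: "X \<in> {-1<..<1} \<Longrightarrow> profile k \<alpha> X = exp (log_profile X)"
  using square_less_1_interval[of X] ratio_pos[of X] one_plus_pos[of X]
  by (simp add: profile_def log_profile_def exp_add exp_diff powr_def)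

lemma profile_continuous: "continuous_on {-1..1} (profile k \<alpha>)"
  unfolding profile_def using ratio_pos one_plus_pos
  by (intro continuous_intros) (auto simp: less_imp_neq[symmetric])

lemma profile_end: "profile k \<alpha> 1 = 0" "profile k \<alpha> (- 1) = 0"
  by (simp_all add: profile_def)

lemma profile_abs: "profile k \<alpha> \<bar>X\<bar> = profile k \<alpha> X"
  by (simp add: profile_def)

text \<open>
  By the chain rule this says that the derivative of \<open>log_profile\<close> with respect to the angle is
  \<open>log_slope\<close>. After clearing denominators it is a polynomial identity.
\<close>
lemma log_profile_deriv:
  assumes X: "X \<in> {-1<..<1}"
  shows "(log_profile has_real_derivative log_slope X * angle_speed k \<alpha> X) (at X)"
proof -
  define q p B kA where "q = quad k \<alpha> X" and "p = 1 + k * X\<^sup>2" and "B = \<alpha> - 1 + k" and "kA = k * (\<alpha> - 1) + 1"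
  have q: "q \<noteq> 0" "q = B + kA * X\<^sup>2" and p: "p > 0" and B: "B \<noteq> 0" and X1: "1 - X\<^sup>2 > 0"
    using quad_pos[of X] X one_plus_pos[of X] nonzero(2) square_less_1_interval[OF X]
    by (auto simp: q_def p_def B_def kA_def quad_def)
  have r: "1 + kA / B * X\<^sup>2 = q / B" "1 + kA / B * X\<^sup>2 > 0"
    using ratio_eq[of X] ratio_pos[of X] X by (simp_all add: q_def B_def kA_def)
  have D: "((\<lambda>X. ln (1 + - 1 * X\<^sup>2) + (\<alpha> - 2) / 2 * ln (1 + kA / B * X\<^sup>2) - \<alpha> / 2 * ln (1 + k * X\<^sup>2))
      has_real_derivative 2 * - 1 * X / (1 + - 1 * X\<^sup>2) + (\<alpha> - 2) / 2 * (2 * (kA / B) * X / (1 + kA / B * X\<^sup>2))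
        - \<alpha> / 2 * (2 * k * X / (1 + k * X\<^sup>2))) (at X)"
    by (intro DERIV_diff DERIV_add DERIV_cmult ln_quadratic_deriv) (use X1 r(2) p in \<open>simp_all add: p_def\<close>)
  have e0: "(\<lambda>X. ln (1 + - 1 * X\<^sup>2) + (\<alpha> - 2) / 2 * ln (1 + kA / B * X\<^sup>2) - \<alpha> / 2 * ln (1 + k * X\<^sup>2)) = log_profile"
    by (simp add: log_profile_def[abs_def] kA_def B_def)
  have e1: "2 * - 1 * X / (1 + - 1 * X\<^sup>2) + (\<alpha> - 2) / 2 * (2 * (kA / B) * X / (1 + kA / B * X\<^sup>2))
        - \<alpha> / 2 * (2 * k * X / (1 + k * X\<^sup>2))
      = - 2 * X / (1 - X\<^sup>2) + (\<alpha> - 2) * kA * X / q - \<alpha> * k * X / p"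
    unfolding r(1) p_def using B by simp
  have e2: "- 2 * X / (1 - X\<^sup>2) + (\<alpha> - 2) * kA * X / q - \<alpha> * k * X / p = (- 2 * X * q * p + (\<alpha> - 2) * kA * X * (1 - X\<^sup>2) * p - \<alpha> * k * X * (1 - X\<^sup>2) * q) / ((1 - X\<^sup>2) * q * p)"
    using X1 q(1) p by (simp add: field_simps)
  have e3: "- 2 * X * q * p + (\<alpha> - 2) * kA * X * (1 - X\<^sup>2) * p - \<alpha> * k * X * (1 - X\<^sup>2) * q
      = - \<alpha> * (k + 1)\<^sup>2 * X * (1 + X\<^sup>2)"
    unfolding q(2) p_def kA_def B_def by (simp add: power2_eq_square algebra_simps)
  have e4: "log_slope X * angle_speed k \<alpha> X = - \<alpha> * (k + 1)\<^sup>2 * X * (1 + X\<^sup>2) / ((1 - X\<^sup>2) * q * p)"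
  proof -
    have "sqrt k \<noteq> 0" using k_pos by simp
    then have "log_slope X * angle_speed k \<alpha> X
        = - (\<bar>\<alpha>\<bar> * sgn \<alpha>) * ((k + 1) * (k + 1)) * X * (1 + X\<^sup>2) / ((1 - X\<^sup>2) * q * p)"
      by (simp add: log_slope_def angle_speed_def q_def[symmetric] p_def[symmetric] mult_ac)
    then show ?thesis by (simp only: abs_mult_sgn power2_eq_square[of "k + 1"])
  qed
  show ?thesis using D unfolding e0 e1 e2 e3 e4 .
qed

lemma log_slope_deriv:
  assumes X: "X \<in> {-1<..<1}"
  shows "(log_slope has_real_derivative log_curvature X * angle_speed k \<alpha> X) (at X)"
proof -
  have X1: "1 - X\<^sup>2 > 0" using square_less_1_interval[OF X] by simp
  have s: "sqrt k > 0" "sqrt k * sqrt k = k" using k_pos by auto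
  have q: "quad k \<alpha> X \<noteq> 0" using quad_pos[of X] X by auto
  have p: "1 + k * X\<^sup>2 > 0" by (rule one_plus_pos)
  have a: "\<bar>\<alpha>\<bar> = sgn \<alpha> * \<alpha>" by (simp add: sgn_if abs_if)
  define C where "C = - \<bar>\<alpha>\<bar> * (k + 1) / sqrt k"
  have "((\<lambda>X. X / (1 - X\<^sup>2)) has_real_derivative (1 * (1 - X\<^sup>2) - X * (- (2 * X))) / ((1 - X\<^sup>2) * (1 - X\<^sup>2))) (at X)"
    using X1 by (intro DERIV_divide) (auto intro!: derivative_eq_intros)
  from DERIV_cmult[OF this, of C]
  have "(log_slope has_real_derivative C * ((1 * (1 - X\<^sup>2) - X * (- (2 * X))) / ((1 - X\<^sup>2) * (1 - X\<^sup>2)))) (at X)"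
    by (simp add: log_slope_def[abs_def] C_def)
  moreover have "C * ((1 * (1 - X\<^sup>2) - X * (- (2 * X))) / ((1 - X\<^sup>2) * (1 - X\<^sup>2)))
     = (sqrt k * (- \<bar>\<alpha>\<bar> * (k + 1) * (1 + X\<^sup>2))) / (k * (1 - X\<^sup>2)\<^sup>2)"
  proof -
    have "C = sqrt k * (- \<bar>\<alpha>\<bar> * (k + 1)) / k"
      unfolding C_def using s by (simp add: divide_eq_eq eq_divide_eq mult_ac)
    moreover have "1 * (1 - X\<^sup>2) - X * (- (2 * X)) = 1 + X\<^sup>2" by (simp add: power2_eq_square)
    ultimately show ?thesis by (simp only: times_divide_times_eq power2_eq_square[of "1 - X\<^sup>2"] mult.assoc)
  qed
  moreover have "\<dots> = log_curvature X * angle_speed k \<alpha> X"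
    using X1 k_pos q p
    by (simp add: log_curvature_def angle_speed_def a mult_ac)
  ultimately show ?thesis by simp
qed

lemma log_curvature_neg:
  assumes X: "X \<in> {-1<..<1}"
  shows "log_curvature X < 0"
proof -
  have "0 < (\<alpha> * quad k \<alpha> X) * (1 + k * X\<^sup>2) / (k * (1 - X\<^sup>2)\<^sup>2)"
  proof (intro divide_pos_pos mult_pos_pos[OF quad_pos one_plus_pos])
    show "0 < k * (1 - X\<^sup>2)\<^sup>2" using k_pos square_less_1_interval[OF X] by simp
  qed (use X in simp)
  then show ?thesis by (simp add: log_curvature_def)
qed

text \<open>
  The third entry simplifies to \<open>a * (k\<^sup>2 * X\<^sup>2 - 1) / (k * (1 - X\<^sup>2))\<close>, and then trace and
  determinant are \<open>(k - 1) * m\<close> and \<open>- k * m\<^sup>2\<close>, where \<open>m\<close> has the sign of \<open>a = \<alpha> * (\<alpha> - 1)\<close>. For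
  \<open>m \<ge> 0\<close> the eigenvalues are \<open>k * m\<close> and \<open>- m\<close> with \<open>k = \<omega>\<close>; for \<open>m \<le> 0\<close> they are \<open>\<omega> * m'\<close> and
  \<open>- m'\<close> with \<open>k = 1 / \<omega>\<close> and \<open>m' = - k * m\<close>.
\<close>
lemma profile_solves_equation:
  assumes X: "X \<in> {-1<..<1}"
  shows "angular_op lam Lam \<alpha> (log_slope X) (log_curvature X) = 0"
proof -
  define y where "y = X\<^sup>2"
  define a b c m where "a = \<alpha> * (\<alpha> - 1)" and "b = (\<alpha> - 1) * log_slope X"
    and "c = \<alpha> + log_curvature X + (log_slope X)\<^sup>2"
    and "m = \<alpha> * (\<alpha> - 1) * (1 + k * X\<^sup>2) / (k * (1 - X\<^sup>2))"
  have y: "y < 1" "0 \<le> y" using square_less_1_interval[OF X] by (auto simp: y_def)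
  note k = k_pos
  have W2: "(log_slope X)\<^sup>2 = \<alpha>\<^sup>2 * (k + 1)\<^sup>2 * y / (k * (1 - y)\<^sup>2)"
    using k by (simp add: log_slope_def y_def power_divide power_mult_distrib)
  have c: "c = a * (k\<^sup>2 * y - 1) / (k * (1 - y))"
  proof -
    have "c = (\<alpha> * k * (1 - y)\<^sup>2 - \<alpha> * (\<alpha> - 1 + k + (k * (\<alpha> - 1) + 1) * y) * (1 + k * y) + \<alpha>\<^sup>2 * (k + 1)\<^sup>2 * y) / (k * (1 - y)\<^sup>2)"
      unfolding c_def W2 using k y
      by (simp add: log_curvature_def quad_def y_def[symmetric] add_divide_distrib diff_divide_distrib)
    also have "\<alpha> * k * (1 - y)\<^sup>2 - \<alpha> * (\<alpha> - 1 + k + (k * (\<alpha> - 1) + 1) * y) * (1 + k * y) + \<alpha>\<^sup>2 * (k + 1)\<^sup>2 * y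
       = a * (k\<^sup>2 * y - 1) * (1 - y)"
      by (simp add: a_def power2_eq_square algebra_simps)
    finally show ?thesis using y by (simp add: power2_eq_square)
  qed
  have m: "m = a * (1 + k * y) / (k * (1 - y))" by (simp add: m_def a_def y_def)
  have tr: "a + c = (k - 1) * m"
  proof -
    have "a + c = (a * (k * (1 - y)) + a * (k\<^sup>2 * y - 1)) / (k * (1 - y))"
      unfolding c using k y by (simp add: add_divide_distrib)
    also have "a * (k * (1 - y)) + a * (k\<^sup>2 * y - 1) = (k - 1) * (a * (1 + k * y))"
      by (simp add: power2_eq_square algebra_simps)
    finally show ?thesis unfolding m by simp
  qed
  have ac: "a * c = a * a * ((k\<^sup>2 * y - 1) * (1 - y)) / (k * (1 - y)\<^sup>2)"
    unfolding c using y by (simp add: power2_eq_square)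
  have b2: "b\<^sup>2 = a * a * (k + 1)\<^sup>2 * y / (k * (1 - y)\<^sup>2)"
    unfolding b_def power_mult_distrib W2 a_def by (simp add: power2_eq_square mult_ac)
  have det: "a * c - b\<^sup>2 = - k * m\<^sup>2"
  proof -
    have "a * c - b\<^sup>2 = a * a * ((k\<^sup>2 * y - 1) * (1 - y) - (k + 1)\<^sup>2 * y) / (k * (1 - y)\<^sup>2)"
      unfolding ac b2 diff_divide_distrib[symmetric] by (simp add: right_diff_distrib mult_ac)
    also have "(k\<^sup>2 * y - 1) * (1 - y) - (k + 1)\<^sup>2 * y = - (1 + k * y)\<^sup>2"
      by (simp add: power2_eq_square algebra_simps)
    also have "a * a * (- (1 + k * y)\<^sup>2) / (k * (1 - y)\<^sup>2) = - k * m\<^sup>2"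
      unfolding m using k by (simp add: power2_eq_square mult_ac)
    finally show ?thesis .
  qed
  have "pucci_sym lam Lam a b c = 0"
  proof (cases "0 < \<alpha> \<and> \<alpha> < 1")
    case True
    then have k': "k = lam / Lam" by (simp add: k_def)
    have "a \<le> 0" using True by (simp add: a_def mult_le_0_iff)
    then have "a * ((1 + k * y) / (k * (1 - y))) \<le> 0"
      using k y by (intro mult_nonpos_nonneg divide_nonneg_nonneg) auto
    then have "m \<le> 0" by (simp add: m_def a_def y_def)
    show ?thesis
    proof (intro pucci_sym_eq_0[of lam Lam "- k * m"] pos)
      have r: "Lam / lam = 1 / k" using k' by simp
      show "0 \<le> - k * m" using k \<open>m \<le> 0\<close> by (simp add: mult_nonneg_nonpos)
      show "a + c = (Lam / lam - 1) * (- k * m)" unfolding r tr using k by (simp add: left_diff_distrib)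
      show "a * c - b\<^sup>2 = - (Lam / lam) * (- k * m)\<^sup>2" unfolding r det using k by (simp add: power2_eq_square)
    qed
  next
    case False
    then have k': "k = Lam / lam" by (auto simp: k_def)
    have "a \<ge> 0" using False by (auto simp: a_def zero_le_mult_iff)
    then have "0 \<le> a * ((1 + k * y) / (k * (1 - y)))"
      using k y by (intro mult_nonneg_nonneg divide_nonneg_nonneg) auto
    then have "m \<ge> 0" by (simp add: m_def a_def y_def)
    then show ?thesis
      by (intro pucci_sym_eq_0[of lam Lam m] pos) (use tr det in \<open>simp_all add: k'\<close>)
  qed
  then show ?thesis by (simp add: angular_op_def a_def b_def c_def)
qed

lemma G_strict_mono:
  assumes "x \<in> {-1..1}" "y \<in> {-1..1}" "x < y"
  shows "G x < G y"
proof (rule DERIV_pos_imp_increasing[OF assms(3)])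
  fix z assume "x \<le> z" "z \<le> y"
  then have z: "z \<in> {-1..1}" using assms by simp
  show "\<exists>d. (G has_real_derivative d) (at z) \<and> 0 < d"
    using G_deriv[OF z] speed_pos[OF z] by blast
qed

lemma G_0: "G 0 = 0" using G_odd[of 0, unfolded minus_zero] by simp

lemma aperture_pos: "0 < aperture" using G_strict_mono[of 0 1] G_0 by (simp add: aperture_def)

lemma G_inj: "inj_on G {-1..1}"
proof (rule inj_onI)
  fix x y assume xy: "x \<in> {-1..1}" "y \<in> {-1..1}" "G x = G y"
  show "x = y"
    using G_strict_mono[OF xy(1,2)] G_strict_mono[OF xy(2,1)] xy(3) by (cases x y rule: linorder_cases) simp_all
qed

lemma G_cont: "continuous_on {-1..1} G"
  by (intro continuous_at_imp_continuous_on ballI DERIV_isCont[OF G_deriv])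

lemma G_minus_1: "G (- 1) = - aperture" by (simp add: G_odd aperture_def)

lemma G_image: "G ` {-1..1} = {- aperture..aperture}"
proof
  have mono: "G x \<le> G y" if "x \<in> {-1..1}" "y \<in> {-1..1}" "x \<le> y" for x y

  proof (cases "x = y")
    case False
    then have "x < y" using that(3) by simp
    from G_strict_mono[OF that(1,2) this] show ?thesis by simp
  qed simp
  show "G ` {-1..1} \<subseteq> {- aperture..aperture}"
  proof
    fix y assume "y \<in> G ` {-1..1}"
    then obtain x where x: "x \<in> {-1..1}" "y = G x" by blast
    have "G (- 1) \<le> G x" "G x \<le> G 1" by (rule mono, use x in simp_all)+
    then show "y \<in> {- aperture..aperture}" unfolding G_minus_1 x(2) by (simp add: aperture_def)
  qed
  show "{- aperture..aperture} \<subseteq> G ` {-1..1}"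
  proof
    fix y assume "y \<in> {- aperture..aperture}"
    then have "G (- 1) \<le> y" "y \<le> G 1" unfolding G_minus_1 by (simp_all add: aperture_def)
    then obtain x where "- 1 \<le> x" "x \<le> 1" "G x = y"
      using IVT'[of G "- 1" y 1, OF _ _ _ G_cont] by auto
    then show "y \<in> G ` {-1..1}" by (intro image_eqI[of _ _ x]) simp_all
  qed
qed

lemma Xi_in: "t \<in> {- aperture..aperture} \<Longrightarrow> Xi t \<in> {-1..1}"
  and G_Xi: "t \<in> {- aperture..aperture} \<Longrightarrow> G (Xi t) = t"
  unfolding Xi_def G_image[symmetric] by (rule inv_into_into, assumption) (rule f_inv_into_f)

lemma Xi_G: "X \<in> {-1..1} \<Longrightarrow> Xi (G X) = X"
  unfolding Xi_def using inv_into_f_f[OF G_inj] by simp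

lemma Xi_end: "Xi aperture = 1" "Xi (- aperture) = - 1"
  using Xi_G[of 1] Xi_G[of "- 1"] by (simp_all add: G_minus_1) (simp add: aperture_def)

lemma Xi_interior:
  assumes "t \<in> {- aperture<..<aperture}"
  shows "Xi t \<in> {-1<..<1}"
proof -
  have t: "t \<in> {- aperture..aperture}" using assms by simp
  have "Xi t \<noteq> 1" "Xi t \<noteq> - 1" using G_Xi[OF t] assms G_minus_1 unfolding aperture_def by force+
  then show ?thesis using Xi_in[OF t] by simp
qed

lemma Xi_cont: "continuous_on {- aperture..aperture} Xi"
  unfolding G_image[symmetric] by (rule continuous_on_inv[OF G_cont compact_Icc]) (use Xi_G in blast)

lemma Xi_deriv:
  assumes t: "t \<in> {- aperture<..<aperture}"
  shows "(Xi has_real_derivative inverse (angle_speed k \<alpha> (Xi t))) (at t)"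
proof (rule DERIV_inverse_function)
  have i: "Xi t \<in> {-1..1}" using Xi_in[of t] t by simp
  show "(G has_real_derivative angle_speed k \<alpha> (Xi t)) (at (Xi t))" by (rule G_deriv[OF i])
  show "angle_speed k \<alpha> (Xi t) \<noteq> 0" using speed_pos[OF i] by simp
  show "- aperture < t" "t < aperture" using t by auto
  show "G (Xi y) = y" if "- aperture < y" "y < aperture" for y using G_Xi[of y] that by simp
  show "isCont Xi t"
    by (rule continuous_on_interior[OF Xi_cont]) (use t in simp)
qed

text \<open>
  The statement of the theorem inverts the angle map on \<open>[0, 1]\<close> at the unsigned angle. As the map
  is odd and the profile is even, this agrees with the smooth inverse on \<open>[-1, 1]\<close> at the signed
  angle.
\<close>
lemma profile_inv_into:
  assumes t: "t \<in> {- aperture..aperture}"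
  shows "profile k \<alpha> (inv_into {0..1} G \<bar>t\<bar>) = profile k \<alpha> (Xi t)"
proof -
  have Gabs: "G \<bar>Xi t\<bar> = \<bar>t\<bar>"
  proof (cases "Xi t \<ge> 0")
    case True
    then have "G (Xi t) \<ge> 0" using G_strict_mono[of 0 "Xi t"] Xi_in[OF t] G_0 by (cases "Xi t = 0") auto
    then show ?thesis using True G_Xi[OF t] by simp
  next
    case False
    then have "G (Xi t) < 0" using G_strict_mono[of "Xi t" 0] Xi_in[OF t] G_0 by auto
    then show ?thesis using False G_Xi[OF t] by (simp add: G_odd[OF Xi_in[OF t]])
  qed
  have "inj_on G {0..1}" by (rule inj_on_subset[OF G_inj]) auto
  then have "inv_into {0..1} G (G \<bar>Xi t\<bar>) = \<bar>Xi t\<bar>"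
    using Xi_in[OF t] by (intro inv_into_f_f) auto
  then show ?thesis unfolding Gabs by (simp only: profile_abs)
qed

sublocale angular_solution lam Lam \<alpha> aperture "\<lambda>t. log_profile (Xi t)" "\<lambda>t. log_slope (Xi t)"
  "\<lambda>t. log_curvature (Xi t)" "\<lambda>t. profile k \<alpha> (Xi t)"
proof
  show "0 < lam" "0 < Lam" by (rule pos)+
  show "0 < aperture" by (rule aperture_pos)
  show "continuous_on {- aperture..aperture} (\<lambda>t. profile k \<alpha> (Xi t))"
    by (rule continuous_on_compose2[OF profile_continuous Xi_cont]) (use Xi_in in blast)
  show "profile k \<alpha> (Xi t) = exp (log_profile (Xi t))" if "\<bar>t\<bar> < aperture" for t
    using profile_exp[OF Xi_interior] that unfolding mem_symmetric_interval by simp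
  show "profile k \<alpha> (Xi aperture) = 0" "profile k \<alpha> (Xi (- aperture)) = 0"
    unfolding Xi_end by (rule profile_end)+
  show "log_curvature (Xi t) < 0" if "\<bar>t\<bar> < aperture" for t
    using log_curvature_neg[OF Xi_interior] that unfolding mem_symmetric_interval by simp
  show "angular_op lam Lam \<alpha> (log_slope (Xi t)) (log_curvature (Xi t)) = 0" if "\<bar>t\<bar> < aperture" for t
    using profile_solves_equation[OF Xi_interior] that unfolding mem_symmetric_interval by simp
  show "C2_jet {- aperture<..<aperture} (\<lambda>t. log_profile (Xi t)) (\<lambda>t. log_slope (Xi t)) (\<lambda>t. log_curvature (Xi t))"
    unfolding C2_jet_def
  proof (intro conjI ballI)
    fix t assume t: "t \<in> {- aperture<..<aperture}"
    have nz: "angle_speed k \<alpha> (Xi t) \<noteq> 0" using speed_pos[of "Xi t"] Xi_interior[OF t] by simp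
    show "((\<lambda>t. log_profile (Xi t)) has_real_derivative log_slope (Xi t)) (at t)"
      by (rule DERIV_cong[OF DERIV_chain2[OF log_profile_deriv[OF Xi_interior[OF t]] Xi_deriv[OF t]]])
        (use nz in simp)
    show "((\<lambda>t. log_slope (Xi t)) has_real_derivative log_curvature (Xi t)) (at t)"
      by (rule DERIV_cong[OF DERIV_chain2[OF log_slope_deriv[OF Xi_interior[OF t]] Xi_deriv[OF t]]])
        (use nz in simp)
  next
    have "continuous_on {-1<..<1} log_curvature"
      unfolding log_curvature_def quad_def using k_pos square_less_1_interval
      by (intro continuous_intros) fastforce
    then show "continuous_on {- aperture<..<aperture} (\<lambda>t. log_curvature (Xi t))"
      by (rule continuous_on_compose2[OF _ continuous_on_subset[OF Xi_cont]]) (use Xi_interior in auto)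
  qed
qed

end

section \<open>Aperture as a function of the degree\<close>

lemma has_real_derivative_imp_integral:
  fixes F f :: "real \<Rightarrow> real"
  assumes "\<And>x. x \<in> {0..1} \<Longrightarrow> (F has_real_derivative f x) (at x)"
  shows "(f has_integral (F 1 - F 0)) {0..1}"
  using assms
  by (intro fundamental_theorem_of_calculus)
     (auto simp: has_real_derivative_iff_has_vector_derivative[symmetric] intro: has_field_derivative_at_within)

text \<open>
  The parameters \<open>d = sgn \<alpha> * (1 - k)\<close> and \<open>\<beta> = \<bar>\<alpha>\<bar>\<close> put positive and negative degrees into one
  form in which the denominator increases with \<open>\<beta>\<close>.
\<close>
definition aperture_density :: "real \<Rightarrow> real \<Rightarrow> real \<Rightarrow> real \<Rightarrow> real" where
  "aperture_density k d \<beta> X =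
     sqrt k * (k + 1) * (1 + X\<^sup>2) / ((\<beta> * (1 + k * X\<^sup>2) - d * (1 - X\<^sup>2)) * (1 + k * X\<^sup>2))"

definition aperture_integral :: "real \<Rightarrow> real \<Rightarrow> real \<Rightarrow> real" where
  "aperture_integral k d \<beta> = integral {0..1} (aperture_density k d \<beta>)"

lemma angle_speed_eq_density:
  assumes "\<alpha> \<noteq> 0"
  shows "angle_speed k \<alpha> X = aperture_density k (sgn \<alpha> * (1 - k)) \<bar>\<alpha>\<bar> X"
proof -
  have *: "\<bar>\<alpha>\<bar> * (1 + k * X\<^sup>2) - sgn \<alpha> * (1 - k) * (1 - X\<^sup>2) = sgn \<alpha> * quad k \<alpha> X"
    using assms by (simp add: quad_def sgn_if algebra_simps)
  have s: "sgn \<alpha> / quad k \<alpha> X = 1 / (sgn \<alpha> * quad k \<alpha> X)" using assms by (simp add: sgn_if)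
  have "angle_speed k \<alpha> X = sgn \<alpha> / quad k \<alpha> X * (sqrt k * (k + 1) * (1 + X\<^sup>2) / (1 + k * X\<^sup>2))"
    by (simp add: angle_speed_def mult_ac)
  then show ?thesis unfolding s by (simp add: aperture_density_def *)
qed

context
  fixes k d :: real
  assumes k: "0 < k"
begin

text \<open>The denominator is affine in \<open>X\<^sup>2\<close>, with the values \<open>\<beta> - d\<close> at 0 and \<open>(k + 1) * \<beta>\<close> at 1.\<close>
lemma density_denominator_pos:
  assumes "max 0 d < \<beta>" "X \<in> {0..1}"
  shows "0 < \<beta> * (1 + k * X\<^sup>2) - d * (1 - X\<^sup>2)"
proof -
  have X: "X\<^sup>2 \<le> 1" using square_le_1_interval[of X] assms(2) by simp
  have "d * (1 - X\<^sup>2) \<le> max 0 d * (1 - X\<^sup>2)" using X by (intro mult_right_mono) auto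
  also have "\<dots> \<le> max 0 d * 1" by (intro mult_left_mono) auto
  also have "\<dots> < \<beta> * 1" using assms by simp
  also have "\<dots> \<le> \<beta> * (1 + k * X\<^sup>2)" using assms k by (intro mult_left_mono) auto
  finally show ?thesis by simp
qed

lemma one_plus_k_pos: "0 < 1 + k * X\<^sup>2" for X :: real using k by (simp add: add_pos_nonneg)

lemma density_numerator_pos: "0 < sqrt k * (k + 1) * (1 + X\<^sup>2)"
  using k by (intro mult_pos_pos add_pos_nonneg) auto

lemma density_continuous:
  "continuous_on ({max 0 d<..} \<times> cbox 0 1) (\<lambda>(\<beta>, X). aperture_density k d \<beta> X)"
  unfolding aperture_density_def split_beta
  using density_denominator_pos one_plus_k_pos
  by (intro continuous_intros) (force simp: less_imp_neq[symmetric])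

lemma density_continuous_X: "max 0 d < \<beta> \<Longrightarrow> continuous_on {0..1} (aperture_density k d \<beta>)"
  unfolding aperture_density_def
  using density_denominator_pos one_plus_k_pos
  by (intro continuous_intros) (force simp: less_imp_neq[symmetric])

lemma aperture_integral_continuous: "continuous_on {max 0 d<..} (aperture_integral k d)"
  using integral_continuous_on_param[OF density_continuous]
  unfolding aperture_integral_def[abs_def] by simp

lemma aperture_integral_strict_anti:
  assumes "max 0 d < \<beta>" "\<beta> < \<beta>'"
  shows "aperture_integral k d \<beta>' < aperture_integral k d \<beta>"
  unfolding aperture_integral_def
proof (rule integral_less_real)
  show "continuous_on {0..1} (aperture_density k d \<beta>')" "continuous_on {0..1} (aperture_density k d \<beta>)"
    using assms by (auto intro!: density_continuous_X)
  fix X :: real assume "X \<in> {0<..<1}"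
  then have X: "X \<in> {0..1}" by simp
  have less: "\<beta> * (1 + k * X\<^sup>2) < \<beta>' * (1 + k * X\<^sup>2)" using assms one_plus_k_pos by (intro mult_strict_right_mono)
  show "aperture_density k d \<beta>' X < aperture_density k d \<beta> X"
    unfolding aperture_density_def
  proof (intro divide_strict_left_mono density_numerator_pos)
    have "0 < \<beta> * (1 + k * X\<^sup>2) - d * (1 - X\<^sup>2)" "0 < \<beta>' * (1 + k * X\<^sup>2) - d * (1 - X\<^sup>2)"
      using density_denominator_pos[OF _ X] assms by simp_all
    then show "0 < (\<beta>' * (1 + k * X\<^sup>2) - d * (1 - X\<^sup>2)) * (1 + k * X\<^sup>2)
        * ((\<beta> * (1 + k * X\<^sup>2) - d * (1 - X\<^sup>2)) * (1 + k * X\<^sup>2))"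
      using one_plus_k_pos[of X] by simp_all
    show "(\<beta> * (1 + k * X\<^sup>2) - d * (1 - X\<^sup>2)) * (1 + k * X\<^sup>2)
        < (\<beta>' * (1 + k * X\<^sup>2) - d * (1 - X\<^sup>2)) * (1 + k * X\<^sup>2)"
      using less one_plus_k_pos[of X] by (intro mult_strict_right_mono) simp_all
  qed
qed simp

text \<open>For large \<open>\<beta>\<close> the denominator is at least \<open>\<beta> - \<bar>d\<bar>\<close>.\<close>
lemma aperture_integral_small:
  assumes "0 < \<theta>"
  shows "\<exists>\<beta>>max 0 d. aperture_integral k d \<beta> < \<theta>"
proof -
  \<comment> \<open>A bound for the numerator; with this \<open>\<beta>\<close> the density is at most \<open>\<theta> / 2\<close>.\<close>
  define C where "C = sqrt k * (k + 1) * 2"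
  have C: "C > 0" using k by (simp add: C_def)
  define \<beta> where "\<beta> = \<bar>d\<bar> + 2 * C / \<theta>"
  have pos: "2 * C / \<theta> > 0" using C assms by simp
  then have \<beta>: "max 0 d < \<beta>" by (auto simp: \<beta>_def)
  have "aperture_integral k d \<beta> \<le> \<theta> / 2"
  proof -
    have le: "aperture_density k d \<beta> X \<le> \<theta> / 2" if X: "X \<in> {0..1}" for X
    proof -
      have X2: "0 \<le> X\<^sup>2" "X\<^sup>2 \<le> 1" using square_le_1_interval[of X] X by simp_all
      have "d * (1 - X\<^sup>2) \<le> \<bar>d\<bar> * 1" using X2 by (intro mult_mono) auto
      moreover have "\<beta> * 1 \<le> \<beta> * (1 + k * X\<^sup>2)" using \<beta> k by (intro mult_left_mono) auto
      ultimately have "2 * C / \<theta> \<le> \<beta> * (1 + k * X\<^sup>2) - d * (1 - X\<^sup>2)" by (simp add: \<beta>_def)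
      then have "2 * C / \<theta> * 1 \<le> (\<beta> * (1 + k * X\<^sup>2) - d * (1 - X\<^sup>2)) * (1 + k * X\<^sup>2)"
        using pos k by (intro mult_mono) auto
      then have "aperture_density k d \<beta> X \<le> C / (2 * C / \<theta> * 1)"
        unfolding aperture_density_def C_def
        using X2 k pos C_def density_numerator_pos[of X]
        by (intro frac_le mult_left_mono) auto
      then show ?thesis using C by simp
    qed
    have "integral {0..1} (aperture_density k d \<beta>) \<le> integral {0..1} (\<lambda>_::real. \<theta> / 2)"
      using density_continuous_X[OF \<beta>] le
      by (intro integral_le integrable_continuous_real) auto
    then show ?thesis by (simp add: aperture_integral_def)
  qed
  then show ?thesis using \<beta> assms by (intro exI[of _ \<beta>]) auto
qed

text \<open>
  The integral of \<open>1 / (e + C * l X)\<close> is \<open>ln ((e + C) / e) / C\<close>, and \<open>e\<close> is chosen such that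
  \<open>ln (C / e) / C = M\<close>. The two choices of \<open>l\<close> place the near-singularity at either end of the
  interval.
\<close>
lemma log_divergence:
  fixes C e M :: real and f :: "real \<Rightarrow> real"
  assumes C: "0 < C" and e: "e = C * exp (- C * M)"
    and f: "continuous_on {0..1} f" and l: "l = (\<lambda>X. X) \<or> l = (\<lambda>X. 1 - X)"
    and ge: "\<And>X. X \<in> {0..1} \<Longrightarrow> 1 / (e + C * l X) \<le> f X"
  shows "M < integral {0..1} f"
proof -
  have e0: "e > 0" using C by (simp add: e)
  define s :: real where "s = (if l = (\<lambda>X. X) then 1 else - 1)"
  define F where "F X = s / C * ln (e + C * l X)" for X
  have pos: "e + C * l X > 0" if "X \<in> {0..1}" for X using l that e0 C by (auto intro!: add_pos_nonneg)
  have ne: "(\<lambda>X. 1 - X) \<noteq> (\<lambda>X::real. X)" by (metis diff_0_right zero_neq_one)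
  have l': "(l has_real_derivative s) (at X)" for X
    using l ne by (auto simp: s_def intro!: derivative_eq_intros)
  have "(F has_real_derivative 1 / (e + C * l X)) (at X)" if "X \<in> {0..1}" for X
  proof -
    have "(F has_real_derivative s / C * (C * s / (e + C * l X))) (at X)"
      unfolding F_def[abs_def] using pos[OF that]
      by (intro DERIV_cmult) (auto intro!: derivative_eq_intros l')
    moreover have "s * s = 1" by (simp add: s_def)
    ultimately show ?thesis using C by simp
  qed
  from has_real_derivative_imp_integral[OF this]
  have int: "((\<lambda>X. 1 / (e + C * l X)) has_integral (F 1 - F 0)) {0..1}" .
  have "F 1 - F 0 = (ln (e + C) - ln e) / C"
    using l ne by (auto simp: F_def s_def diff_divide_distrib)
  moreover have "ln e = ln C - C * M" using C by (simp add: e ln_mult)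
  moreover have "ln (e + C) > ln C" using C e0 by simp
  ultimately have "F 1 - F 0 = (ln (e + C) - ln C) / C + M" "0 < (ln (e + C) - ln C) / C"
    using C by (simp_all add: diff_divide_distrib divide_strict_right_mono)
  then have "M < F 1 - F 0" by simp
  also have "F 1 - F 0 \<le> integral {0..1} f"
    using has_integral_le[OF int integrable_integral[OF integrable_continuous_real[OF f]] ge] by simp
  finally show ?thesis .
qed

text \<open>
  As \<open>\<beta>\<close> decreases to \<open>max 0 d\<close>, the denominator tends to 0 at \<open>X = 0\<close> if \<open>d \<ge> 0\<close> and at \<open>X = 1\<close>
  if \<open>d \<le> 0\<close>, in both cases at least linearly, so the integral diverges at least logarithmically.
\<close>
lemma aperture_integral_large: "\<exists>\<beta>>max 0 d. M < aperture_integral k d \<beta>"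
proof -
  define C where "C = (2 * \<bar>d\<bar> + \<bar>d\<bar> * (k + 1) + 1) / sqrt k"
  define D where "D = 2 * \<bar>d\<bar> + \<bar>d\<bar> * (k + 1) + 1"
  have D: "D > 0" using k by (auto simp: D_def intro!: add_nonneg_pos)
  have sk: "sqrt k > 0" using k by simp
  have C: "C > 0" "sqrt k * C = D" using D sk by (auto simp: C_def D_def)
  \<comment> \<open>The degree exceeds its lower bound by \<open>\<epsilon>\<close>, which makes the denominator at most \<open>sqrt k * (e + C * l X)\<close>.\<close>
  define e where "e = C * exp (- C * M)"
  define \<epsilon> where "\<epsilon> = sqrt k * e / (1 + k)"
  have \<epsilon>: "\<epsilon> > 0" "\<epsilon> * (1 + k) = sqrt k * e" using C sk k by (auto simp: \<epsilon>_def e_def)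
  define \<beta> where "\<beta> = max 0 d + \<epsilon>"
  have \<beta>: "max 0 d < \<beta>" using \<epsilon> by (simp add: \<beta>_def)
  define l :: "real \<Rightarrow> real" where "l = (if 0 \<le> d then (\<lambda>X. X) else (\<lambda>X. 1 - X))"
  have "M < integral {0..1} (aperture_density k d \<beta>)"
  proof (rule log_divergence[OF C(1) e_def density_continuous_X[OF \<beta>], of l])
    show "l = (\<lambda>X. X) \<or> l = (\<lambda>X. 1 - X)" by (simp add: l_def)
    fix X :: real assume X: "X \<in> {0..1}"
    have X2: "0 \<le> X\<^sup>2" "X\<^sup>2 \<le> 1" "X\<^sup>2 \<le> X" using X square_le_1_interval[of X]
      by (auto simp: power2_eq_square mult_left_le)
    have l0: "0 \<le> l X" using X by (simp add: l_def)
    have k1: "1 + k * X\<^sup>2 \<le> 1 + k" using X2 k by (simp add: mult_left_le)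
    have den: "\<beta> * (1 + k * X\<^sup>2) - d * (1 - X\<^sup>2) \<le> sqrt k * e + D * l X"
    proof (cases "0 \<le> d")
      case True
      have "\<beta> * (1 + k * X\<^sup>2) - d * (1 - X\<^sup>2) = \<epsilon> * (1 + k * X\<^sup>2) + d * (k + 1) * X\<^sup>2"
        using True by (simp add: \<beta>_def algebra_simps)
      also have "\<dots> \<le> \<epsilon> * (1 + k) + D * X"
        using True \<epsilon> k1 X2 X k
        by (intro add_mono mult_left_mono[OF k1] mult_mono) (auto simp: D_def)
      finally show ?thesis using True \<epsilon>(2) by (simp add: l_def)
    next
      case False
      have "1 - X\<^sup>2 = (1 + X) * (1 - X)" by (simp add: power2_eq_square algebra_simps)
      also have "\<dots> \<le> 2 * (1 - X)" using X by (intro mult_right_mono) auto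
      finally have sq: "1 - X\<^sup>2 \<le> 2 * (1 - X)" .
      have "\<beta> * (1 + k * X\<^sup>2) - d * (1 - X\<^sup>2) = \<epsilon> * (1 + k * X\<^sup>2) + \<bar>d\<bar> * (1 - X\<^sup>2)"
        using False by (simp add: \<beta>_def)
      also have "\<dots> \<le> \<epsilon> * (1 + k) + \<bar>d\<bar> * (2 * (1 - X))"
        using \<epsilon> sq by (intro add_mono mult_left_mono[OF k1] mult_left_mono[OF sq]) auto
      also have "\<dots> \<le> \<epsilon> * (1 + k) + D * (1 - X)"
      proof -
        have "2 * \<bar>d\<bar> \<le> D" using k by (simp add: D_def)
        then have "2 * \<bar>d\<bar> * (1 - X) \<le> D * (1 - X)" using X by (intro mult_right_mono) auto
        moreover have "\<bar>d\<bar> * (2 * (1 - X)) = 2 * \<bar>d\<bar> * (1 - X)" by simp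
        ultimately show ?thesis by linarith
      qed
      finally show ?thesis using False \<epsilon>(2) by (simp add: l_def)
    qed
    have dp: "0 < \<beta> * (1 + k * X\<^sup>2) - d * (1 - X\<^sup>2)" by (rule density_denominator_pos[OF \<beta> X])
    have el: "0 < e + C * l X" using C l0 by (auto simp: e_def intro!: add_pos_nonneg)
    have "1 / (e + C * l X) = sqrt k * (k + 1) * 1 / (sqrt k * (e + C * l X) * (1 + k))"
      using sk k el by (simp add: add.commute[of k 1])
    also have "\<dots> \<le> aperture_density k d \<beta> X"
      unfolding aperture_density_def
    proof (rule frac_le)
      show "sqrt k * (k + 1) * 1 \<le> sqrt k * (k + 1) * (1 + X\<^sup>2)" using k by (intro mult_left_mono) auto
      show "0 < (\<beta> * (1 + k * X\<^sup>2) - d * (1 - X\<^sup>2)) * (1 + k * X\<^sup>2)" using dp one_plus_k_pos by (rule mult_pos_pos)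
      have "sqrt k * (e + C * l X) = sqrt k * e + D * l X" using C(2) by (simp add: algebra_simps)
      then show "(\<beta> * (1 + k * X\<^sup>2) - d * (1 - X\<^sup>2)) * (1 + k * X\<^sup>2) \<le> sqrt k * (e + C * l X) * (1 + k)"
        using den dp k1 one_plus_k_pos[of X] by (intro mult_mono) auto
    qed (use k in simp)
    finally show "1 / (e + C * l X) \<le> aperture_density k d \<beta> X" .
  qed
  then show ?thesis using \<beta> by (auto simp: aperture_integral_def)
qed

lemma aperture_integral_unique_exponent:
  assumes "0 < \<theta>"
  shows "\<exists>!\<beta>. max 0 d < \<beta> \<and> aperture_integral k d \<beta> = \<theta>"
proof -
  obtain a where a: "max 0 d < a" "\<theta> < aperture_integral k d a" using aperture_integral_large by blast
  obtain b where b: "max 0 d < b" "aperture_integral k d b < \<theta>" using aperture_integral_small[OF assms] by blast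
  have "a \<le> b" using aperture_integral_strict_anti[OF b(1), of a] a b by (cases "a \<le> b") auto
  have "continuous_on {a..b} (aperture_integral k d)"
    by (rule continuous_on_subset[OF aperture_integral_continuous]) (use a in auto)
  then obtain x where x: "a \<le> x" "x \<le> b" "aperture_integral k d x = \<theta>"
    using IVT2'[of "aperture_integral k d" b \<theta> a] a b \<open>a \<le> b\<close> by auto
  show ?thesis
  proof (rule ex1I[of _ x])
    show "max 0 d < x \<and> aperture_integral k d x = \<theta>" using x a by simp
    fix y assume y: "max 0 d < y \<and> aperture_integral k d y = \<theta>"
    have xd: "max 0 d < x" using x a by simp
    show "y = x"
      using aperture_integral_strict_anti[of x y, OF xd] aperture_integral_strict_anti[of y x] y x(3)
      by (cases x y rule: linorder_cases) auto
  qed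
qed

end

section \<open>The explicit angle maps\<close>

text \<open>The value of \<open>k\<close> that belongs to the degree \<alpha>.\<close>
definition branch :: "real \<Rightarrow> real \<Rightarrow> real" where
  "branch \<omega> \<alpha> = (if 0 < \<alpha> \<and> \<alpha> < 1 then 1 / \<omega> else \<omega>)"

text \<open>The degrees for which \<open>quad\<close> has constant sign, so that an exact solution exists.\<close>
definition admissible :: "real \<Rightarrow> real \<Rightarrow> bool" where
  "admissible \<omega> \<alpha> \<longleftrightarrow> 0 < \<alpha> * (\<alpha> - 1 + branch \<omega> \<alpha>)"

definition angular_map :: "real \<Rightarrow> real \<Rightarrow> (real \<Rightarrow> real) \<Rightarrow> bool" where
  "angular_map k \<alpha> G \<longleftrightarrow>
     (\<forall>X\<in>{-1..1}. G (- X) = - G X \<and> (G has_real_derivative angle_speed k \<alpha> X) (at X))"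

text \<open>
  All formulas of the theorem for the angle are instances, with \<open>k = \<omega>\<close> or \<open>k = 1 / \<omega>\<close>. The linear
  case \<open>Q = 0\<close> is the common limit of the other two.
\<close>
definition angle_map :: "real \<Rightarrow> real \<Rightarrow> real \<Rightarrow> real" where
  "angle_map k \<alpha> X = (let P = \<alpha> - 1 + k; Q = \<alpha> - 1 + 1 / k in sgn \<alpha> * arctan (sqrt k * X) +
     (if 0 < P * Q then (2 - \<alpha>) / sqrt (P * Q) * arctan (sqrt (k * Q / P) * X)
      else if P * Q < 0 then (2 - \<alpha>) / sqrt (- (P * Q)) * artanh (sqrt (- (k * Q / P)) * X)
      else (2 - \<alpha>) * sqrt k * X / \<bar>P\<bar>))"

context
  fixes k \<alpha> :: real
  assumes k: "0 < k" and adm: "0 < \<alpha> * (\<alpha> - 1 + k)"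
begin

lemma sgn_eq: "sgn (\<alpha> - 1 + k) = sgn \<alpha>"
  using adm by (auto simp: sgn_if zero_less_mult_iff)

lemma quad_eq: "quad k \<alpha> X = (\<alpha> - 1 + k) + k * (\<alpha> - 1 + 1 / k) * X\<^sup>2"
  using k by (simp add: quad_def algebra_simps)

text \<open>
  A partial fraction decomposition; its two terms are the derivatives of the two summands in the
  formulas for the angle maps.
\<close>
lemma angle_speed_split:
  assumes X: "X \<in> {-1..1}"
  shows "sgn \<alpha> * (sqrt k / (1 + k * X\<^sup>2)) + (2 - \<alpha>) * sqrt k * sgn \<alpha> / quad k \<alpha> X = angle_speed k \<alpha> X"
proof -
  define q p where "q = quad k \<alpha> X" and "p = 1 + k * X\<^sup>2"
  have q: "q \<noteq> 0" using quad_sign[OF k adm X] by (auto simp: q_def)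
  have p: "p \<noteq> 0" using one_plus_k_pos[OF k, of X] by (simp add: p_def)
  have "sgn \<alpha> * (sqrt k / p) + (2 - \<alpha>) * sqrt k * sgn \<alpha> / q = sgn \<alpha> * sqrt k * (q + (2 - \<alpha>) * p) / (q * p)"
    using q p by (simp add: field_simps)
  also have "q + (2 - \<alpha>) * p = (k + 1) * (1 + X\<^sup>2)"
    by (simp add: q_def p_def quad_def algebra_simps)
  finally show ?thesis by (simp add: angle_speed_def q_def p_def mult.assoc)
qed

lemma first_summand_deriv:
  "((\<lambda>X. sgn \<alpha> * arctan (sqrt k * X)) has_real_derivative sgn \<alpha> * (sqrt k / (1 + k * X\<^sup>2))) (at X)"
proof -
  have "((\<lambda>X. arctan (sqrt k * X)) has_real_derivative inverse (1 + (sqrt k * X)\<^sup>2) * sqrt k) (at X)"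
    by (rule DERIV_chain2[OF DERIV_arctan]) (auto intro!: derivative_eq_intros)
  moreover have "inverse (1 + (sqrt k * X)\<^sup>2) * sqrt k = sqrt k / (1 + k * X\<^sup>2)"
    using k by (simp add: power_mult_distrib divide_inverse)
  ultimately show ?thesis using DERIV_cmult by force
qed

lemma angular_mapI:
  assumes "\<And>X. X \<in> {-1..1} \<Longrightarrow> S (- X) = - S X"
    and "\<And>X. X \<in> {-1..1} \<Longrightarrow> (S has_real_derivative (2 - \<alpha>) * sqrt k * sgn \<alpha> / quad k \<alpha> X) (at X)"
  shows "angular_map k \<alpha> (\<lambda>X. sgn \<alpha> * arctan (sqrt k * X) + S X)"
  unfolding angular_map_def
proof (intro ballI conjI)
  fix X :: real assume X: "X \<in> {-1..1}"
  show "sgn \<alpha> * arctan (sqrt k * - X) + S (- X) = - (sgn \<alpha> * arctan (sqrt k * X) + S X)"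
    using assms(1)[OF X] by (simp add: arctan_minus)
  show "((\<lambda>X. sgn \<alpha> * arctan (sqrt k * X) + S X) has_real_derivative angle_speed k \<alpha> X) (at X)"
    unfolding angle_speed_split[OF X, symmetric]
    by (intro DERIV_add first_summand_deriv assms(2)[OF X])
qed

text \<open>
  The coefficient inside \<open>arctan\<close> (for \<open>\<sigma> = 1\<close>) or \<open>artanh\<close> (for \<open>\<sigma> = - 1\<close>) is chosen such that
  its square times \<open>X\<^sup>2\<close> completes 1 to a multiple of \<open>quad\<close>.
\<close>
lemma radius_identities:
  assumes "Q = \<alpha> - 1 + 1 / k" "P = \<alpha> - 1 + k" "\<sigma> = 1 \<or> \<sigma> = - 1" "0 < \<sigma> * (P * Q)"
  shows "sqrt (\<sigma> * (k * Q / P)) / sqrt (\<sigma> * (P * Q)) = sqrt k / \<bar>P\<bar>"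
    and "(sqrt (\<sigma> * (k * Q / P)) * X)\<^sup>2 = \<sigma> * (quad k \<alpha> X / P - 1)"
    and "P \<noteq> 0"
proof -
  show P: "P \<noteq> 0" using assms(4) by auto
  have eq: "\<sigma> * (k * Q / P) = k * (\<sigma> * (P * Q)) / P\<^sup>2" using P by (simp add: power2_eq_square)
  have s: "sqrt (\<sigma> * (k * Q / P)) = sqrt k * sqrt (\<sigma> * (P * Q)) / \<bar>P\<bar>"
    unfolding eq by (simp add: real_sqrt_divide real_sqrt_mult)
  show "sqrt (\<sigma> * (k * Q / P)) / sqrt (\<sigma> * (P * Q)) = sqrt k / \<bar>P\<bar>"
  proof -
    have "sqrt (\<sigma> * (P * Q)) \<noteq> 0" using assms(4) by (simp only: real_sqrt_eq_0_iff)
    moreover have "a * z / b / z = a / b" if "z \<noteq> 0" for a b z :: real using that by simp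
    ultimately show ?thesis unfolding s by blast
  qed
  have nn: "0 \<le> \<sigma> * (k * Q / P)" unfolding eq using k assms(4) by simp
  have "(sqrt (\<sigma> * (k * Q / P)) * X)\<^sup>2 = \<sigma> * (k * Q / P) * X\<^sup>2"
    unfolding power_mult_distrib real_sqrt_pow2[OF nn] ..
  also have "\<dots> = \<sigma> * (k * Q / P * X\<^sup>2)" by (rule mult.assoc)
  also have "k * Q / P * X\<^sup>2 = quad k \<alpha> X / P - 1"
    using P unfolding quad_eq assms(1,2)[symmetric] by (simp add: field_simps)
  finally show "(sqrt (\<sigma> * (k * Q / P)) * X)\<^sup>2 = \<sigma> * (quad k \<alpha> X / P - 1)" .
qed

lemma second_summand_factor:
  assumes "P = \<alpha> - 1 + k" "P \<noteq> 0"
  shows "(2 - \<alpha>) * (sqrt k / \<bar>P\<bar>) * inverse (quad k \<alpha> X / P) = (2 - \<alpha>) * sqrt k * sgn \<alpha> / quad k \<alpha> X"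
proof -
  have "P / \<bar>P\<bar> = sgn P" by (simp add: sgn_div_norm divide_inverse)
  then have "P / \<bar>P\<bar> = sgn \<alpha>" unfolding assms(1) sgn_eq .
  then have "sqrt k / \<bar>P\<bar> * inverse (quad k \<alpha> X / P) = sqrt k * sgn \<alpha> / quad k \<alpha> X"
    by (metis (no_types, opaque_lifting) inverse_divide mult.commute times_divide_eq_left times_divide_eq_right)
  note factor = this
  have "(2 - \<alpha>) * (sqrt k / \<bar>P\<bar>) * inverse (quad k \<alpha> X / P)
      = (2 - \<alpha>) * (sqrt k / \<bar>P\<bar> * inverse (quad k \<alpha> X / P))" by (rule mult.assoc)
  also have "\<dots> = (2 - \<alpha>) * (sqrt k * sgn \<alpha> / quad k \<alpha> X)" by (simp only: factor)
  also have "\<dots> = (2 - \<alpha>) * sqrt k * sgn \<alpha> / quad k \<alpha> X" by simp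
  finally show ?thesis .
qed

lemma quad_over_pos:
  assumes "X \<in> {-1..1}"
  shows "0 < quad k \<alpha> X / (\<alpha> - 1 + k)"
  using quad_sign[OF k adm assms] adm by (auto simp: zero_less_mult_iff zero_less_divide_iff)

lemma angular_map_arctan:
  assumes PQ: "0 < (\<alpha> - 1 + k) * (\<alpha> - 1 + 1 / k)"
  shows "angular_map k \<alpha> (\<lambda>X. sgn \<alpha> * arctan (sqrt k * X) + (2 - \<alpha>) / sqrt ((\<alpha> - 1 + k) * (\<alpha> - 1 + 1 / k))
     * arctan (sqrt (k * (\<alpha> - 1 + 1 / k) / (\<alpha> - 1 + k)) * X))"
proof (rule angular_mapI)
  define P Q where "P = \<alpha> - 1 + k" and "Q = \<alpha> - 1 + 1 / k"
  note R = radius_identities[OF Q_def P_def, of 1, simplified, OF PQ[folded P_def Q_def]]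
  fix X :: real assume X: "X \<in> {-1..1}"
  let ?r = "sqrt (k * Q / P)"
  have "((\<lambda>X. arctan (?r * X)) has_real_derivative inverse (1 + (?r * X)\<^sup>2) * ?r) (at X)"
    by (rule DERIV_chain2[OF DERIV_arctan]) (auto intro!: derivative_eq_intros)
  from DERIV_cmult[OF this, of "(2 - \<alpha>) / sqrt (P * Q)"]
  have D: "((\<lambda>X. (2 - \<alpha>) / sqrt (P * Q) * arctan (?r * X)) has_real_derivative
      (2 - \<alpha>) / sqrt (P * Q) * (inverse (1 + (?r * X)\<^sup>2) * ?r)) (at X)" .
  have "(2 - \<alpha>) / sqrt (P * Q) * (inverse (1 + (?r * X)\<^sup>2) * ?r)
      = (2 - \<alpha>) * (?r / sqrt (P * Q)) * inverse (quad k \<alpha> X / P)"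
    unfolding R(2) by simp
  also have "\<dots> = (2 - \<alpha>) * sqrt k * sgn \<alpha> / quad k \<alpha> X"
    unfolding R(1) by (rule second_summand_factor[OF P_def R(3)])
  finally show "((\<lambda>X. (2 - \<alpha>) / sqrt (P * Q) * arctan (?r * X)) has_real_derivative
      (2 - \<alpha>) * sqrt k * sgn \<alpha> / quad k \<alpha> X) (at X)" using D by simp
qed (simp add: arctan_minus)

lemma angular_map_artanh:
  assumes PQ: "(\<alpha> - 1 + k) * (\<alpha> - 1 + 1 / k) < 0"
  shows "angular_map k \<alpha> (\<lambda>X. sgn \<alpha> * arctan (sqrt k * X) + (2 - \<alpha>) / sqrt (- ((\<alpha> - 1 + k) * (\<alpha> - 1 + 1 / k)))
     * artanh (sqrt (- (k * (\<alpha> - 1 + 1 / k) / (\<alpha> - 1 + k))) * X))"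
proof (rule angular_mapI)
  define P Q where "P = \<alpha> - 1 + k" and "Q = \<alpha> - 1 + 1 / k"
  have PQ': "0 < - 1 * (P * Q)" using PQ by (simp add: P_def Q_def)
  note R = radius_identities[OF Q_def P_def disjI2[OF refl] PQ', unfolded mult_minus1]
  fix X :: real assume X: "X \<in> {-1..1}"
  let ?r = "sqrt (- (k * Q / P))"
  have "(?r * X)\<^sup>2 < 1\<^sup>2" unfolding R(2) using quad_over_pos[OF X] by (simp add: P_def)
  then have less: "\<bar>?r * X\<bar> < 1" using power2_less_imp_less[of "\<bar>?r * X\<bar>" 1] by simp
  have "((\<lambda>X. artanh (?r * X)) has_real_derivative 1 / (1 - (?r * X)\<^sup>2) * ?r) (at X)"
    by (rule DERIV_chain2[where g = "\<lambda>X. ?r * X", OF artanh_real_has_field_derivative[OF less]])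
       (auto intro!: derivative_eq_intros)
  from DERIV_cmult[OF this, of "(2 - \<alpha>) / sqrt (- (P * Q))"]
  have D: "((\<lambda>X. (2 - \<alpha>) / sqrt (- (P * Q)) * artanh (?r * X)) has_real_derivative
      (2 - \<alpha>) / sqrt (- (P * Q)) * (1 / (1 - (?r * X)\<^sup>2) * ?r)) (at X)" .
  have "(2 - \<alpha>) / sqrt (- (P * Q)) * (1 / (1 - (?r * X)\<^sup>2) * ?r)
      = (2 - \<alpha>) * (?r / sqrt (- (P * Q))) * inverse (quad k \<alpha> X / P)"
    unfolding R(2) by (simp add: divide_inverse mult_ac)
  also have "\<dots> = (2 - \<alpha>) * sqrt k * sgn \<alpha> / quad k \<alpha> X"
    unfolding R(1) by (rule second_summand_factor[OF P_def R(3)])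
  finally show "((\<lambda>X. (2 - \<alpha>) / sqrt (- (P * Q)) * artanh (?r * X)) has_real_derivative
      (2 - \<alpha>) * sqrt k * sgn \<alpha> / quad k \<alpha> X) (at X)" using D by simp
  show "(2 - \<alpha>) / sqrt (- (P * Q)) * artanh (?r * - X) = - ((2 - \<alpha>) / sqrt (- (P * Q)) * artanh (?r * X))"
    using artanh_minus_real[OF less] by simp
qed

lemma angular_map_linear:
  assumes Q: "\<alpha> - 1 + 1 / k = 0"
  shows "angular_map k \<alpha> (\<lambda>X. sgn \<alpha> * arctan (sqrt k * X) + (2 - \<alpha>) * sqrt k * X / \<bar>\<alpha> - 1 + k\<bar>)"
proof (rule angular_mapI)
  fix X :: real assume X: "X \<in> {-1..1}"
  define P where "P = \<alpha> - 1 + k"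
  have P: "P \<noteq> 0" using adm by (auto simp: P_def)
  have qP: "quad k \<alpha> X = P" unfolding quad_eq Q P_def by simp
  have "((\<lambda>X. (2 - \<alpha>) * (sqrt k / \<bar>P\<bar>) * X) has_real_derivative (2 - \<alpha>) * (sqrt k / \<bar>P\<bar>) * 1) (at X)"
    by (intro DERIV_cmult DERIV_ident)
  moreover have "(2 - \<alpha>) * (sqrt k / \<bar>P\<bar>) * 1 = (2 - \<alpha>) * sqrt k * sgn \<alpha> / quad k \<alpha> X"
    using second_summand_factor[OF P_def P, of X] P by (simp add: qP)
  ultimately show "((\<lambda>X. (2 - \<alpha>) * sqrt k * X / \<bar>\<alpha> - 1 + k\<bar>) has_real_derivative
      (2 - \<alpha>) * sqrt k * sgn \<alpha> / quad k \<alpha> X) (at X)"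
    by (simp add: P_def[symmetric])
qed simp

lemma angular_map_angle_map: "angular_map k \<alpha> (angle_map k \<alpha>)"
proof -
  define P Q where "P = \<alpha> - 1 + k" and "Q = \<alpha> - 1 + 1 / k"
  have P: "P \<noteq> 0" using adm by (auto simp: P_def)
  note maps = angular_map_arctan[folded P_def Q_def] angular_map_artanh[folded P_def Q_def]
    angular_map_linear[folded P_def Q_def]
  consider "0 < P * Q" | "P * Q < 0" | "Q = 0" using P by (metis linorder_neqE_linordered_idom mult_eq_0_iff)
  then show ?thesis
    unfolding angle_map_def[abs_def] P_def[symmetric] Q_def[symmetric] Let_def using maps by cases simp_all
qed

lemma angular_map_aperture:
  assumes "angular_map k \<alpha> G"
  shows "G 1 = aperture_integral k (sgn \<alpha> * (1 - k)) \<bar>\<alpha>\<bar>"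
proof -
  have "(0::real) \<in> {-1..1}" by simp
  from bspec[OF assms[unfolded angular_map_def] this] have G0: "G 0 = 0" unfolding minus_zero by linarith
  have nz: "\<alpha> \<noteq> 0" using adm by auto
  have "(angle_speed k \<alpha> has_integral (G 1 - G 0)) {0..1}"
    by (rule has_real_derivative_imp_integral) (use assms in \<open>auto simp: angular_map_def\<close>)
  then have "(aperture_density k (sgn \<alpha> * (1 - k)) \<bar>\<alpha>\<bar> has_integral (G 1 - G 0)) {0..1}"
    using angle_speed_eq_density[OF nz, of k] by (simp add: fun_eq_iff cong: has_integral_cong)
  then show ?thesis by (simp add: aperture_integral_def G0 integral_unique)
qed

end

text \<open>At degree 1 the two summands are the arc tangents of inverse numbers.\<close>
lemma aperture_integral_one:
  assumes \<omega>: "0 < \<omega>"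
  shows "aperture_integral \<omega> (1 - \<omega>) 1 = pi / 2"
proof -
  have adm: "0 < (1::real) * (1 - 1 + \<omega>)" using \<omega> by simp
  have "0 < (1 - 1 + \<omega>) * (1 - 1 + 1 / \<omega>)" using \<omega> by simp
  from angular_map_aperture[OF \<omega> adm angular_map_arctan[OF \<omega> adm this]]
  have "aperture_integral \<omega> (1 - \<omega>) 1 = arctan (sqrt \<omega>) + arctan (1 / sqrt \<omega>)"
    using \<omega> by (simp add: real_sqrt_divide)
  also have "\<dots> = pi / 2" using \<omega> Transcendental.arctan_inverse[of "sqrt \<omega>"] by simp
  finally show ?thesis .
qed

section \<open>Classification of the positive solutions\<close>

definition aperture_of :: "real \<Rightarrow> real \<Rightarrow> real" where
  "aperture_of \<omega> \<alpha> = aperture_integral (branch \<omega> \<alpha>) (sgn \<alpha> * (1 - branch \<omega> \<alpha>)) \<bar>\<alpha>\<bar>"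

text \<open>
  Each of the three branches (negative degrees, degrees in \<open>(0, 1)\<close>, degrees at least 1) comes
  from a full family with exactly one solution \<open>b\<close>, \<open>b2\<close>, \<open>b1\<close> of aperture \<open>\<theta>\<close>. Both positive
  families have aperture \<open>pi / 2\<close> at degree 1, so \<open>b1\<close> and \<open>b2\<close> lie on the same side of 1 and
  exactly one of them belongs to its branch.
\<close>
lemma exponents:
  assumes \<omega>: "0 < \<omega>" and \<theta>: "0 < \<theta>"
  shows "\<exists>\<alpha>m \<alpha>p. \<alpha>m < 0 \<and> 0 < \<alpha>p \<and> {\<alpha>. admissible \<omega> \<alpha> \<and> aperture_of \<omega> \<alpha> = \<theta>} = {\<alpha>m, \<alpha>p}
     \<and> (1 \<le> \<alpha>p \<longleftrightarrow> \<theta> \<le> pi / 2)"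
proof -
  have \<omega>': "0 < 1 / \<omega>" using \<omega> by simp
  obtain b where b: "max 0 (\<omega> - 1) < b" "aperture_integral \<omega> (\<omega> - 1) b = \<theta>"
    and b_unique: "\<And>\<beta>. max 0 (\<omega> - 1) < \<beta> \<Longrightarrow> aperture_integral \<omega> (\<omega> - 1) \<beta> = \<theta> \<Longrightarrow> \<beta> = b"
    using aperture_integral_unique_exponent[OF \<omega> \<theta>, of "\<omega> - 1"] by metis
  obtain b1 where b1: "max 0 (1 - \<omega>) < b1" "aperture_integral \<omega> (1 - \<omega>) b1 = \<theta>"
    and b1_unique: "\<And>\<beta>. max 0 (1 - \<omega>) < \<beta> \<Longrightarrow> aperture_integral \<omega> (1 - \<omega>) \<beta> = \<theta> \<Longrightarrow> \<beta> = b1"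
    using aperture_integral_unique_exponent[OF \<omega> \<theta>, of "1 - \<omega>"] by metis
  obtain b2 where b2: "max 0 (1 - 1 / \<omega>) < b2" "aperture_integral (1 / \<omega>) (1 - 1 / \<omega>) b2 = \<theta>"
    and b2_unique: "\<And>\<beta>. max 0 (1 - 1 / \<omega>) < \<beta> \<Longrightarrow> aperture_integral (1 / \<omega>) (1 - 1 / \<omega>) \<beta> = \<theta> \<Longrightarrow> \<beta> = b2"
    using aperture_integral_unique_exponent[OF \<omega>' \<theta>, of "1 - 1 / \<omega>"] by metis
  have one: "max 0 (1 - \<omega>) < 1" "max 0 (1 - 1 / \<omega>) < 1" using \<omega> by auto
  have b1_ge: "1 \<le> b1 \<longleftrightarrow> \<theta> \<le> pi / 2"
    using aperture_integral_strict_anti[OF \<omega> one(1), of b1] aperture_integral_strict_anti[OF \<omega> b1(1), of 1]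
      aperture_integral_one[OF \<omega>] b1(2) by (cases b1 "1::real" rule: linorder_cases) auto
  have b2_ge: "1 \<le> b2 \<longleftrightarrow> \<theta> \<le> pi / 2"
    using aperture_integral_strict_anti[OF \<omega>' one(2), of b2] aperture_integral_strict_anti[OF \<omega>' b2(1), of 1]
      aperture_integral_one[OF \<omega>'] b2(2) by (cases b2 "1::real" rule: linorder_cases) auto
  define \<alpha>p where "\<alpha>p = (if \<theta> \<le> pi / 2 then b1 else b2)"
  have neg: "admissible \<omega> \<alpha> \<and> aperture_of \<omega> \<alpha> = \<theta> \<longleftrightarrow> \<alpha> = - b" if "\<alpha> < 0" for \<alpha>
  proof -
    have "admissible \<omega> \<alpha> \<longleftrightarrow> max 0 (\<omega> - 1) < - \<alpha>"
      using that by (auto simp: admissible_def branch_def zero_less_mult_iff)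
    moreover have "aperture_of \<omega> \<alpha> = aperture_integral \<omega> (\<omega> - 1) (- \<alpha>)"
      using that by (simp add: aperture_of_def branch_def)
    ultimately show ?thesis using b b_unique[of "- \<alpha>"] by (metis minus_minus)
  qed
  have ge1: "admissible \<omega> \<alpha> \<and> aperture_of \<omega> \<alpha> = \<theta> \<longleftrightarrow> \<alpha> = b1" if "1 \<le> \<alpha>" for \<alpha>
  proof -
    have "admissible \<omega> \<alpha>" "max 0 (1 - \<omega>) < \<alpha>"
      using that \<omega> by (auto simp: admissible_def branch_def zero_less_mult_iff)
    moreover have "aperture_of \<omega> \<alpha> = aperture_integral \<omega> (1 - \<omega>) \<alpha>"
      using that by (simp add: aperture_of_def branch_def)
    ultimately show ?thesis using b1 b1_unique[of "\<alpha>"] by metis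
  qed
  have lt1: "admissible \<omega> \<alpha> \<and> aperture_of \<omega> \<alpha> = \<theta> \<longleftrightarrow> \<alpha> = b2" if "0 < \<alpha>" "\<alpha> < 1" for \<alpha>
  proof -
    have "admissible \<omega> \<alpha> \<longleftrightarrow> max 0 (1 - 1 / \<omega>) < \<alpha>"
      using that \<omega> by (auto simp: admissible_def branch_def zero_less_mult_iff)
    moreover have "aperture_of \<omega> \<alpha> = aperture_integral (1 / \<omega>) (1 - 1 / \<omega>) \<alpha>"
      using that by (simp add: aperture_of_def branch_def)
    ultimately show ?thesis using b2 b2_unique[of "\<alpha>"] by metis
  qed
  have zero: "\<not> admissible \<omega> 0" by (simp add: admissible_def)
  have bpos: "0 < b" "0 < b1" "0 < b2" using b(1) b1(1) b2(1) by auto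
  have "admissible \<omega> \<alpha> \<and> aperture_of \<omega> \<alpha> = \<theta> \<longleftrightarrow> \<alpha> = - b \<or> \<alpha> = \<alpha>p" for \<alpha>
  proof -
    consider "\<alpha> < 0" | "\<alpha> = 0" | "0 < \<alpha>" "\<alpha> < 1" | "1 \<le> \<alpha>" by linarith
    then show ?thesis
    proof cases
      case 1 then show ?thesis using neg[OF 1] bpos by (auto simp: \<alpha>p_def)
    next
      case 2 then show ?thesis using zero bpos by (auto simp: \<alpha>p_def)
    next
      case 3 then show ?thesis using lt1[OF 3] bpos b1_ge b2_ge by (auto simp: \<alpha>p_def)
    next
      case 4 then show ?thesis using ge1[OF 4] bpos b1_ge b2_ge by (auto simp: \<alpha>p_def)
    qed
  qed
  then have "{\<alpha>. admissible \<omega> \<alpha> \<and> aperture_of \<omega> \<alpha> = \<theta>} = {- b, \<alpha>p}" by auto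
  moreover have "1 \<le> \<alpha>p \<longleftrightarrow> \<theta> \<le> pi / 2" using b1_ge b2_ge by (auto simp: \<alpha>p_def)
  moreover have "0 < \<alpha>p" using bpos by (simp add: \<alpha>p_def)
  ultimately show ?thesis using bpos(1) by (intro exI[of _ "- b"] exI[of _ \<alpha>p]) auto
qed

lemma branch_pos: "0 < \<omega> \<Longrightarrow> 0 < branch \<omega> \<alpha>"
  by (simp add: branch_def)

text \<open>
  For \<open>\<alpha> < 1\<close> the sum of the weights is a positive constant times the product that defines
  admissibility; degrees at least 1 are always admissible.
\<close>
lemma admissible_if_weights_pos:
  assumes pos: "0 < lam" "0 < Lam"
    and w: "0 < pucci_weight lam Lam (\<alpha> * (\<alpha> - 1)) + pucci_weight lam Lam \<alpha>"
  shows "admissible (Lam / lam) \<alpha>"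
proof -
  consider "\<alpha> < 0" | "\<alpha> = 0" | "0 < \<alpha>" "\<alpha> < 1" | "1 \<le> \<alpha>" by linarith
  then show ?thesis
  proof cases
    case 1
    then have "0 \<le> \<alpha> * (\<alpha> - 1)" by (simp add: zero_le_mult_iff)
    then have "pucci_weight lam Lam (\<alpha> * (\<alpha> - 1)) = lam * (\<alpha> * (\<alpha> - 1))" "pucci_weight lam Lam \<alpha> = Lam * \<alpha>"
      using 1 by (simp_all add: pucci_weight_def)
    moreover have "lam * (\<alpha> * (\<alpha> - 1)) + Lam * \<alpha> = lam * (\<alpha> * (\<alpha> - 1 + Lam / lam))"
      using pos by (simp add: algebra_simps)
    ultimately have "0 < lam * (\<alpha> * (\<alpha> - 1 + Lam / lam))" using w by simp
    then show ?thesis using pos 1 by (simp add: admissible_def branch_def zero_less_mult_iff)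
  next
    case 2 then show ?thesis using w by (simp add: pucci_weight_def)
  next
    case 3
    then have "\<alpha> * (\<alpha> - 1) \<le> 0" by (simp add: mult_le_0_iff)
    then have "pucci_weight lam Lam (\<alpha> * (\<alpha> - 1)) = Lam * (\<alpha> * (\<alpha> - 1))" "pucci_weight lam Lam \<alpha> = lam * \<alpha>"
      using 3 by (simp_all add: pucci_weight_def)
    moreover have "Lam * (\<alpha> * (\<alpha> - 1)) + lam * \<alpha> = Lam * (\<alpha> * (\<alpha> - 1 + lam / Lam))"
      using pos by (simp add: algebra_simps)
    ultimately have "0 < Lam * (\<alpha> * (\<alpha> - 1 + lam / Lam))" using w by simp
    then show ?thesis using pos 3 by (simp add: admissible_def branch_def zero_less_mult_iff)
  next
    case 4
    then show ?thesis using pos by (simp add: admissible_def branch_def add_nonneg_pos)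
  qed
qed

definition separated_solution :: "real \<Rightarrow> real \<Rightarrow> (real \<Rightarrow> real) \<Rightarrow> real^2 \<Rightarrow> real" where
  "separated_solution k \<alpha> G p = norm p powr \<alpha> * profile k \<alpha> (inv_into {0..1} G (polar_angle p))"

lemma positive_solutions_characterization:
  assumes pos: "0 < lam" "0 < Lam" and \<theta>0: "0 < \<theta>0" "\<theta>0 < pi"
    and \<omega>: "\<omega> = Lam / lam"
    and G: "\<And>\<alpha>. admissible \<omega> \<alpha> \<Longrightarrow> angular_map (branch \<omega> \<alpha>) \<alpha> (G \<alpha>)"
  shows "positive_homogeneous_solution lam Lam \<theta>0 u \<longleftrightarrow>
    (\<exists>\<alpha>. admissible \<omega> \<alpha> \<and> aperture_of \<omega> \<alpha> = \<theta>0 \<and>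
       positive_multiple_on (closure (sector \<theta>0) - {0}) u
         (separated_solution (branch \<omega> \<alpha>) \<alpha> (G \<alpha>)))"
proof -
  have \<omega>_pos: "0 < \<omega>" using pos \<omega> by simp
  have loc: "angular_profile lam Lam \<alpha> (branch \<omega> \<alpha>) (G \<alpha>)" if "admissible \<omega> \<alpha>" for \<alpha>
  proof
    show "branch \<omega> \<alpha> = (if 0 < \<alpha> \<and> \<alpha> < 1 then lam / Lam else Lam / lam)"
      using \<omega> by (simp add: branch_def)
    show "0 < \<alpha> * (\<alpha> - 1 + branch \<omega> \<alpha>)" using that by (simp add: admissible_def)
  qed (use pos G[OF that] in \<open>simp_all add: angular_map_def\<close>)
  have ap: "angular_profile.aperture (G \<alpha>) = aperture_of \<omega> \<alpha>" if "admissible \<omega> \<alpha>" for \<alpha>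
    unfolding angular_profile.aperture_def[OF loc[OF that]] aperture_of_def
    by (rule angular_map_aperture[OF branch_pos[OF \<omega>_pos] _ G[OF that]]) (use that in \<open>simp add: admissible_def\<close>)
  have E: "profile (branch \<omega> \<alpha>) \<alpha> (inv_into {0..1} (G \<alpha>) (polar_angle p))
      = profile (branch \<omega> \<alpha>) \<alpha> (angular_profile.Xi (G \<alpha>) (signed_angle p))"
    if adm: "admissible \<omega> \<alpha>" and T: "aperture_of \<omega> \<alpha> = \<theta>0" and p: "p \<in> closure (sector \<theta>0) - {0}" for \<alpha> p
  proof -
    have ps: "p \<in> slit_plane" "\<bar>signed_angle p\<bar> \<le> \<theta>0"
      using p in_punctured_closed_sector_iff[OF \<theta>0] by auto
    then have t: "signed_angle p \<in> {- \<theta>0..\<theta>0}" unfolding atLeastAtMost_iff by linarith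
    show ?thesis
      unfolding polar_angle_eq_abs[OF ps(1)]
      by (rule angular_profile.profile_inv_into[OF loc[OF adm]]) (use t in \<open>simp add: ap[OF adm] T\<close>)
  qed
  have ang: "signed_angle p \<in> {- \<theta>0..\<theta>0}" if "p \<in> closure (sector \<theta>0) - {0}" for p
    using that unfolding in_punctured_closed_sector_iff[OF \<theta>0] atLeastAtMost_iff by linarith
  show ?thesis
  proof
    assume u: "positive_homogeneous_solution lam Lam \<theta>0 u"
    obtain \<alpha> \<phi> where \<phi>: "continuous_on {- \<theta>0..\<theta>0} \<phi>" "\<And>t. \<bar>t\<bar> < \<theta>0 \<Longrightarrow> \<phi> t > 0" "\<phi> \<theta>0 = 0" "\<phi> (- \<theta>0) = 0"
      and u_eq: "\<And>p. p \<in> closure (sector \<theta>0) - {0} \<Longrightarrow> u p = norm p powr \<alpha> * \<phi> (signed_angle p)"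
      and visc: "angular_viscosity_solution lam Lam \<theta>0 \<alpha> (\<lambda>t. ln (\<phi> t))"
      using positive_homogeneous_solutionE[OF \<theta>0 u] by metis
    have adm: "admissible \<omega> \<alpha>"
      unfolding \<omega> by (rule admissible_if_weights_pos[OF pos weights_pos_of_angular_solution[OF pos \<theta>0(1) \<phi> visc]])
    interpret angular_profile lam Lam \<alpha> "branch \<omega> \<alpha>" "G \<alpha>" by (rule loc[OF adm])
    interpret angular_comparison lam Lam \<alpha> aperture "\<lambda>t. log_profile (Xi t)" "\<lambda>t. log_slope (Xi t)"
      "\<lambda>t. log_curvature (Xi t)" "\<lambda>t. profile (branch \<omega> \<alpha>) \<alpha> (Xi t)" \<theta>0 \<phi>
      by unfold_locales (use \<theta>0 \<phi> visc in auto)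
    have T: "aperture_of \<omega> \<alpha> = \<theta>0" using T_eq ap[OF adm] by simp
    obtain c where c: "c > 0" "\<And>t. t \<in> {- \<theta>0..\<theta>0} \<Longrightarrow> \<phi> t = c * profile (branch \<omega> \<alpha>) \<alpha> (Xi t)"
      using multiple_of_exact_solution by blast
    have "u p = c * separated_solution (branch \<omega> \<alpha>) \<alpha> (G \<alpha>) p"
      if p: "p \<in> closure (sector \<theta>0) - {0}" for p
      unfolding separated_solution_def u_eq[OF p] E[OF adm T p] c(2)[OF ang[OF p]] by simp
    then show "\<exists>\<alpha>. admissible \<omega> \<alpha> \<and> aperture_of \<omega> \<alpha> = \<theta>0 \<and>
       positive_multiple_on (closure (sector \<theta>0) - {0}) u
         (separated_solution (branch \<omega> \<alpha>) \<alpha> (G \<alpha>))"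
      using adm T c(1) unfolding positive_multiple_on_def by blast
  next
    assume "\<exists>\<alpha>. admissible \<omega> \<alpha> \<and> aperture_of \<omega> \<alpha> = \<theta>0 \<and>
       positive_multiple_on (closure (sector \<theta>0) - {0}) u
         (separated_solution (branch \<omega> \<alpha>) \<alpha> (G \<alpha>))"
    then obtain \<alpha> c where adm: "admissible \<omega> \<alpha>" and T: "aperture_of \<omega> \<alpha> = \<theta>0" and c: "c > 0"
      and u: "\<And>p. p \<in> closure (sector \<theta>0) - {0} \<Longrightarrow>
         u p = c * separated_solution (branch \<omega> \<alpha>) \<alpha> (G \<alpha>) p"
      unfolding positive_multiple_on_def by blast
    interpret angular_profile lam Lam \<alpha> "branch \<omega> \<alpha>" "G \<alpha>" by (rule loc[OF adm])
    have A: "aperture = \<theta>0" using ap[OF adm] T by simp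
    have u': "u p = c * (norm p powr \<alpha> * profile (branch \<omega> \<alpha>) \<alpha> (Xi (signed_angle p)))"
      if p: "p \<in> closure (sector \<theta>0) - {0}" for p
      unfolding u[OF p] separated_solution_def E[OF adm T p] ..
    show "positive_homogeneous_solution lam Lam \<theta>0 u"
      by (rule positive_homogeneous_solutionI[OF pos \<theta>0 E_cont[unfolded A] E_exp[unfolded A]
            E_end[unfolded A] jet[unfolded A] solution[unfolded A] c u'])
  qed
qed

lemma two_positive_solutions:
  assumes pos: "0 < lam" "0 < Lam" and \<theta>0: "0 < \<theta>0" "\<theta>0 < pi"
    and \<omega>: "\<omega> = Lam / lam"
    and G: "\<And>\<alpha>. admissible \<omega> \<alpha> \<Longrightarrow> angular_map (branch \<omega> \<alpha>) \<alpha> (G \<alpha>)"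
  shows "\<exists>\<alpha>m \<alpha>p. \<alpha>m < 0 \<and> 0 < \<alpha>p \<and> {\<alpha>. admissible \<omega> \<alpha> \<and> G \<alpha> 1 = \<theta>0} = {\<alpha>m, \<alpha>p} \<and>
    (\<forall>u. positive_homogeneous_solution lam Lam \<theta>0 u \<longleftrightarrow>
       positive_multiple_on (closure (sector \<theta>0) - {0}) u
         (separated_solution (if \<theta>0 \<le> pi / 2 then \<omega> else 1 / \<omega>) \<alpha>p (G \<alpha>p)) \<or>
       positive_multiple_on (closure (sector \<theta>0) - {0}) u
         (separated_solution \<omega> \<alpha>m (G \<alpha>m)))"
proof -
  have \<omega>_pos: "0 < \<omega>" using pos \<omega> by simp
  obtain \<alpha>m \<alpha>p where e: "\<alpha>m < 0" "0 < \<alpha>p" "{\<alpha>. admissible \<omega> \<alpha> \<and> aperture_of \<omega> \<alpha> = \<theta>0} = {\<alpha>m, \<alpha>p}"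
    "1 \<le> \<alpha>p \<longleftrightarrow> \<theta>0 \<le> pi / 2"
    using exponents[OF \<omega>_pos \<theta>0(1)] by blast
  have ap: "G \<alpha> 1 = aperture_of \<omega> \<alpha>" if "admissible \<omega> \<alpha>" for \<alpha>
    unfolding aperture_of_def
    by (rule angular_map_aperture[OF branch_pos[OF \<omega>_pos] _ G[OF that]]) (use that in \<open>simp add: admissible_def\<close>)
  have set: "{\<alpha>. admissible \<omega> \<alpha> \<and> G \<alpha> 1 = \<theta>0} = {\<alpha>m, \<alpha>p}"
    unfolding e(3)[symmetric] using ap by (intro Collect_cong) (metis)
  have br: "branch \<omega> \<alpha>p = (if \<theta>0 \<le> pi / 2 then \<omega> else 1 / \<omega>)" "branch \<omega> \<alpha>m = \<omega>"
    using e by (auto simp: branch_def)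
  have ex: "(\<exists>\<alpha>. admissible \<omega> \<alpha> \<and> aperture_of \<omega> \<alpha> = \<theta>0 \<and> P \<alpha>) \<longleftrightarrow> P \<alpha>p \<or> P \<alpha>m" for P
  proof -
    have "(\<exists>\<alpha>. admissible \<omega> \<alpha> \<and> aperture_of \<omega> \<alpha> = \<theta>0 \<and> P \<alpha>) \<longleftrightarrow> (\<exists>\<alpha>\<in>{\<alpha>m, \<alpha>p}. P \<alpha>)"
      unfolding e(3)[symmetric] by blast
    then show ?thesis by blast
  qed
  show ?thesis
    by (intro exI[of _ \<alpha>m] exI[of _ \<alpha>p] conjI e(1,2) set allI)
      (simp only: positive_solutions_characterization[OF pos \<theta>0 \<omega> G] ex br)
qed

section \<open>The maps of the theorem\<close>

lemma angular_map_G_fun: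
  assumes \<omega>: "1 \<le> \<omega>" and adm: "admissible \<omega> \<alpha>"
  shows "angular_map (branch \<omega> \<alpha>) \<alpha> (G_fun \<omega> \<alpha>)"
proof -
  have a: "0 < \<alpha> * (\<alpha> - 1 + branch \<omega> \<alpha>)" using adm by (simp add: admissible_def)
  have \<omega>0: "0 < 1 / \<omega>" "1 / \<omega> \<le> 1" using \<omega> by auto
  define A B where "A = \<alpha> - 1 + 1 / \<omega>" and "B = \<alpha> - 1 + \<omega>"
  have "G_fun \<omega> \<alpha> = angle_map (branch \<omega> \<alpha>) \<alpha>"
  proof (cases "0 < \<alpha> \<and> \<alpha> < 1")
    case True
    then have br: "branch \<omega> \<alpha> = 1 / \<omega>" by (simp add: branch_def)
    have A: "0 < A" using a True by (simp add: br A_def zero_less_mult_iff)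
    have AB: "0 < A * B" using A \<omega> True by (intro mult_pos_pos) (simp_all add: B_def)
    have lt: "1 - 1 / \<omega> < \<alpha>" using A unfolding A_def by linarith
    show ?thesis
      unfolding br fun_eq_iff G_fun_def angle_map_def Let_def coefA_def coefB_def A_def[symmetric]
        B_def[symmetric] divide_divide_eq_right div_by_1 mult_1
      using True AB lt by (simp add: real_sqrt_divide B_def[symmetric])
  next
    case False
    then have br: "branch \<omega> \<alpha> = \<omega>" by (auto simp: branch_def)
    have AB: "0 < B * A"
    proof (cases "\<alpha> < 0")
      case True
      then have "B < 0" using a by (simp add: br B_def zero_less_mult_iff)
      moreover have "A \<le> B" using \<omega> \<omega>0 unfolding A_def B_def by linarith
      ultimately show ?thesis by (intro mult_neg_neg) auto
    next
      case n: False
      have "\<alpha> \<noteq> 0" using a by auto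
      then have "1 \<le> \<alpha>" using n False by linarith
      then show ?thesis unfolding A_def B_def by (intro mult_pos_pos) (use \<omega> \<omega>0 in linarith)+
    qed
    have "1 \<le> \<alpha> \<or> \<alpha> < 0 \<and> \<not> 1 - 1 / \<omega> < \<alpha>" using False a \<omega>0 by (cases "\<alpha> = 0") (simp, linarith)
    then show ?thesis
      unfolding br fun_eq_iff G_fun_def angle_map_def Let_def coefA_def coefB_def A_def[symmetric] B_def[symmetric]
      using AB by (auto simp: mult.commute[of A B])
  qed
  then show ?thesis using angular_map_angle_map[OF branch_pos a] \<omega> by simp
qed

text \<open>
  For \<open>0 < \<alpha> < 1\<close> the factor \<open>A\<close> may have any sign, and for \<open>\<alpha> < 0\<close> so may \<open>B\<close>; the three signs
  give the \<open>arctan\<close>, the linear and the \<open>artanh\<close> formula.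
\<close>
lemma angular_map_H_fun:
  assumes \<omega>: "1 \<le> \<omega>" and \<alpha>: "\<alpha> \<noteq> 0"
  shows "angular_map (branch (1 / \<omega>) \<alpha>) \<alpha> (H_fun \<omega> \<alpha>)"
proof -
  have \<omega>0: "0 < 1 / \<omega>" "1 / \<omega> \<le> 1" using \<omega> by auto
  define A B where "A = \<alpha> - 1 + 1 / \<omega>" and "B = \<alpha> - 1 + \<omega>"
  have cases_A: "1 - 1 / \<omega> < \<alpha> \<longleftrightarrow> 0 < A" "\<alpha> = 1 - 1 / \<omega> \<longleftrightarrow> A = 0"
    and cases_B: "1 - \<omega> < \<alpha> \<longleftrightarrow> 0 < B" "\<alpha> = 1 - \<omega> \<longleftrightarrow> B = 0"
    unfolding A_def B_def by linarith+
  note H = H_fun_def Let_def coefA_def coefB_def A_def[symmetric] B_def[symmetric] cases_A cases_B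
  have "0 < \<alpha> * (\<alpha> - 1 + branch (1 / \<omega>) \<alpha>) \<and> H_fun \<omega> \<alpha> = angle_map (branch (1 / \<omega>) \<alpha>) \<alpha>"
  proof (cases "0 < \<alpha> \<and> \<alpha> < 1")
    case True
    then have br: "branch (1 / \<omega>) \<alpha> = \<omega>" by (simp add: branch_def)
    have B: "0 < B" using True \<omega> by (simp add: B_def)
    have sgn: "0 < B * A \<longleftrightarrow> 0 < A" "B * A < 0 \<longleftrightarrow> A < 0" using B by (simp_all add: zero_less_mult_iff mult_less_0_iff)
    show ?thesis
      unfolding br fun_eq_iff H angle_map_def sgn
      using True B by (auto simp: mult.commute[of A B])
  next
    case False
    then have br: "branch (1 / \<omega>) \<alpha> = 1 / \<omega>" by (auto simp: branch_def)
    have \<alpha>': "1 \<le> \<alpha> \<or> \<alpha> < 0" using False \<alpha> by linarith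
    then have A: "1 \<le> \<alpha> \<and> 0 < A \<and> 0 < B \<or> \<alpha> < 0 \<and> A < 0"
      unfolding A_def B_def using \<omega> \<omega>0 by linarith
    have sgn: "0 < A * B \<longleftrightarrow> 0 < A \<and> 0 < B \<or> A < 0 \<and> B < 0" "A * B < 0 \<longleftrightarrow> 0 < A \<and> B < 0 \<or> A < 0 \<and> 0 < B"
      by (auto simp: zero_less_mult_iff mult_less_0_iff)
    have inv: "1 / (1 / \<omega>) = \<omega>" "B / (\<omega> * A) = 1 / \<omega> * B / A" "x / sqrt \<omega> = sqrt (1 / \<omega>) * x" for x
      by (simp_all add: real_sqrt_divide)
    have "0 < \<alpha> * A" using A by (auto simp: zero_less_mult_iff)
    then show ?thesis
      unfolding br fun_eq_iff H angle_map_def inv sgn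
      using A by (auto simp: real_sqrt_divide)
  qed
  then show ?thesis using angular_map_angle_map[OF branch_pos, of "1 / \<omega>" \<alpha>] \<omega> by simp
qed

lemma admissible_iff_g_dom:
  assumes \<omega>: "1 \<le> \<omega>"
  shows "admissible \<omega> \<alpha> \<longleftrightarrow> \<alpha> \<in> g_dom \<omega>"
proof -
  have \<omega>0: "0 < 1 / \<omega>" "1 / \<omega> \<le> 1" using \<omega> by auto
  consider "\<alpha> < 0" | "\<alpha> = 0" | "0 < \<alpha>" "\<alpha> < 1" | "1 \<le> \<alpha>" by linarith
  then show ?thesis
  proof cases
    case 1
    then have "\<not> 1 - 1 / \<omega> < \<alpha>" using \<omega>0 by linarith
    moreover have "admissible \<omega> \<alpha> \<longleftrightarrow> \<alpha> - 1 + \<omega> < 0"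
      using 1 by (simp add: admissible_def branch_def zero_less_mult_iff)
    ultimately show ?thesis unfolding g_dom_def by (simp only: Un_iff lessThan_iff greaterThan_iff simp_thms) linarith
  next
    case 2
    then have "\<not> 1 - 1 / \<omega> < \<alpha>" "\<not> \<alpha> < 1 - \<omega>" using \<omega> \<omega>0 by linarith+
    then show ?thesis unfolding g_dom_def using 2 by (simp add: admissible_def)
  next
    case 3 then show ?thesis using \<omega> \<omega>0 by (auto simp: admissible_def branch_def g_dom_def zero_less_mult_iff)
  next
    case 4
    then have "1 - 1 / \<omega> < \<alpha>" using \<omega>0 by linarith
    then show ?thesis using 4 \<omega> by (simp add: admissible_def branch_def g_dom_def zero_less_mult_iff)
  qed
qed

lemma admissible_iff_h_dom:
  assumes \<omega>: "1 \<le> \<omega>"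
  shows "admissible (1 / \<omega>) \<alpha> \<longleftrightarrow> \<alpha> \<in> h_dom"
proof -
  have \<omega>0: "0 < 1 / \<omega>" "1 / \<omega> \<le> 1" using \<omega> by auto
  consider "\<alpha> < 0" | "\<alpha> = 0" | "0 < \<alpha>" "\<alpha> < 1" | "1 \<le> \<alpha>" by linarith
  then show ?thesis
  proof cases
    case 1
    then have "\<alpha> - 1 + 1 / \<omega> < 0" using \<omega>0 by linarith
    then show ?thesis using 1 by (simp add: admissible_def branch_def h_dom_def zero_less_mult_iff)
  next
    case 2 then show ?thesis by (simp add: admissible_def h_dom_def)
  next
    case 3 then show ?thesis using \<omega> \<omega>0 by (auto simp: admissible_def branch_def h_dom_def zero_less_mult_iff)
  next
    case 4
    then have "0 < \<alpha> - 1 + 1 / \<omega>" using \<omega>0 by linarith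
    then show ?thesis using 4 by (simp add: admissible_def branch_def h_dom_def zero_less_mult_iff)
  qed
qed

lemma profile1_eq: "0 < \<omega> \<Longrightarrow> profile1 \<omega> \<alpha> = profile \<omega> \<alpha>"
  by (simp add: fun_eq_iff profile1_def profile_def algebra_simps)

lemma profile2_eq:
  assumes "0 < \<omega>"
  shows "profile2 \<omega> \<alpha> = profile (1 / \<omega>) \<alpha>"
proof -
  have "(\<alpha> - 1 + \<omega>) / (\<omega> * (\<alpha> - 1 + 1 / \<omega>)) = (1 / \<omega> * (\<alpha> - 1) + 1) / (\<alpha> - 1 + 1 / \<omega>)"
    using assms by (simp add: divide_simps)
  then show ?thesis by (simp add: fun_eq_iff profile2_def profile_def)
qed

section \<open>Negative solutions\<close>

lemma C2_with_hessian_uminus: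
  assumes "C2_with_hessian U \<phi> H"
  shows "C2_with_hessian U (\<lambda>x. - \<phi> x) (\<lambda>x. - H x)"
proof -
  obtain g where cont: "continuous_on U H" and g: "\<And>x. x \<in> U \<Longrightarrow>
        (\<phi> has_derivative (\<lambda>h. g x \<bullet> h)) (at x) \<and> (g has_derivative (\<lambda>h. H x *v h)) (at x)"
    using assms unfolding C2_with_hessian_def by blast
  have m: "(- A) *v h = - (A *v h)" for A :: "real^'b^'b" and h
    by (simp add: vec_eq_iff matrix_vector_mult_def sum_negf)
  have d: "((\<lambda>x. - \<phi> x) has_derivative (\<lambda>h. (- g x) \<bullet> h)) (at x)"
    "((\<lambda>x. - g x) has_derivative (\<lambda>h. (- H x) *v h)) (at x)" if "x \<in> U" for x
    using has_derivative_minus[of \<phi>] has_derivative_minus[of g] g[OF that] by (simp_all add: m)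
  show ?thesis
    unfolding C2_with_hessian_def by (intro conjI continuous_on_minus cont exI[of _ "\<lambda>x. - g x"] ballI d)
qed

lemma viscosity_sub_uminus:
  assumes F: "\<And>M. F' (- M) = - F M" and u: "viscosity_subsolution F \<Omega> u"
  shows "viscosity_supersolution F' \<Omega> (\<lambda>x. - u x)"
  unfolding viscosity_supersolution_def
proof (intro allI impI, elim conjE)
  fix U \<phi> H x0
  assume *: "open U" "x0 \<in> U" "U \<subseteq> \<Omega>" "C2_with_hessian U \<phi> H" "\<forall>x\<in>U. - u x - \<phi> x \<ge> - u x0 - \<phi> x0"
  then have "\<forall>x\<in>U. u x - (- \<phi> x) \<le> u x0 - (- \<phi> x0)" by force
  with u * C2_with_hessian_uminus[OF *(4)] have "0 \<le> F (- H x0)"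
    unfolding viscosity_subsolution_def by blast
  then show "F' (H x0) \<le> 0" using F[of "- H x0"] by simp
qed

lemma viscosity_super_uminus:
  assumes F: "\<And>M. F' (- M) = - F M" and u: "viscosity_supersolution F \<Omega> u"
  shows "viscosity_subsolution F' \<Omega> (\<lambda>x. - u x)"
  unfolding viscosity_subsolution_def
proof (intro allI impI, elim conjE)
  fix U \<phi> H x0
  assume *: "open U" "x0 \<in> U" "U \<subseteq> \<Omega>" "C2_with_hessian U \<phi> H" "\<forall>x\<in>U. - u x - \<phi> x \<le> - u x0 - \<phi> x0"
  then have "\<forall>x\<in>U. u x - (- \<phi> x) \<ge> u x0 - (- \<phi> x0)" by force
  with u * C2_with_hessian_uminus[OF *(4)] have "F (- H x0) \<le> 0"
    unfolding viscosity_supersolution_def by blast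
  then show "0 \<le> F' (H x0)" using F[of "- H x0"] by simp
qed

lemma homogeneous_solution_uminus:
  assumes "homogeneous_solution lam Lam \<theta>0 u"
  shows "homogeneous_solution Lam lam \<theta>0 (\<lambda>p. - u p)"
proof -
  from assms have cont: "continuous_on (closure (sector \<theta>0) - {0}) u"
    and hom: "\<exists>\<alpha>. homogeneous_on (closure (sector \<theta>0) - {0}) \<alpha> u"
    and visc: "continuous_on (sector \<theta>0) u" "viscosity_subsolution (pucci_minus lam Lam) (sector \<theta>0) u"
      "viscosity_supersolution (pucci_minus lam Lam) (sector \<theta>0) u"
    and bdry: "\<forall>p \<in> frontier (sector \<theta>0) - {0}. u p = 0"
    unfolding homogeneous_solution_def viscosity_solution_def by simp_all
  from hom obtain \<alpha> f where "\<forall>p\<in>closure (sector \<theta>0) - {0}. u p = norm p powr \<alpha> * f (p /\<^sub>R norm p)"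
    unfolding homogeneous_on_def by blast
  then have "homogeneous_on (closure (sector \<theta>0) - {0}) \<alpha> (\<lambda>p. - u p)"
    unfolding homogeneous_on_def by (intro exI[of _ "\<lambda>d. - f d"]) simp
  then show ?thesis
    unfolding homogeneous_solution_def viscosity_solution_def
    using cont visc bdry viscosity_sub_uminus[OF pucci_minus_uminus visc(2)]
      viscosity_super_uminus[OF pucci_minus_uminus visc(3)]
    by (auto intro: continuous_on_minus)
qed

text \<open>Negation exchanges \<open>lam\<close> and \<open>Lam\<close> in the operator and sub- and supersolutions.\<close>
lemma negative_iff_positive_uminus:
  "negative_homogeneous_solution lam Lam \<theta>0 v \<longleftrightarrow> positive_homogeneous_solution Lam lam \<theta>0 (\<lambda>p. - v p)"
  using homogeneous_solution_uminus[of lam Lam \<theta>0 v] homogeneous_solution_uminus[of Lam lam \<theta>0 "\<lambda>p. - v p"]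
  by (auto simp: negative_homogeneous_solution_def positive_homogeneous_solution_def)

lemma positive_multiple_on_uminus:
  "positive_multiple_on S (\<lambda>p. - v p) (\<lambda>p. - w p) \<longleftrightarrow> positive_multiple_on S v w"
  by (simp add: positive_multiple_on_def)

theorem theorem2p4:
  fixes lam Lam \<omega> \<theta>0 :: real
  assumes "0 < lam" and "lam \<le> Lam" and "\<omega> = Lam / lam"
    and "0 < \<theta>0" and "\<theta>0 < pi"
  shows "(\<exists>\<alpha>m \<alpha>p. \<alpha>m < 0 \<and> 0 < \<alpha>p \<and>
            {\<alpha> \<in> g_dom \<omega>. g_fun \<omega> \<alpha> = \<theta>0} = {\<alpha>m, \<alpha>p} \<and>
            (\<forall>u. positive_homogeneous_solution lam Lam \<theta>0 u \<longleftrightarrow>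
               positive_multiple_on (closure (sector \<theta>0) - {0}) u (u_plus \<omega> \<theta>0 \<alpha>p) \<or>
               positive_multiple_on (closure (sector \<theta>0) - {0}) u (u_minus \<omega> \<alpha>m)))
       \<and> (\<exists>\<beta>m \<beta>p. \<beta>m < 0 \<and> 0 < \<beta>p \<and>
            {\<beta> \<in> h_dom. h_fun \<omega> \<beta> = \<theta>0} = {\<beta>m, \<beta>p} \<and>
            (\<forall>v. negative_homogeneous_solution lam Lam \<theta>0 v \<longleftrightarrow>
               positive_multiple_on (closure (sector \<theta>0) - {0}) v (v_plus \<omega> \<theta>0 \<beta>p) \<or>
               positive_multiple_on (closure (sector \<theta>0) - {0}) v (v_minus \<omega> \<beta>m)))"
proof -
  have pos: "0 < Lam" using assms by simp
  have \<omega>1: "1 \<le> \<omega>" using assms by simp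
  have \<omega>0: "0 < \<omega>" using \<omega>1 by simp
  note prof = profile1_eq[OF \<omega>0] profile2_eq[OF \<omega>0]
  have u: "separated_solution (if \<theta>0 \<le> pi / 2 then \<omega> else 1 / \<omega>) \<alpha> (G_fun \<omega> \<alpha>) = u_plus \<omega> \<theta>0 \<alpha>"
    "separated_solution \<omega> \<alpha> (G_fun \<omega> \<alpha>) = u_minus \<omega> \<alpha>" for \<alpha>
    by (simp_all add: fun_eq_iff separated_solution_def u_plus_def phi_plus_def u_minus_def phi_minus_def G_inv_def prof)
  have g: "{\<alpha>. admissible \<omega> \<alpha> \<and> G_fun \<omega> \<alpha> 1 = \<theta>0} = {\<alpha> \<in> g_dom \<omega>. g_fun \<omega> \<alpha> = \<theta>0}"
    by (simp add: admissible_iff_g_dom[OF \<omega>1] g_fun_def)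
  note positive = two_positive_solutions[OF assms(1) pos assms(4,5,3) angular_map_G_fun[OF \<omega>1], unfolded g u]
  have H: "angular_map (branch (1 / \<omega>) \<alpha>) \<alpha> (H_fun \<omega> \<alpha>)" if "admissible (1 / \<omega>) \<alpha>" for \<alpha>
    by (rule angular_map_H_fun[OF \<omega>1]) (use that in \<open>auto simp: admissible_def\<close>)
  have v: "separated_solution (if \<theta>0 \<le> pi / 2 then 1 / \<omega> else 1 / (1 / \<omega>)) \<alpha> (H_fun \<omega> \<alpha>)
      = (\<lambda>p. - v_plus \<omega> \<theta>0 \<alpha> p)"
    "separated_solution (1 / \<omega>) \<alpha> (H_fun \<omega> \<alpha>) = (\<lambda>p. - v_minus \<omega> \<alpha> p)" for \<alpha>
    by (simp_all add: fun_eq_iff separated_solution_def v_plus_def psi_plus_def v_minus_def psi_minus_def H_inv_def prof)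
  have h: "{\<alpha>. admissible (1 / \<omega>) \<alpha> \<and> H_fun \<omega> \<alpha> 1 = \<theta>0} = {\<beta> \<in> h_dom. h_fun \<omega> \<beta> = \<theta>0}"
    by (simp add: admissible_iff_h_dom[OF \<omega>1] h_fun_def)
  have swap: "1 / \<omega> = lam / Lam" using assms by simp
  obtain \<beta>m \<beta>p where \<beta>: "\<beta>m < 0 \<and> 0 < \<beta>p \<and> {\<beta> \<in> h_dom. h_fun \<omega> \<beta> = \<theta>0} = {\<beta>m, \<beta>p}"
    and sol: "\<And>u. positive_homogeneous_solution Lam lam \<theta>0 u \<longleftrightarrow>
       positive_multiple_on (closure (sector \<theta>0) - {0}) u (\<lambda>p. - v_plus \<omega> \<theta>0 \<beta>p p) \<or>
       positive_multiple_on (closure (sector \<theta>0) - {0}) u (\<lambda>p. - v_minus \<omega> \<beta>m p)"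
    using two_positive_solutions[OF pos assms(1,4,5) swap H, unfolded h v] by blast
  have "\<forall>v. negative_homogeneous_solution lam Lam \<theta>0 v \<longleftrightarrow>
       positive_multiple_on (closure (sector \<theta>0) - {0}) v (v_plus \<omega> \<theta>0 \<beta>p) \<or>
       positive_multiple_on (closure (sector \<theta>0) - {0}) v (v_minus \<omega> \<beta>m)"
    unfolding negative_iff_positive_uminus sol positive_multiple_on_uminus by blast
  with positive \<beta> show ?thesis by blast
qed

end
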